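(* Let $R$ be a non-discrete irreducible, continuous ring. Every element of $\mathrm{GL}(R)$ that is algebraic over the center $\mathrm{Z}(R)$ is contained in a locally solvable, extremely amenable topological subgroup of $\mathrm{GL}(R)$, where $\mathrm{GL}(R)$ carries the topology generated by the rank metric $d_R$.
   Context: A unital ring $R$ is (von Neumann) regular if for every $a\in R$ there is $b\in R$ with $aba=a$. For such $R$, the set $\mathrm{L}(R)=\{aR\mid a\in R\}$ ordered by inclusion is a complemented modular lattice. A continuous ring is a regular ring $R$ such that $\mathrm{L}(R)$ is a continuous geometry, i.e., additionally a complete lattice such that for every chain $C\subseteq \mathrm{L}(R)$ and every $x\in\mathrm{L}(R)$ one has $x\wedge\bigvee C=\bigvee\{x\wedge y\mid y\in C\}$ and $x\vee\bigwedge C=\bigwedge\{x\vee y\mid y\in C\}$. A ring is irreducible if it is non-zero and not isomorphic to a direct product of two non-zero rings. A rank function on a regular ring $R$ is a map $\rho\colon R\to[0,1]$ with $\rho(1)=1$, $\rho(ab)\le\min\{\rho(a),\rho(b)\}$ for all $a,b\in R$, $\rho(e+f)=\rho(e)+\rho(f)$ for all idempotents $e,f$ with $ef=fe=0$, and $\rho(a)>0$ for $a\ne0$. Every irreducible, continuous ring $R$ has a unique rank function $\rho_R$ (von Neumann), and $d_R(a,b):=\rho_R(a-b)$ is a complete metric on $R$; $R$ is non-discrete if the topology generated by $d_R$ is not discrete. $\mathrm{GL}(R)$ is the group of units of $R$; with the topology generated by $d_R$ it is a topological group, and topological subgroups carry the relative topology. The center $\mathrm{Z}(R)$ of an irreducible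 regular ring is a field; $a\in R$ is algebraic over $\mathrm{Z}(R)$ if $p(a)=0$ for some non-zero polynomial $p\in\mathrm{Z}(R)[X]$. A group is locally solvable if each of its finitely generated subgroups is solvable. A topological group is extremely amenable if every (jointly) continuous action of it on a non-empty compact Hausdorff space has a fixed point. *)

theory Defs
  imports "HOL-Algebra.Algebra" "HOL-Analysis.Analysis"
begin

definition regular_ring :: "('a, 'm) ring_scheme \<Rightarrow> bool" where
  "regular_ring R \<longleftrightarrow>
     ring R \<and> (\<forall>a\<in>carrier R. \<exists>b\<in>carrier R. a \<otimes>\<^bsub>R\<^esub> b \<otimes>\<^bsub>R\<^esub> a = a)"

definition principal_right_ideals :: "('a, 'm) ring_scheme \<Rightarrow> 'a set gorder" where
  "principal_right_ideals R =
     \<lparr>carrier = {a <#\<^bsub>R\<^esub> carrier R | a. a \<in> carrier R}, eq = (=), le = (\<subseteq>)\<rparr>"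

definition modular_lattice :: "('a, 'm) gorder_scheme \<Rightarrow> bool" where
  "modular_lattice L \<longleftrightarrow> lattice L \<and>
     (\<forall>x\<in>carrier L. \<forall>y\<in>carrier L. \<forall>z\<in>carrier L.
        x \<sqsubseteq>\<^bsub>L\<^esub> z \<longrightarrow> x \<squnion>\<^bsub>L\<^esub> (y \<sqinter>\<^bsub>L\<^esub> z) = (x \<squnion>\<^bsub>L\<^esub> y) \<sqinter>\<^bsub>L\<^esub> z)"

definition complemented_lattice :: "('a, 'm) gorder_scheme \<Rightarrow> bool" where
  "complemented_lattice L \<longleftrightarrow> bounded_lattice L \<and>
     (\<forall>x\<in>carrier L. \<exists>y\<in>carrier L. x \<sqinter>\<^bsub>L\<^esub> y = \<bottom>\<^bsub>L\<^esub> \<and> x \<squnion>\<^bsub>L\<^esub> y = \<top>\<^bsub>L\<^esub>)"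

definition continuous_geometry :: "('a, 'm) gorder_scheme \<Rightarrow> bool" where
  "continuous_geometry L \<longleftrightarrow>
     complete_lattice L \<and> modular_lattice L \<and> complemented_lattice L \<and>
     (\<forall>C x. C \<subseteq> carrier L \<and> (\<forall>y\<in>C. \<forall>z\<in>C. y \<sqsubseteq>\<^bsub>L\<^esub> z \<or> z \<sqsubseteq>\<^bsub>L\<^esub> y) \<and> x \<in> carrier L \<longrightarrow>
        x \<sqinter>\<^bsub>L\<^esub> (\<Squnion>\<^bsub>L\<^esub>C) = \<Squnion>\<^bsub>L\<^esub>{x \<sqinter>\<^bsub>L\<^esub> y | y. y \<in> C} \<and>
        x \<squnion>\<^bsub>L\<^esub> (\<Sqinter>\<^bsub>L\<^esub>C) = \<Sqinter>\<^bsub>L\<^esub>{x \<squnion>\<^bsub>L\<^esub> y | y. y \<in> C})"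

definition continuous_ring :: "('a, 'm) ring_scheme \<Rightarrow> bool" where
  "continuous_ring R \<longleftrightarrow> regular_ring R \<and> continuous_geometry (principal_right_ideals R)"

text \<open>
  The factors range over rings on the type of elements of the ring itself.  This is no restriction,
  since both factors of a direct product embed into it; see \<open>irreducible_ringD\<close>.
\<close>

definition irreducible_ring :: "('a, 'm) ring_scheme \<Rightarrow> bool" where
  "irreducible_ring R \<longleftrightarrow> ring R \<and> carrier R \<noteq> {\<zero>\<^bsub>R\<^esub>} \<and>
     \<not> (\<exists>(S :: 'a ring) (T :: 'a ring). ring S \<and> ring T \<and>
          carrier S \<noteq> {\<zero>\<^bsub>S\<^esub>} \<and> carrier T \<noteq> {\<zero>\<^bsub>T\<^esub>} \<and> R \<simeq> RDirProd S T)"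

lemma irreducible_ringD:
  fixes S :: "('b, 'n) ring_scheme" and T :: "('c, 'k) ring_scheme"
  assumes irr: "irreducible_ring R" and S: "ring S" "carrier S \<noteq> {\<zero>\<^bsub>S\<^esub>}"
    and T: "ring T" "carrier T \<noteq> {\<zero>\<^bsub>T\<^esub>}"
  shows "\<not> R \<simeq> RDirProd S T"
proof
  interpret R: ring R using irr by (simp add: irreducible_ring_def)
  interpret S: ring S by (rule S)
  interpret T: ring T by (rule T)
  assume "R \<simeq> RDirProd S T"
  then obtain h where h: "h \<in> ring_iso R (RDirProd S T)"
    unfolding is_ring_iso_def by blast
  define k where "k = inv_into (carrier R) h"
  have bij: "bij_betw h (carrier R) (carrier S \<times> carrier T)"
    using h by (simp add: ring_iso_def RDirProd_carrier)
  have k: "inj_on k (carrier S \<times> carrier T)"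
    using bij unfolding k_def by (simp add: bij_betw_def inj_on_inv_into)
  define f where "f = (\<lambda>s. k (s, \<zero>\<^bsub>T\<^esub>))"
  define g where "g = (\<lambda>t. k (\<zero>\<^bsub>S\<^esub>, t))"
  have f: "inj_on f (carrier S)" and g: "inj_on g (carrier T)"
    using inj_onD[OF k] by (fastforce simp: f_def g_def intro!: inj_onI)+
  have "ring (image_ring f S)" "ring (image_ring g T)"
    using S.inj_imp_image_ring_is_ring[OF f] T.inj_imp_image_ring_is_ring[OF g] by auto
  moreover have isos: "f \<in> ring_iso S (image_ring f S)" "g \<in> ring_iso T (image_ring g T)"
    using inj_imp_image_ring_iso[OF f] inj_imp_image_ring_iso[OF g] by auto
  moreover have "carrier (image_ring f S) \<noteq> {\<zero>\<^bsub>image_ring f S\<^esub>}"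
    using S(2) f S.zero_closed unfolding image_ring_carrier image_ring_zero inj_on_def by blast
  moreover have "carrier (image_ring g T) \<noteq> {\<zero>\<^bsub>image_ring g T\<^esub>}"
    using T(2) g T.zero_closed unfolding image_ring_carrier image_ring_zero inj_on_def by blast
  moreover have "R \<simeq> RDirProd (image_ring f S) (image_ring g T)"
    using ring_iso_set_trans[OF h RDirProd_iso6[OF isos]] unfolding is_ring_iso_def by blast
  ultimately show False
    using irr unfolding irreducible_ring_def by blast
qed

definition rank_function :: "('a, 'm) ring_scheme \<Rightarrow> ('a \<Rightarrow> real) \<Rightarrow> bool" where
  "rank_function R \<rho> \<longleftrightarrow>
     \<rho> \<in> carrier R \<rightarrow>\<^sub>E {0..1} \<and>
     \<rho> \<one>\<^bsub>R\<^esub> = 1 \<and>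
     (\<forall>a\<in>carrier R. \<forall>b\<in>carrier R. \<rho> (a \<otimes>\<^bsub>R\<^esub> b) \<le> min (\<rho> a) (\<rho> b)) \<and>
     (\<forall>e\<in>carrier R. \<forall>f\<in>carrier R.
        e \<otimes>\<^bsub>R\<^esub> e = e \<and> f \<otimes>\<^bsub>R\<^esub> f = f \<and> e \<otimes>\<^bsub>R\<^esub> f = \<zero>\<^bsub>R\<^esub> \<and> f \<otimes>\<^bsub>R\<^esub> e = \<zero>\<^bsub>R\<^esub>
          \<longrightarrow> \<rho> (e \<oplus>\<^bsub>R\<^esub> f) = \<rho> e + \<rho> f) \<and>
     (\<forall>a\<in>carrier R. a \<noteq> \<zero>\<^bsub>R\<^esub> \<longrightarrow> \<rho> a > 0)"

text \<open>
  By a theorem of von Neumann, an irreducible continuous ring has exactly one rank function, so that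
  the description below is proper.  Rank functions are taken to be \<^const>\<open>undefined\<close> outside
  the carrier (\<open>\<rightarrow>\<^sub>E\<close>); otherwise they would not be unique as functions on the whole type.
\<close>

definition rank_of :: "('a, 'm) ring_scheme \<Rightarrow> 'a \<Rightarrow> real" where
  "rank_of R = (THE \<rho>. rank_function R \<rho>)"

text \<open>
  The locale \<^locale>\<open>Metric_space\<close> requires symmetry and non-negativity also outside the carrier,
  hence the value \<open>0\<close> there.
\<close>

definition rank_dist :: "('a, 'm) ring_scheme \<Rightarrow> 'a \<Rightarrow> 'a \<Rightarrow> real" where
  "rank_dist R a b =
     (if a \<in> carrier R \<and> b \<in> carrier R then rank_of R (a \<ominus>\<^bsub>R\<^esub> b) else 0)"

definition rank_topology :: "('a, 'm) ring_scheme \<Rightarrow> 'a topology" where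
  "rank_topology R = Metric_space.mtopology (carrier R) (rank_dist R)"

definition non_discrete_ring :: "('a, 'm) ring_scheme \<Rightarrow> bool" where
  "non_discrete_ring R \<longleftrightarrow> rank_topology R \<noteq> discrete_topology (carrier R)"

definition ring_center :: "('a, 'm) ring_scheme \<Rightarrow> 'a set" where
  "ring_center R = {z \<in> carrier R. \<forall>x\<in>carrier R. z \<otimes>\<^bsub>R\<^esub> x = x \<otimes>\<^bsub>R\<^esub> z}"

definition algebraic_over_center :: "('a, 'm) ring_scheme \<Rightarrow> 'a \<Rightarrow> bool" where
  "algebraic_over_center R a \<longleftrightarrow>
     (\<exists>p \<in> carrier (univ_poly R (ring_center R)).
        p \<noteq> \<zero>\<^bsub>univ_poly R (ring_center R)\<^esub> \<and> ring.eval R p a = \<zero>\<^bsub>R\<^esub>)"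

definition locally_solvable :: "('a, 'm) monoid_scheme \<Rightarrow> bool" where
  "locally_solvable G \<longleftrightarrow> group G \<and>
     (\<forall>F. finite F \<and> F \<subseteq> carrier G \<longrightarrow> solvable (G\<lparr>carrier := generate G F\<rparr>))"

definition topological_group :: "('a, 'm) monoid_scheme \<Rightarrow> 'a topology \<Rightarrow> bool" where
  "topological_group G T \<longleftrightarrow> group G \<and> topspace T = carrier G \<and>
     continuous_map (prod_topology T T) T (\<lambda>(x, y). x \<otimes>\<^bsub>G\<^esub> y) \<and>
     continuous_map T T (\<lambda>x. inv\<^bsub>G\<^esub> x)"

definition continuous_action ::
    "('a, 'm) monoid_scheme \<Rightarrow> 'a topology \<Rightarrow> 'b topology \<Rightarrow> ('a \<Rightarrow> 'b \<Rightarrow> 'b) \<Rightarrow> bool" where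
  "continuous_action G T S \<phi> \<longleftrightarrow> group_action G (topspace S) \<phi> \<and>
     continuous_map (prod_topology T S) S (\<lambda>(g, x). \<phi> g x)"

text \<open>
  HOL does not allow quantification over all compact Hausdorff spaces of all types.  Spaces of sets
  of sets of group elements suffice: every non-empty compact Hausdorff space acted upon contains the
  closure of an orbit, whose points are determined by the sets of group elements carrying the base
  point close to them.  The fixed point property for spaces over arbitrary types is derived in
  \<open>extremely_amenable_fixed_point\<close>.
\<close>

definition extremely_amenable :: "('a, 'm) monoid_scheme \<Rightarrow> 'a topology \<Rightarrow> bool" where
  "extremely_amenable G T \<longleftrightarrow> topological_group G T \<and>
     (\<forall>(S :: 'a set set topology) \<phi>.
        topspace S \<noteq> {} \<and> compact_space S \<and> Hausdorff_space S \<and> continuous_action G T S \<phi>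
          \<longrightarrow> (\<exists>x\<in>topspace S. \<forall>g\<in>carrier G. \<phi> g x = x))"

lemma extremely_amenable_fixed_point:
  fixes S :: "'b topology"
  assumes EA: "extremely_amenable G T"
    and S: "topspace S \<noteq> {}" "compact_space S" "Hausdorff_space S"
    and act: "continuous_action G T S \<phi>"
  shows "\<exists>x\<in>topspace S. \<forall>g\<in>carrier G. \<phi> g x = x"
proof -
  interpret group_action G "topspace S" \<phi>
    using act by (simp add: continuous_action_def)
  interpret G: group G
    using group_hom group_hom.axioms(1) by blast
  have T: "topspace T = carrier G"
    using EA by (simp add: extremely_amenable_def topological_group_def)
  have jcont: "continuous_map (prod_topology T S) S (\<lambda>(g, x). \<phi> g x)"
    using act by (simp add: continuous_action_def)
  obtain x0 where x0: "x0 \<in> topspace S" using S(1) by blast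
  define Orb where "Orb = (\<lambda>A. (\<lambda>g. \<phi> g x0) ` A)"
  define Y where "Y = S closure_of (Orb (carrier G))"
  have YX: "Y \<subseteq> topspace S" by (simp add: Y_def closure_of_subset_topspace)
  have Orb_X: "Orb (carrier G) \<subseteq> topspace S"
    using x0 element_image by (auto simp: Orb_def)
  have Y0: "x0 \<in> Y"
  proof -
    have "\<phi> \<one>\<^bsub>G\<^esub> x0 = x0" using x0 id_eq_one by (metis restrict_apply')
    then have "x0 \<in> Orb (carrier G)" unfolding Orb_def by force
    then show ?thesis unfolding Y_def using closure_of_subset[OF Orb_X] by blast
  qed
  have cont: "continuous_map S S (\<phi> g)" if "g \<in> carrier G" for g
  proof -
    have "continuous_map S (prod_topology T S) (\<lambda>x. (g, x))"
      using that T by (simp add: continuous_map_pairedI)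
    from continuous_map_compose[OF this jcont] show ?thesis by (simp add: o_def)
  qed
  have Yinv: "\<phi> g y \<in> Y" if g: "g \<in> carrier G" and y: "y \<in> Y" for g y
  proof -
    have "\<phi> g ` Orb (carrier G) \<subseteq> Orb (carrier G)"
    proof (clarsimp simp: Orb_def)
      fix h assume h: "h \<in> carrier G"
      have "\<phi> g (\<phi> h x0) = \<phi> (g \<otimes>\<^bsub>G\<^esub> h) x0"
        using composition_rule[OF x0 g h] by simp
      then show "\<phi> g (\<phi> h x0) \<in> (\<lambda>g. \<phi> g x0) ` carrier G" using g h by auto
    qed
    then have "S closure_of (\<phi> g ` Orb (carrier G)) \<subseteq> Y"
      unfolding Y_def by (rule closure_of_mono)
    moreover have "\<phi> g ` (S closure_of Orb (carrier G)) \<subseteq> S closure_of (\<phi> g ` Orb (carrier G))"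
      using cont[OF g] continuous_map_image_closure_subset by blast
    ultimately show ?thesis using y unfolding Y_def by blast
  qed
  define k where "k = (\<lambda>y. {A. A \<subseteq> carrier G \<and> y \<in> S closure_of (Orb A)})"
  have k: "inj_on k Y"
  proof (rule inj_onI, rule ccontr)
    fix y z assume y: "y \<in> Y" and z: "z \<in> Y" and eq: "k y = k z" and "y \<noteq> z"
    then obtain U V where UV: "openin S U" "openin S V" "y \<in> U" "z \<in> V" "disjnt U V"
      using S(3) YX unfolding Hausdorff_space_def by (metis subsetD)
    define A where "A = {g \<in> carrier G. \<phi> g x0 \<in> U}"
    have OA: "Orb A = U \<inter> Orb (carrier G)" by (auto simp: A_def Orb_def)
    have "y \<in> S closure_of (Orb A)"
      unfolding OA using y UV openin_Int_closure_of_subset[OF UV(1)] unfolding Y_def by blast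
    then have "A \<in> k y" by (auto simp: k_def A_def)
    then have "z \<in> S closure_of (Orb A)" using eq by (auto simp: k_def)
    then obtain w where "w \<in> Orb A" "w \<in> V" using UV unfolding in_closure_of by blast
    then show False using OA UV by (auto simp: disjnt_def)
  qed
  define h where "h = inv_into Y k"
  have hk: "h (k y) = y" if "y \<in> Y" for y using that k by (simp add: h_def)
  define Z where "Z = pullback_topology (k ` Y) h (subtopology S Y)"
  have Ztop: "topspace Z = k ` Y"
    using hk YX unfolding Z_def topspace_pullback_topology by auto
  have hcont: "continuous_map Z (subtopology S Y) h"
    unfolding Z_def
    using continuous_map_pullback[OF continuous_map_id[of "subtopology S Y"]] by (metis id_comp)
  have kcont: "continuous_map (subtopology S Y) Z k"
    unfolding Z_def
  proof (rule continuous_map_pullback')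
    show "continuous_map (subtopology S Y) (subtopology S Y) (h \<circ> k)"
      by (rule continuous_map_eq[OF continuous_map_id]) (use hk in auto)
    show "topspace (subtopology S Y) \<subseteq> k -` k ` Y" by auto
  qed
  have "homeomorphic_maps (subtopology S Y) Z k h"
    unfolding homeomorphic_maps_def using hcont kcont hk Ztop by auto
  then have homeo: "subtopology S Y homeomorphic_space Z"
    unfolding homeomorphic_space_def by blast
  have "closedin S Y" by (simp add: Y_def)
  then have "compact_space (subtopology S Y)"
    using S(2) by (simp add: closedin_compact_space compact_space_subtopology)
  then have Zc: "compact_space Z" using homeo homeomorphic_compact_space by blast
  have ZH: "Hausdorff_space Z"
    using homeo homeomorphic_Hausdorff_space Hausdorff_space_subtopology[OF S(3)] by blast
  define \<psi> where "\<psi> = (\<lambda>g. \<lambda>z\<in>topspace Z. k (\<phi> g (h z)))"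
  have \<psi>k: "\<psi> g (k y) = k (\<phi> g y)" if "y \<in> Y" for g y
    using that hk Ztop by (simp add: \<psi>_def)
  have comp: "\<phi> g (\<phi> f y) = \<phi> (g \<otimes>\<^bsub>G\<^esub> f) y" if "g \<in> carrier G" "f \<in> carrier G" "y \<in> Y" for g f y
    using composition_rule[of y g f] that YX by auto
  have one: "\<phi> \<one>\<^bsub>G\<^esub> y = y" if "y \<in> Y" for y
    using that YX id_eq_one by (metis restrict_apply' subsetD)
  have bij: "\<psi> g \<in> Bij (topspace Z)" if g: "g \<in> carrier G" for g
  proof -
    have "bij_betw (\<psi> g) (topspace Z) (topspace Z)"
    proof (rule bij_betwI[where g = "\<psi> (inv\<^bsub>G\<^esub> g)"])
      show "\<psi> g \<in> topspace Z \<rightarrow> topspace Z" "\<psi> (inv\<^bsub>G\<^esub> g) \<in> topspace Z \<rightarrow> topspace Z"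
        using g Yinv \<psi>k unfolding Ztop by auto
    qed (use g Yinv \<psi>k comp one Ztop in auto)
    then show ?thesis by (auto simp: Bij_def \<psi>_def)
  qed
  have act': "group_action G (topspace Z) \<psi>"
  proof (unfold group_action_def group_hom_def group_hom_axioms_def, intro conjI)
    show "group G" by (rule G.group_axioms)
    show "group (BijGroup (topspace Z))" by (rule group_BijGroup)
    show "\<psi> \<in> hom G (BijGroup (topspace Z))"
    proof (rule homI)
      fix g f assume g: "g \<in> carrier G" and f: "f \<in> carrier G"
      have "\<psi> (g \<otimes>\<^bsub>G\<^esub> f) = compose (topspace Z) (\<psi> g) (\<psi> f)"
      proof
        fix z show "\<psi> (g \<otimes>\<^bsub>G\<^esub> f) z = compose (topspace Z) (\<psi> g) (\<psi> f) z"
        proof (cases "z \<in> topspace Z")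
          case True
          then obtain y where "y \<in> Y" "z = k y" using Ztop by auto
          then show ?thesis using True g f Yinv \<psi>k comp by (simp add: compose_def)
        next
          case False
          then show ?thesis by (simp add: compose_def \<psi>_def)
        qed
      qed
      then show "\<psi> (g \<otimes>\<^bsub>G\<^esub> f) = \<psi> g \<otimes>\<^bsub>BijGroup (topspace Z)\<^esub> \<psi> f"
        using bij g f by (simp add: BijGroup_def)
    qed (use bij in \<open>simp add: BijGroup_def\<close>)
  qed
  have "continuous_map (prod_topology T Z) Z (\<lambda>(g, z). \<psi> g z)"
  proof -
    have hX: "continuous_map Z S h" using hcont continuous_map_in_subtopology by blast
    have 1: "continuous_map (prod_topology T Z) (prod_topology T S) (\<lambda>p. (fst p, h (snd p)))"
    proof (rule continuous_map_pairedI)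
      show "continuous_map (prod_topology T Z) T fst" by (rule continuous_map_fst)
      show "continuous_map (prod_topology T Z) S (\<lambda>p. h (snd p))"
        using continuous_map_compose[OF continuous_map_snd hX] by (simp add: o_def)
    qed
    have 2: "continuous_map (prod_topology T Z) S (\<lambda>p. \<phi> (fst p) (h (snd p)))"
      using continuous_map_compose[OF 1 jcont] by (simp add: o_def)
    have "continuous_map (prod_topology T Z) (subtopology S Y) (\<lambda>p. \<phi> (fst p) (h (snd p)))"
      unfolding continuous_map_in_subtopology using 2 Yinv hk T Ztop by auto
    from continuous_map_compose[OF this kcont]
    have 3: "continuous_map (prod_topology T Z) Z (\<lambda>p. k (\<phi> (fst p) (h (snd p))))"
      by (simp add: o_def)
    show ?thesis
      by (rule continuous_map_eq[OF 3]) (auto simp: \<psi>_def)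
  qed
  then have "continuous_action G T Z \<psi>" using act' by (simp add: continuous_action_def)
  moreover have "topspace Z \<noteq> {}" using Y0 Ztop by auto
  ultimately obtain z where z: "z \<in> topspace Z" "\<forall>g\<in>carrier G. \<psi> g z = z"
    using EA Zc ZH unfolding extremely_amenable_def by blast
  then obtain y where y: "y \<in> Y" "z = k y" using Ztop by auto
  have "\<phi> g y = y" if "g \<in> carrier G" for g
    using z(2) y that \<psi>k Yinv k by (metis inj_onD)
  then show ?thesis using y YX by blast
qed

end

theory Submission
  imports Defs
begin

text \<open>
  Comparability, halving and finiteness of idempotents give the unique rank function of \<open>R\<close>; if its
  positive values are not bounded away from zero, then \<open>R\<close> has no minimal idempotents. Let \<open>a\<close> be an
  algebraic unit. The unit element is a finite sum of orthogonal idempotents \<open>e\<close> commuting with \<open>a\<close>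
  such that some corner \<open>F R F\<close> embeds into the commutant of \<open>a\<close> within \<open>e R e\<close>, the embedding
  mapping \<open>F\<close> to \<open>e\<close>. Repeated halving of \<open>F\<close> yields, for every \<open>n\<close>, orthogonal idempotents \<open>Q n k\<close>,
  \<open>k < 2 ^ n\<close>, with sum \<open>1\<close> that commute with \<open>a\<close> and have rank at most \<open>C / 2 ^ n\<close>.

  The elements \<open>u n z = (\<Sum>k<2 ^ n. Q n k * a ^ z k)\<close>, for integer vectors \<open>z\<close>, form an abelian group
  that contains \<open>a\<close>. Changing one coordinate of \<open>z\<close> changes \<open>u n z\<close> by rank at most \<open>C / 2 ^ n\<close>. By
  the Efron--Stein inequality, a continuous function on a compact space is therefore almost constant
  along the part of an orbit parametrized by a box \<open>{0..<N} ^ (2 ^ n)\<close>, and a large box is almost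
  invariant under any given translation. So some point of the orbit is almost fixed by finitely many
  group elements, and compactness provides a fixed point.
\<close>

section \<open>Regular rings and the lattice of principal right ideals\<close>

text \<open>An algebraic unit need not be diagonalizable, so eigenspaces cannot provide the
  commuting idempotents. Maximal independent strings \<open>x\<close>, \<open>c x\<close>, ...,
  \<open>c ^ (m - 1) x\<close> replace them. Maximality of \<open>m\<close> forces one monic central
  relation of degree \<open>m\<close> on all of \<open>e\<close>; without a dimension to count with,
  the room for that argument comes from the rank, some ideals being made small by halving. On the
  direct sum of the ideals \<open>c ^ i F R\<close>, \<open>i < m\<close>, the commutant of
  \<open>c\<close> then contains \<open>F R F\<close> acting diagonally. The idempotent onto that
  sum is split off, which lowers the order of the rest.

  The continuity axioms act in two ways: they exclude infinitely many orthogonal copies of a nonzero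
  idempotent, which gives finiteness, and they supply the suprema that Zorn's lemma requires.

  A function of \<open>K = 2 ^ n\<close> coordinates that each matter by order \<open>1 / K\<close>
  has variance of order \<open>1 / K\<close>. The box is not invariant but loses only order
  \<open>K / N\<close> of its points, hence \<open>n\<close> is fixed before the side length
  \<open>N\<close>.\<close>

definition pri :: "'r::ring_1 \<Rightarrow> 'r set" where
  "pri a = range (\<lambda>x. a * x)"

definition idem :: "'r::ring_1 \<Rightarrow> bool" where
  "idem e \<longleftrightarrow> e * e = e"

definition isum :: "'r::ring_1 set \<Rightarrow> 'r set \<Rightarrow> 'r set" where
  "isum A B = {x + y | x y. x \<in> A \<and> y \<in> B}"

text \<open>For idempotents this says that \<open>a R\<close> is isomorphic to a direct summand of \<open>b R\<close>.\<close>

definition subord :: "'r::ring_1 \<Rightarrow> 'r \<Rightarrow> bool" (infix "\<preceq>" 50) where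
  "a \<preceq> b \<longleftrightarrow> (\<exists>x y. a = x * b * y)"

definition is_join :: "'r::ring_1 set set \<Rightarrow> 'r set \<Rightarrow> bool" where
  "is_join \<A> S \<longleftrightarrow> S \<in> range pri \<and> (\<forall>A\<in>\<A>. A \<subseteq> S) \<and>
     (\<forall>T\<in>range pri. (\<forall>A\<in>\<A>. A \<subseteq> T) \<longrightarrow> S \<subseteq> T)"

section \<open>Principal right ideals, their sums, and subordination\<close>

lemma mult_assoc_subst: "a * b = c \<Longrightarrow> a * (b * x) = c * (x::'r::ring_1)"
  by (metis mult.assoc)

lemma pri_iff: "x \<in> pri a \<longleftrightarrow> (\<exists>s. x = a * s)"
  by (auto simp: pri_def)

lemma pri_self [simp]: "a \<in> pri a"
  by (metis mult_1_right pri_iff)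

lemma pri_mult [simp]: "a * s \<in> pri a"
  by (auto simp: pri_iff)

lemma pri_zero [simp]: "0 \<in> pri a"
  by (metis mult_zero_right pri_iff)

lemma pri_add: "x \<in> pri a \<Longrightarrow> y \<in> pri a \<Longrightarrow> x + y \<in> pri a"
  by (metis distrib_left pri_iff)

lemma pri_diff: "x \<in> pri a \<Longrightarrow> y \<in> pri a \<Longrightarrow> x - y \<in> pri a"
  by (metis right_diff_distrib pri_iff)

lemma pri_minus: "x \<in> pri a \<Longrightarrow> - x \<in> pri a"
  by (metis mult_minus_right pri_iff)

lemma pri_mult_right: "x \<in> pri a \<Longrightarrow> x * s \<in> pri a"
  by (metis mult.assoc pri_iff)

lemma pri_sum: "(\<And>i. i \<in> I \<Longrightarrow> x i \<in> pri a) \<Longrightarrow> sum x I \<in> pri a"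
  by (induction I rule: infinite_finite_induct) (auto intro: pri_add)

lemma pri_subset_iff: "pri a \<subseteq> pri b \<longleftrightarrow> a \<in> pri b"
  by (metis pri_iff pri_mult_right pri_self subset_iff)

lemma pri_idem: "idem e \<Longrightarrow> x \<in> pri e \<longleftrightarrow> e * x = x"
  by (metis idem_def mult.assoc pri_iff)

lemma pri_0 [simp]: "pri (0::'r::ring_1) = {0}"
  by (auto simp: pri_def)

lemma pri_eq_0: "pri a = {0} \<longleftrightarrow> a = (0::'r::ring_1)"
  by (metis pri_0 pri_self singletonD)

lemma idem_0 [simp]: "idem 0" and idem_1 [simp]: "idem 1"
  by (auto simp: idem_def)

lemma isum_iff: "x \<in> isum A B \<longleftrightarrow> (\<exists>a\<in>A. \<exists>b\<in>B. x = a + b)"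
  by (auto simp: isum_def)

lemma isum_pri_iff: "x \<in> isum (pri a) (pri b) \<longleftrightarrow> (\<exists>s t. x = a * s + b * t)"
  by (auto simp: isum_def pri_iff)

lemma isum_commute: "isum A B = isum B A"
  by (auto simp: isum_def) (metis add.commute)+

lemma isum_upper: "pri a \<subseteq> isum (pri a) (pri b)" "pri b \<subseteq> isum (pri a) (pri b)"
  unfolding isum_def by (auto, metis add.right_neutral pri_zero, metis add.left_neutral pri_zero)

lemma isum_least: "pri a \<subseteq> pri c \<Longrightarrow> pri b \<subseteq> pri c \<Longrightarrow> isum (pri a) (pri b) \<subseteq> pri c"
  unfolding isum_def using pri_add by blast

lemma subordI: "a = x * b * y \<Longrightarrow> a \<preceq> b"
  by (auto simp: subord_def)

lemma subord_refl [simp]: "a \<preceq> a"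
  by (rule subordI[of _ 1 _ 1]) simp

lemma subord_trans [trans]: "a \<preceq> b \<Longrightarrow> b \<preceq> c \<Longrightarrow> a \<preceq> c"
  unfolding subord_def by (metis mult.assoc)

lemma subord_mult_right: "a * b \<preceq> a"
  by (rule subordI[of _ 1 _ b]) simp

lemma subord_mult_left: "a * b \<preceq> b"
  by (rule subordI[of _ a _ 1]) simp

lemma subord_pri: "a \<in> pri b \<Longrightarrow> a \<preceq> b"
  by (metis pri_iff subord_mult_right)

lemma zero_subord [simp]: "0 \<preceq> a"
  by (rule subordI[of _ 0 _ 0]) simp

lemma subord_zero [simp]: "a \<preceq> 0 \<longleftrightarrow> a = 0"
  by (auto simp: subord_def)

lemma subord_one [simp]: "a \<preceq> 1"
  by (rule subordI[of _ a _ 1]) simp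

lemma subord_idemE:
  assumes "e \<preceq> f" "idem e" "idem f"
  obtains x y where "x * y = e" "e * x = x" "x * f = x" "f * y = y" "y * e = y"
proof -
  obtain x y where xy: "e = x * f * y" using assms by (auto simp: subord_def)
  have f: "f * f = f" and e: "e * e = e" using assms by (auto simp: idem_def)
  have "(e * x * f) * (f * y * e) = e * (x * (f * f) * y) * e" by (simp add: mult.assoc)
  also have "\<dots> = e" by (simp add: f e xy[symmetric])
  finally show thesis
    by (intro that[of "e * x * f" "f * y * e"])
      (simp_all add: mult.assoc e f e[THEN mult_assoc_subst] f[THEN mult_assoc_subst])
qed

lemma subord_subidem:
  assumes "f \<preceq> e" "idem e" "idem f"
  obtains e' where "idem e'" "e' * e = e'" "e * e' = e'" "e' \<preceq> f" "f \<preceq> e'"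
proof -
  obtain x y where xy: "x * y = f" "f * x = x" "x * e = x" "e * y = y" "y * f = y"
    using subord_idemE[OF assms(1,3,2)] .
  show thesis
  proof (rule that[of "y * x"])
    show "idem (y * x)" unfolding idem_def
      by (simp add: mult.assoc xy xy(1)[THEN mult_assoc_subst])
    show "y * x * e = y * x" "e * (y * x) = y * x"
      by (simp_all add: mult.assoc xy xy(4)[THEN mult_assoc_subst])
    show "y * x \<preceq> f" by (rule subordI[of _ y _ x]) (simp add: xy)
    show "f \<preceq> y * x"
    proof (rule subordI)
      show "f = x * (y * x) * y" using assms(3)
        by (simp add: mult.assoc xy xy(1)[THEN mult_assoc_subst] idem_def)
    qed
  qed
qed

lemma subord_add:
  assumes "e1 \<preceq> f1" "e2 \<preceq> f2" and f: "idem f1" "idem f2" "f1 * f2 = 0" "f2 * f1 = 0"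
  shows "e1 + e2 \<preceq> f1 + f2"
proof -
  obtain x1 y1 x2 y2 where e: "e1 = x1 * f1 * y1" "e2 = x2 * f2 * y2"
    using assms by (auto simp: subord_def)
  have ff: "f1 * f1 = f1" "f2 * f2 = f2" using f by (simp_all add: idem_def)
  have "(x1 * f1 + x2 * f2) * (f1 + f2) * (f1 * y1 + f2 * y2) = e1 + e2"
    by (simp add: algebra_simps e f ff ff[THEN mult_assoc_subst] f(3,4)[THEN mult_assoc_subst])
  then show ?thesis by (metis subordI)
qed

text \<open>
  The intersection of all principal right ideals above \<open>Z\<close> and \<open>C\<close> is \<open>Z + C\<close>, since sums of
  principal right ideals are principal. So \<open>lower_continuous\<close> says that an element of all \<open>Z + C\<close>
  already belongs to \<open>Z + I\<close> for some \<open>I\<close> below the chain.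
\<close>

locale continuous_regular_ring =
  fixes ty :: "'r::ring_1 itself"
  assumes regular: "\<exists>b. a * b * a = (a::'r)"
    and join_exists: "\<A> \<subseteq> range (pri :: 'r \<Rightarrow> 'r set) \<Longrightarrow> \<exists>S. is_join \<A> S"
    and upper_continuous: "\<lbrakk>\<C> \<subseteq> range (pri :: 'r \<Rightarrow> 'r set); \<forall>A\<in>\<C>. \<forall>B\<in>\<C>. A \<subseteq> B \<or> B \<subseteq> A;
        Z \<in> range pri; is_join \<C> S; \<forall>C\<in>\<C>. Z \<inter> C = {0}\<rbrakk> \<Longrightarrow> Z \<inter> S = {0}"
    and lower_continuous: "\<lbrakk>\<C> \<subseteq> range (pri :: 'r \<Rightarrow> 'r set); \<forall>A\<in>\<C>. \<forall>B\<in>\<C>. A \<subseteq> B \<or> B \<subseteq> A;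
        \<C> \<noteq> {}; Z \<in> range pri; \<forall>C\<in>\<C>. \<forall>T\<in>range pri. Z \<subseteq> T \<and> C \<subseteq> T \<longrightarrow> y \<in> T\<rbrakk>
        \<Longrightarrow> \<exists>I\<in>range pri. (\<forall>C\<in>\<C>. I \<subseteq> C) \<and> (\<forall>T\<in>range pri. Z \<subseteq> T \<and> I \<subseteq> T \<longrightarrow> y \<in> T)"
    and indecomposable: "(e::'r) * e = e \<Longrightarrow> (\<forall>x. e * x = x * e) \<Longrightarrow> e = 0 \<or> e = 1"
begin

section \<open>Idempotent generators, complements and projections\<close>

lemma pri_idem_exists:
  obtains e b where "idem (e::'r)" "pri e = pri a" "e = a * b" "e * a = a"
proof -
  obtain b where b: "a * b * a = a" using regular by blast
  have i: "idem (a * b)" unfolding idem_def by (metis b mult.assoc)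
  have "pri (a * b) = pri a"
    by (metis b pri_mult pri_subset_iff subset_antisym)
  then show thesis using i b that by blast
qed

text \<open>The ideal generated by \<open>1 - t' * t\<close> is the right annihilator of
  \<open>t\<close>. Since \<open>s\<close> vanishes there, \<open>s\<close> equals
  \<open>s * t' * t\<close>.\<close>

lemma left_factor:
  assumes "\<And>x. t * x = 0 \<Longrightarrow> s * x = (0::'r)"
  obtains q where "s = q * t"
proof -
  obtain t' where t': "t * t' * t = t" using regular by blast
  have "t * (1 - t' * t) = 0" by (simp add: right_diff_distrib t' flip: mult.assoc)
  then have "s * (1 - t' * t) = 0" by (rule assms)
  then have "s = (s * t') * t" by (simp add: algebra_simps)
  then show thesis by (rule that)
qed

lemma kernel_idem:
  obtains k where "idem (k::'r)" "\<And>x. t * x = 0 \<longleftrightarrow> k * x = x"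
proof -
  obtain t' where t': "t * t' * t = t" using regular by blast
  define k where "k = 1 - t' * t"
  have "idem k" unfolding idem_def k_def
    by (simp add: algebra_simps) (metis t' mult.assoc)
  moreover have "t * x = 0 \<longleftrightarrow> k * x = x" for x
  proof
    assume "k * x = x"
    then have "t' * (t * x) = 0" by (simp add: k_def algebra_simps)
    then show "t * x = 0" by (metis t' mult.assoc mult_zero_right)
  qed (simp add: k_def algebra_simps)
  ultimately show thesis using that by blast
qed

text \<open>\<open>(1 - h') * f'\<close> has the same right annihilator as \<open>f'\<close>,
  because the ideals of \<open>f'\<close> and \<open>h'\<close> meet trivially. Hence
  \<open>f'\<close> can be recovered from its image modulo \<open>h R\<close> by a left
  factor.\<close>

lemma projection:
  assumes "pri f \<inter> pri h = {0::'r}"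
  obtains p where "\<And>x. x \<in> pri f \<Longrightarrow> p * x = x" "\<And>x. x \<in> pri h \<Longrightarrow> p * x = 0"
proof -
  obtain f' where f': "idem f'" "pri f' = pri f" by (rule pri_idem_exists)
  obtain h' where h': "idem h'" "pri h' = pri h" by (rule pri_idem_exists)
  have "f' * x = 0" if "(1 - h') * f' * x = 0" for x
  proof -
    have "f' * x = h' * (f' * x)" using that by (simp add: algebra_simps)
    then have "f' * x \<in> pri f' \<inter> pri h'" by (metis IntI pri_mult)
    then show ?thesis using assms f' h' by auto
  qed
  then obtain q where q: "f' = q * ((1 - h') * f')" by (rule left_factor)
  show thesis
  proof (rule that[of "q * (1 - h')"])
    fix x assume "x \<in> pri f"
    then have x: "f' * x = x" using f' pri_idem by blast
    then show "q * (1 - h') * x = x" using q by (metis mult.assoc)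
  next
    fix x assume "x \<in> pri h"
    then have "h' * x = x" using h' pri_idem by blast
    then show "q * (1 - h') * x = 0" by (simp add: algebra_simps)
  qed
qed

lemma isum_idem:
  assumes e: "idem (e::'r)"
  obtains g where "idem g" "e * g = 0" "g * e = 0" "pri (e + g) = isum (pri e) (pri b)" "g \<preceq> b"
proof -
  \<comment> \<open>\<open>c\<close> is \<open>b\<close> with its component in \<open>e R\<close>
    removed. The right factor \<open>1 - e\<close> in \<open>g\<close> makes \<open>g\<close>
    orthogonal to \<open>e\<close> on both sides, while \<open>g * c = c\<close> is kept.\<close>
  define c where "c = (1 - e) * b"
  obtain d where d: "c * d * c = c" using regular by blast
  define g where "g = c * d * (1 - e)"
  have ee: "e * e = e" using e by (simp add: idem_def)
  have ec: "e * c = 0" by (simp add: c_def algebra_simps ee ee[THEN mult_assoc_subst])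
  then have ec': "(1 - e) * c = c" by (simp add: algebra_simps)
  have gg: "g * g = g"
  proof -
    have "g * g = c * d * ((1 - e) * c) * d * (1 - e)" by (simp add: g_def mult.assoc)
    then show ?thesis by (simp add: ec' d g_def)
  qed
  have eg: "e * g = 0" by (simp add: g_def mult.assoc[symmetric] ec)
  have ge: "g * e = 0" by (simp add: g_def mult.assoc algebra_simps ee)
  have gc: "g * c = c" by (metis d ec' g_def mult.assoc)
  have gb: "g = b * (d * (1 - e)) - e * (b * (d * (1 - e)))"
    by (simp add: g_def c_def left_diff_distrib mult.assoc)
  have be: "b = c + e * b" by (simp add: c_def algebra_simps)
  have "pri (e + g) = isum (pri e) (pri b)"
  proof
    show "pri (e + g) \<subseteq> isum (pri e) (pri b)"
    proof
      fix x assume "x \<in> pri (e + g)"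
      then obtain s where "x = (e + g) * s" by (auto simp: pri_iff)
      then have "x = e * (s - b * (d * (1 - e)) * s) + b * (d * (1 - e) * s)"
        by (subst (asm) gb) (simp add: algebra_simps)
      then show "x \<in> isum (pri e) (pri b)" unfolding isum_iff by (metis pri_mult)
    qed
    have 1: "e \<in> pri (e + g)" "c \<in> pri (e + g)"
      unfolding pri_iff using ee ge gc ec
      by (metis add.right_neutral distrib_right, metis add.left_neutral distrib_right)
    then have "b \<in> pri (e + g)" using be pri_add pri_mult_right by metis
    then show "isum (pri e) (pri b) \<subseteq> pri (e + g)"
      using 1 isum_least pri_subset_iff by blast
  qed
  moreover have "g \<preceq> b"
    by (rule subordI[of _ "1 - e" _ "d * (1 - e)"]) (simp add: g_def c_def mult.assoc)
  ultimately show thesis using that gg eg ge idem_def by blast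
qed

lemma isum_principal: obtains c where "pri (c::'r) = isum (pri a) (pri b)"
  by (metis isum_idem pri_idem_exists)

text \<open>\<open>e * x\<close> lies in \<open>f R\<close> exactly when \<open>(1 - f) * e\<close>
  kills \<open>x\<close>, so the intersection is \<open>e\<close> applied to an annihilator, which
  is generated by an idempotent.\<close>

lemma Int_principal: obtains c where "pri (c::'r) = pri a \<inter> pri b"
proof -
  obtain e where e: "idem e" "pri e = pri a" by (rule pri_idem_exists)
  obtain f where f: "idem f" "pri f = pri b" by (rule pri_idem_exists)
  obtain k where k: "idem k" "\<And>x. (1 - f) * e * x = 0 \<longleftrightarrow> k * x = x"
    by (rule kernel_idem[of "(1 - f) * e"]) blast
  have "pri (e * k) = pri e \<inter> pri f"
  proof (intro equalityI subsetI)
    fix x assume "x \<in> pri (e * k)"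
    then obtain s where s: "x = e * (k * s)" by (auto simp: pri_iff mult.assoc)
    have "(1 - f) * e * (k * s) = 0" by (metis k idem_def mult.assoc)
    then have "f * x = x" by (simp add: s algebra_simps)
    then show "x \<in> pri e \<inter> pri f" using f(1) by (auto simp: pri_idem s)
  next
    fix x assume "x \<in> pri e \<inter> pri f"
    then have "e * x = x" "f * x = x" using e f pri_idem by blast+
    then have "(1 - f) * e * x = 0" by (simp add: algebra_simps)
    then have "k * x = x" using k(2) by blast
    then have "x = e * k * x" using \<open>e * x = x\<close> by (simp add: mult.assoc)
    then show "x \<in> pri (e * k)" by (metis pri_mult)
  qed
  then show thesis using that e f by metis
qed

lemma idem_below:
  assumes "idem (f::'r)" "pri a \<subseteq> pri f"
  obtains e where "idem e" "pri e = pri a" "f * e = e" "e * f = e"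
proof -
  obtain e where e: "idem e" "pri e = pri a" by (rule pri_idem_exists)
  have ff: "f * f = f" and ee: "e * e = e" using assms e by (auto simp: idem_def)
  have fe: "f * e = e" using assms e pri_idem pri_self by blast
  show thesis
  proof (rule that[of "e * f"])
    show "idem (e * f)" unfolding idem_def by (metis ee fe mult.assoc)
    show "pri (e * f) = pri a"
      using e ee fe by (metis mult.assoc pri_mult pri_subset_iff subset_antisym)
    show "f * (e * f) = e * f" "e * f * f = e * f" by (simp_all add: fe ff mult.assoc mult_assoc_subst)
  qed
qed

lemma relative_complement:
  assumes "pri a \<subseteq> pri (b::'r)"
  obtains d where "pri d \<subseteq> pri b" "pri a \<inter> pri d = {0}" "isum (pri a) (pri d) = pri b"
proof -
  obtain f where f: "idem f" "pri f = pri b" by (rule pri_idem_exists)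
  obtain e where e: "idem e" "pri e = pri a" "f * e = e" "e * f = e"
    using idem_below assms f by metis
  have ff: "f * f = f" and ee: "e * e = e" using f e by (auto simp: idem_def)
  have d: "idem (f - e)" by (simp add: idem_def algebra_simps e ff ee)
  have 1: "pri (f - e) \<subseteq> pri f" unfolding pri_subset_iff pri_idem[OF f(1)]
    by (simp add: algebra_simps ff e)
  have 2: "pri e \<inter> pri (f - e) = {0}"
  proof -
    have "x = 0" if "e * x = x" "(f - e) * x = x" for x
    proof -
      have "x = (f - e) * (e * x)" using that by simp
      also have "\<dots> = 0" by (simp add: algebra_simps e ee mult.assoc[symmetric])
      finally show ?thesis .
    qed
    then show ?thesis using e(1) d by (auto simp: pri_idem)
  qed
  have 3: "isum (pri e) (pri (f - e)) = pri f"
  proof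
    show "isum (pri e) (pri (f - e)) \<subseteq> pri f"
      by (rule isum_least[OF _ 1]) (simp add: pri_subset_iff pri_idem[OF f(1)] e(3))
    show "pri f \<subseteq> isum (pri e) (pri (f - e))"
    proof
      fix x assume "x \<in> pri f"
      then have "x = e * x + (f - e) * x" by (simp add: pri_idem[OF f(1)] left_diff_distrib)
      then show "x \<in> isum (pri e) (pri (f - e))" unfolding isum_iff by (metis pri_mult)
    qed
  qed
  show thesis using that[of "f - e"] 1 2 3 e f by simp
qed

text \<open>Projection onto \<open>b R\<close> along \<open>c R\<close> is injective on
  \<open>a R\<close>, because \<open>a R\<close> meets \<open>c R\<close> trivially;
  \<open>left_factor\<close> inverts it.\<close>

lemma perspective_subord:
  assumes "pri a \<inter> pri c = {0::'r}" "pri b \<inter> pri c = {0}" "pri a \<subseteq> isum (pri b) (pri c)"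
  shows "a \<preceq> b"
proof -
  obtain p where p: "\<And>x. x \<in> pri b \<Longrightarrow> p * x = x" "\<And>x. x \<in> pri c \<Longrightarrow> p * x = 0"
    by (rule projection[OF assms(2)]) blast
  have sp: "\<exists>s t. x = b * s + c * t \<and> p * x = b * s" if "x \<in> pri a" for x
  proof -
    have "x \<in> isum (pri b) (pri c)" by (rule subsetD[OF assms(3) that])
    then have "\<exists>s t. x = b * s + c * t" by (simp only: isum_pri_iff)
    then obtain s t where st: "x = b * s + c * t" by (elim exE)
    have "p * x = p * (b * s) + p * (c * t)" by (simp add: st distrib_left)
    then have "p * x = b * s" using p by simp
    then show ?thesis using st by blast
  qed
  have "a * x = 0" if "p * a * x = 0" for x
  proof -
    obtain s t where "a * x = b * s + c * t" "p * (a * x) = b * s" using sp[of "a * x"] by auto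
    moreover have "p * (a * x) = 0" using that by (simp add: mult.assoc)
    ultimately have "a * x = c * t" by simp
    then have "a * x \<in> pri c" by simp
    moreover have "a * x \<in> pri a" by simp
    ultimately show ?thesis using assms(1) by blast
  qed
  then obtain q where "a = q * (p * a)" by (rule left_factor)
  moreover obtain s where "p * a = b * s" using sp[of a] by auto
  ultimately show ?thesis by (metis mult.assoc subordI)
qed

section \<open>Primeness and comparability\<close>

lemma prime_idem:
  assumes "idem (e::'r)" "idem f" "e \<noteq> 0" "f \<noteq> 0"
  shows "\<exists>r. f * r * e \<noteq> 0"
proof (rule ccontr)
  assume "\<nexists>r. f * r * e \<noteq> 0"
  then have 0: "f * r * e = 0" for r by blast
  \<comment> \<open>The join \<open>h R\<close> of all \<open>x e R\<close> is shown to have a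
    central generator \<open>h\<close>, hence \<open>h = 1\<close>. On the other hand
    \<open>f R e = 0\<close> puts every \<open>x * e\<close> into \<open>(1 - f) R\<close>.\<close>
  obtain S where S: "is_join (range (\<lambda>x. pri (x * e))) S" using join_exists[of "range (\<lambda>x. pri (x * e))"] by blast
  then obtain h0 where "S = pri h0" unfolding is_join_def by blast
  then obtain h where h: "idem h" "S = pri h" using pri_idem_exists by metis
  have hh: "h * h = h" using h by (simp add: idem_def)
  have up: "x * e \<in> pri h" for x
    using S h unfolding is_join_def by (metis pri_subset_iff rangeI)
  have least: "pri h \<subseteq> pri t" if "\<And>x. x * e \<in> pri t" for t
    using S h that unfolding is_join_def by (auto simp: pri_subset_iff)
  have unit: "h * (u * h) = u * h" if u: "u * u' = 1" "u' * u = 1" for u u'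
  proof -
    have "x * e \<in> pri (u' * h)" for x
    proof -
      have "h * (u * x * e) = u * x * e" using up[of "u * x"] pri_idem h by blast
      then have "x * e = u' * h * (u * x * e)" by (metis u(2) mult.assoc mult_1_left)
      then show ?thesis by (metis pri_mult)
    qed
    then have "h \<in> pri (u' * h)" using least pri_subset_iff by blast
    then obtain s where "h = u' * h * s" by (auto simp: pri_iff)
    then have "u * h = h * s" by (metis u(1) mult.assoc mult_1_left)
    then show ?thesis by (metis hh mult.assoc)
  qed
  have n1: "(1 - h) * r * h = 0" for r
  proof -
    let ?n = "(1 - h) * r * h"
    have h1: "h * (1 - h) = 0" by (simp add: algebra_simps hh)
    have hn: "h * ?n = 0" by (simp add: mult.assoc[symmetric] h1)
    have nn: "?n * ?n = 0" by (metis hn mult.assoc mult_zero_right)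
    have "(1 + ?n) * (1 - ?n) = 1" "(1 - ?n) * (1 + ?n) = 1" using nn by (simp_all only: algebra_simps) simp_all
    then have "h * ((1 + ?n) * h) = (1 + ?n) * h" by (rule unit)
    moreover have "(1 + ?n) * h = h + ?n" by (simp add: distrib_right mult.assoc hh)
    ultimately show ?thesis using hn hh by (simp add: distrib_left)
  qed
  have n2: "h * r * (1 - h) = 0" for r
  proof -
    let ?x = "h * r * (1 - h)"
    obtain y where y: "?x * y * ?x = ?x" using regular by blast
    have "?x * y * ?x = h * r * ((1 - h) * y * h) * r * (1 - h)" by (simp add: mult.assoc)
    then show ?thesis using y n1[of y] by simp
  qed
  have "h * x = x * h" for x
    using n1[of x] n2[of x] by (simp add: algebra_simps)
  then have "h = 0 \<or> h = 1" using indecomposable hh by blast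
  moreover have "h \<noteq> 0" using up[of 1] assms(3) by auto
  ultimately have h1: "h = 1" by blast
  have "x * e \<in> pri (1 - f)" for x
  proof -
    have "idem (1 - f)" using assms(2) by (simp add: idem_def algebra_simps)
    then show ?thesis using 0[of x] by (simp add: pri_idem algebra_simps)
  qed
  then have "(1::'r) \<in> pri (1 - f)" using least h1 by (metis pri_subset_iff)
  then obtain s where "1 = (1 - f) * s" by (auto simp: pri_iff)
  then have "f = f * ((1 - f) * s)" by simp
  also have "\<dots> = 0" using assms(2) by (simp add: idem_def algebra_simps mult_assoc_subst)
  finally show False using assms by blast
qed

lemma prime:
  assumes "(a::'r) \<noteq> 0" "b \<noteq> 0"
  obtains r where "b * r * a \<noteq> 0"
proof -
  obtain e a' where e: "idem e" "pri e = pri a" "e = a * a'" by (metis pri_idem_exists)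
  obtain b' where b': "b * b' * b = b" using regular by blast
  have "idem (b' * b)" unfolding idem_def by (metis b' mult.assoc)
  moreover have "b' * b \<noteq> 0" using b' assms by (metis mult.assoc mult_zero_right)
  moreover have "e \<noteq> 0" using e assms pri_eq_0 by metis
  ultimately obtain r where "b' * b * r * e \<noteq> 0" using prime_idem e(1) by blast
  then have "b * r * a \<noteq> 0" using e(3) by (metis mult.assoc mult_zero_left mult_zero_right)
  then show thesis by (rule that)
qed

text \<open>Equal right annihilators make the map from \<open>u * s\<close> to \<open>v * s\<close>
  an isomorphism of \<open>u R\<close> and \<open>v R\<close>. With \<open>t = b * r * a\<close> and
  \<open>t * t' * t = t\<close>, the factor \<open>t' * t\<close> restricts \<open>a\<close> to a
  part on which left multiplication by \<open>b * r\<close> is injective.\<close>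

lemma common_part:
  assumes "pri a \<noteq> {0::'r}" "pri b \<noteq> {0}"
  obtains u v where "u \<in> pri a" "v \<in> pri b" "u \<noteq> 0" "v \<noteq> 0" "\<And>s. u * s = 0 \<longleftrightarrow> v * s = 0"
proof -
  obtain r where r: "b * r * a \<noteq> 0" using prime assms pri_eq_0 by metis
  define t where "t = b * r * a"
  obtain t' where t': "t * t' * t = t" using regular by blast
  define u where "u = a * t' * t"
  have "b * r * u = t" by (metis t' mult.assoc t_def u_def)
  show thesis
  proof (rule that[of u t])
    show "u \<in> pri a" "t \<in> pri b" by (simp_all add: u_def t_def mult.assoc)
    show "t \<noteq> 0" using r t_def by simp
    then show "u \<noteq> 0" using \<open>b * r * u = t\<close> by auto
    show "u * s = 0 \<longleftrightarrow> t * s = 0" for s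
      by (metis \<open>b * r * u = t\<close> u_def mult.assoc mult_zero_right)
  qed
qed

lemma chain_join_disjoint:
  assumes "\<C> \<subseteq> range (pri :: 'r \<Rightarrow> 'r set)" "\<forall>A\<in>\<C>. \<forall>B\<in>\<C>. A \<subseteq> B \<or> B \<subseteq> A"
    "is_join \<C> S" "\<forall>C\<in>\<C>. pri x \<inter> C = {0}"
  shows "pri x \<inter> S = {0}"
  using upper_continuous assms by blast

lemma chain_join_exists:
  assumes "\<C> \<subseteq> range (pri :: 'r \<Rightarrow> 'r set)"
  obtains s where "is_join \<C> (pri s)" "\<And>C. C \<in> \<C> \<Longrightarrow> C \<subseteq> pri s"
    "\<And>t. (\<And>C. C \<in> \<C> \<Longrightarrow> C \<subseteq> pri t) \<Longrightarrow> pri s \<subseteq> pri t"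
proof -
  obtain S where S: "is_join \<C> S" using join_exists assms by blast
  then obtain s where "S = pri s" unfolding is_join_def by blast
  then show thesis using that[of s] S unfolding is_join_def by blast
qed

text \<open>
  The ideal \<open>c\<close> is the graph of an isomorphism between submodules of \<open>a R\<close> and \<open>b R\<close>; a maximal
  graph exhausts one of them, as otherwise irreducibility provides a further common part.
\<close>

lemma perspectivity_exists:
  assumes "pri a \<inter> pri b = {0::'r}"
  obtains c where "pri c \<inter> pri a = {0}" "pri c \<inter> pri b = {0}" "pri c \<subseteq> isum (pri a) (pri b)"
    "pri a \<subseteq> isum (pri b) (pri c) \<or> pri b \<subseteq> isum (pri a) (pri c)"
proof -
  obtain ab where ab: "pri ab = isum (pri a) (pri b)" by (rule isum_principal)
  define \<A> where "\<A> = {C \<in> range pri. C \<inter> pri a = {0} \<and> C \<inter> pri b = {0} \<and> C \<subseteq> pri ab}"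
  have "\<exists>U\<in>\<A>. \<forall>C\<in>\<C>. C \<subseteq> U" if ch: "subset.chain \<A> \<C>" for \<C>
  proof -
    have C: "\<C> \<subseteq> range pri" "\<forall>A\<in>\<C>. \<forall>B\<in>\<C>. A \<subseteq> B \<or> B \<subseteq> A"
      and D: "\<forall>C\<in>\<C>. pri a \<inter> C = {0}" "\<forall>C\<in>\<C>. pri b \<inter> C = {0}" "\<And>C. C \<in> \<C> \<Longrightarrow> C \<subseteq> pri ab"
    proof -
      have 1: "\<C> \<subseteq> \<A>" and 2: "\<forall>A\<in>\<C>. \<forall>B\<in>\<C>. A \<subseteq> B \<or> B \<subseteq> A"
        using ch by (simp_all add: subset_chain_def)
      show "\<forall>A\<in>\<C>. \<forall>B\<in>\<C>. A \<subseteq> B \<or> B \<subseteq> A" by (rule 2)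
      show "\<C> \<subseteq> range pri" "\<forall>C\<in>\<C>. pri a \<inter> C = {0}" "\<forall>C\<in>\<C>. pri b \<inter> C = {0}"
        "\<And>C. C \<in> \<C> \<Longrightarrow> C \<subseteq> pri ab" using 1 by (auto simp: \<A>_def Int_commute)
    qed
    obtain s where s: "is_join \<C> (pri s)" "\<And>C. C \<in> \<C> \<Longrightarrow> C \<subseteq> pri s"
        "\<And>t. (\<And>C. C \<in> \<C> \<Longrightarrow> C \<subseteq> pri t) \<Longrightarrow> pri s \<subseteq> pri t"
      using chain_join_exists[OF C(1)] by metis
    have "pri a \<inter> pri s = {0}" "pri b \<inter> pri s = {0}"
      using chain_join_disjoint[OF C s(1)] D by blast+
    moreover have "pri s \<subseteq> pri ab" using s(3) D(3) by blast
    ultimately have "pri s \<in> \<A>" by (auto simp: \<A>_def)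
    then show ?thesis using s(2) by blast
  qed
  then have "\<exists>M\<in>\<A>. \<forall>C\<in>\<A>. M \<subseteq> C \<longrightarrow> C = M" by (rule subset_Zorn)
  then obtain M where M: "M \<in> \<A>" "\<And>C. C \<in> \<A> \<Longrightarrow> M \<subseteq> C \<Longrightarrow> C = M" by metis
  from M(1) obtain c where c: "M = pri c" "pri c \<inter> pri a = {0}" "pri c \<inter> pri b = {0}" "pri c \<subseteq> pri ab"
    by (auto simp: \<A>_def)
  have "pri a \<subseteq> isum (pri b) (pri c) \<or> pri b \<subseteq> isum (pri a) (pri c)"
  proof (rule ccontr)
    assume neg: "\<not> ?thesis"
    obtain bc where bc: "pri bc = isum (pri b) (pri c)" by (rule isum_principal)
    obtain ac where ac: "pri ac = isum (pri a) (pri c)" by (rule isum_principal)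
    obtain a1 where a1: "pri a1 = pri a \<inter> pri bc" by (rule Int_principal)
    obtain b1 where b1: "pri b1 = pri b \<inter> pri ac" by (rule Int_principal)
    obtain a2 where a2: "pri a2 \<subseteq> pri a" "pri a1 \<inter> pri a2 = {0}" "isum (pri a1) (pri a2) = pri a"
      using relative_complement[of a1 a] a1 by blast
    obtain b2 where b2: "pri b2 \<subseteq> pri b" "pri b1 \<inter> pri b2 = {0}" "isum (pri b1) (pri b2) = pri b"
      using relative_complement[of b1 b] b1 by blast
    have "pri a2 \<noteq> {0}"
    proof
      assume "pri a2 = {0}"
      then have "pri a \<subseteq> pri a1" using a2(3) by (auto simp: isum_def)
      then show False using neg a1 bc by blast
    qed
    moreover have "pri b2 \<noteq> {0}"
    proof
      assume "pri b2 = {0}"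
      then have "pri b \<subseteq> pri b1" using b2(3) by (auto simp: isum_def)
      then show False using neg b1 ac by blast
    qed
    ultimately obtain u v where uv: "u \<in> pri a2" "v \<in> pri b2" "u \<noteq> 0" "v \<noteq> 0"
      "\<And>s. u * s = 0 \<longleftrightarrow> v * s = 0" by (rule common_part) blast
    have ua: "u \<in> pri a" and vb: "v \<in> pri b" using uv a2 b2 by blast+
    have u0: "u * s = 0" if "u * s \<in> pri bc" for s
      using that uv(1) ua a1 a2(2) pri_mult_right[of u a s] pri_mult_right[of u a2 s] by blast
    have v0: "v * s = 0" if "v * s \<in> pri ac" for s
      using that uv(2) vb b1 b2(2) pri_mult_right[of v b s] pri_mult_right[of v b2 s] by blast
    \<comment> \<open>\<open>w R\<close> is the graph of the isomorphism from \<open>u R\<close> to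
      \<open>v R\<close>; adjoining it to \<open>c R\<close> contradicts maximality.\<close>
    define w where "w = u + v"
    obtain d where d: "pri d = isum (pri c) (pri w)" by (rule isum_principal)
    have sub: "pri a \<subseteq> pri ab" "pri b \<subseteq> pri ab" using ab isum_upper by metis+
    have wab: "w \<in> pri ab" using sub ua vb by (auto simp: w_def intro: pri_add)
    have cbc: "pri c \<subseteq> pri bc" "pri b \<subseteq> pri bc" "pri c \<subseteq> pri ac" "pri a \<subseteq> pri ac"
      using ac bc isum_upper by metis+
    have "pri d \<in> \<A>"
    proof -
      have "x = 0" if x: "x \<in> pri d" "x \<in> pri a" for x
      proof -
        obtain r s where rs: "x = c * r + w * s" using x d by (auto simp: isum_pri_iff)
        have "v * s = x - u * s - c * r" by (simp add: rs w_def algebra_simps)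
        moreover have "x - u * s - c * r \<in> pri ac" using x ua cbc by (intro pri_diff) (auto intro: pri_mult_right)
        ultimately have "v * s = 0" using v0[of s] by argo
        then have "w * s = 0" using uv(5) by (simp add: w_def distrib_right)
        then have "x \<in> pri c" using rs by simp
        then show "x = 0" using x c by blast
      qed
      moreover have "x = 0" if x: "x \<in> pri d" "x \<in> pri b" for x
      proof -
        obtain r s where rs: "x = c * r + w * s" using x d by (auto simp: isum_pri_iff)
        have "u * s = x - v * s - c * r" by (simp add: rs w_def algebra_simps)
        moreover have "x - v * s - c * r \<in> pri bc" using x vb cbc by (intro pri_diff) (auto intro: pri_mult_right)
        ultimately have "u * s = 0" using u0[of s] by argo
        then have "w * s = 0" using uv(5) by (simp add: w_def distrib_right)
        then have "x \<in> pri c" using rs by simp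
        then show "x = 0" using x c by blast
      qed
      moreover have "pri d \<subseteq> pri ab" using d isum_least c(4) wab pri_subset_iff by metis
      ultimately show ?thesis unfolding \<A>_def by auto
    qed
    moreover have "pri c \<subseteq> pri d" "w \<in> pri d" using d isum_upper pri_self by blast+
    ultimately have "w \<in> pri c" using M(2) c(1) by blast
    moreover have "u = w - v" by (simp add: w_def)
    ultimately have "u \<in> pri bc" using cbc vb by (auto intro: pri_diff)
    then show False using u0[of 1] uv(3) by simp
  qed
  then show thesis using that c ab by metis
qed

text \<open>\<open>perspectivity_exists\<close> requires independent ideals. So the intersection of
  \<open>a R\<close> and \<open>b R\<close> is split off as \<open>i'\<close>, the remainders
  \<open>e\<close> and \<open>f\<close> are compared, and the identity on \<open>i'\<close> is added
  back.\<close>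

lemma comparable:
  obtains "a \<preceq> b" | "b \<preceq> (a::'r)"
proof -
  obtain i where i: "pri i = pri a \<inter> pri b" by (rule Int_principal)
  obtain i' where i': "idem i'" "pri i' = pri i" by (rule pri_idem_exists)
  have ii: "i' * i' = i'" using i' by (simp add: idem_def)
  have split: "\<exists>g. idem g \<and> i' * g = 0 \<and> g * i' = 0 \<and> pri (i' + g) = pri x" if x: "pri i \<subseteq> pri x" for x
  proof -
    obtain g where "idem g" "i' * g = 0" "g * i' = 0" "pri (i' + g) = isum (pri i') (pri x)"
      using isum_idem[OF i'(1), of x] .
    moreover have "isum (pri i') (pri x) = pri x"
      using x i'(2) isum_least[of i' x x] isum_upper by blast
    ultimately show ?thesis by metis
  qed
  obtain e where e: "idem e" "i' * e = 0" "e * i' = 0" "pri (i' + e) = pri a" using split i by blast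
  obtain f where f: "idem f" "i' * f = 0" "f * i' = 0" "pri (i' + f) = pri b" using split i by blast
  have ea: "pri e \<subseteq> pri a"
  proof -
    have "(i' + e) * e = e" using e by (simp add: distrib_right idem_def)
    then show ?thesis by (metis e(4) pri_mult pri_subset_iff)
  qed
  have fb: "pri f \<subseteq> pri b"
  proof -
    have "(i' + f) * f = f" using f by (simp add: distrib_right idem_def)
    then show ?thesis by (metis f(4) pri_mult pri_subset_iff)
  qed
  have "pri e \<inter> pri f = {0}"
  proof -
    have "x = 0" if x: "x \<in> pri e" "x \<in> pri f" for x
    proof -
      have "x \<in> pri i'" using x ea fb i i' by blast
      then have "i' * x = x" using i'(1) pri_idem by blast
      moreover have "e * x = x" using x e pri_idem by blast
      ultimately show ?thesis using e(2) by (metis mult.assoc mult_zero_left)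
    qed
    then show ?thesis by auto
  qed
  then obtain c where c: "pri c \<inter> pri e = {0}" "pri c \<inter> pri f = {0}"
    "pri e \<subseteq> isum (pri f) (pri c) \<or> pri f \<subseteq> isum (pri e) (pri c)"
    by (rule perspectivity_exists) blast
  have "e \<preceq> f \<or> f \<preceq> e"
    using c perspective_subord[of e c f] perspective_subord[of f c e] by (auto simp: Int_commute)
  then have "i' + e \<preceq> i' + f \<or> i' + f \<preceq> i' + e"
    using subord_add[OF subord_refl _ i'(1) f(1,2,3)] subord_add[OF subord_refl _ i'(1) e(1,2,3)] by blast
  moreover have "a \<preceq> i' + e" "i' + e \<preceq> a" "b \<preceq> i' + f" "i' + f \<preceq> b"
    using e(4) f(4) by (metis pri_self subord_pri)+
  ultimately show thesis using that subord_trans by metis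
qed

section \<open>Direct finiteness\<close>

lemma sum_ideal:
  fixes n :: nat
  obtains c where "\<And>x::'r. x \<in> pri c \<longleftrightarrow> (\<exists>s. x = (\<Sum>i<n. b i * s i))"
proof (induction n arbitrary: thesis)
  case 0
  show ?case by (rule 0[of 0]) simp
next
  case (Suc n)
  obtain c where c: "\<And>x. x \<in> pri c \<longleftrightarrow> (\<exists>s. x = (\<Sum>i<n. b i * s i))" using Suc.IH by blast
  obtain d where d: "pri d = isum (pri c) (pri (b n))" by (rule isum_principal)
  show ?case
  proof (rule Suc.prems)
    fix x
    show "x \<in> pri d \<longleftrightarrow> (\<exists>s. x = (\<Sum>i<Suc n. b i * s i))"
    proof
      assume "x \<in> pri d"
      then obtain y t where "x = y + b n * t" "y \<in> pri c"
        unfolding d by (auto simp: isum_iff pri_iff[of _ "b n"])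
      then obtain s t where "x = (\<Sum>i<n. b i * s i) + b n * t"
        using c by metis
      then have "x = (\<Sum>i<Suc n. b i * (s(n := t)) i)" by simp
      then show "\<exists>s. x = (\<Sum>i<Suc n. b i * s i)" by blast
    next
      assume "\<exists>s. x = (\<Sum>i<Suc n. b i * s i)"
      then obtain s where "x = (\<Sum>i<n. b i * s i) + b n * s n" by auto
      moreover have "(\<Sum>i<n. b i * s i) \<in> pri c" using c by metis
      ultimately show "x \<in> pri d" unfolding d isum_iff by (metis pri_mult)
    qed
  qed
qed

text \<open>
  With copies \<open>y n\<close> of \<open>p\<close> inside \<open>e n\<close>, all \<open>y n\<close> agree modulo the join \<open>s R\<close> of the spans \<open>B n\<close>
  of the differences, and \<open>y n\<close> lies in the \<open>n\<close>-th member of a decreasing sequence \<open>T\<close>. Lower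
  continuity puts \<open>y 0\<close> into \<open>s R\<close> up to an element killed by all \<open>e n\<close>, whereas upper continuity
  makes \<open>y 0\<close> independent of \<open>s R\<close>.
\<close>

lemma no_infinite_copies_idem:
  fixes e :: "nat \<Rightarrow> 'r"
  assumes e: "\<And>n. idem (e n)" "\<And>m n. m \<noteq> n \<Longrightarrow> e m * e n = 0"
    and p: "idem p" "\<And>n. p \<preceq> e n"
  shows "p = 0"
proof -
  have ee: "e n * e n = e n" for n using e by (simp add: idem_def)
  have "\<exists>x y. x * y = p \<and> p * x = x \<and> x * e n = x \<and> e n * y = y \<and> y * p = y" for n
    using subord_idemE[OF p(2)[of n] p(1) e(1)[of n]] by metis
  then obtain x y where xy: "\<And>n. x n * y n = p" "\<And>n. x n * e n = x n" "\<And>n. e n * y n = y n"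
    "\<And>n. y n * p = y n" by metis
  have ey: "e i * y j = (if i = j then y j else 0)" for i j
  proof (cases "i = j")
    case False
    have "e i * y j = e i * e j * y j" by (metis xy(3) mult.assoc)
    then show ?thesis using False e(2) by simp
  qed (simp add: xy)
  have xey: "x i * y j = (if i = j then p else 0)" for i j
  proof (cases "i = j")
    case False
    have "x i * y j = x i * (e i * y j)" by (metis xy(2) mult.assoc)
    then show ?thesis using False ey by simp
  qed (simp add: xy)
  define b where "b i = y i - y (Suc i)" for i
  define B where "B n = {z. \<exists>s. z = (\<Sum>i<n. b i * s i)}" for n
  have B: "B n \<in> range pri" for n
  proof -
    obtain c where "\<And>z::'r. z \<in> pri c \<longleftrightarrow> (\<exists>s. z = (\<Sum>i<n. b i * s i))" using sum_ideal by blast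
    then have "B n = pri c" by (auto simp: B_def)
    then show ?thesis by blast
  qed
  have Bmono: "B m \<subseteq> B n" if "m \<le> n" for m n
  proof
    fix z assume "z \<in> B m"
    then obtain s where s: "z = (\<Sum>i<m. b i * s i)" by (auto simp: B_def)
    have "z = (\<Sum>i<n. b i * (if i < m then s i else 0))"
      unfolding s by (rule sum.mono_neutral_cong_left) (use that in auto)
    then show "z \<in> B n" unfolding B_def mem_Collect_eq
      by (rule exI[of _ "\<lambda>i. if i < m then s i else 0"])
  qed
  define T where "T n = pri (1 - (\<Sum>i<n. e i))" for n
  have eS: "e j * (\<Sum>i<n. e i) = (if j < n then e j else 0)" for j n
  proof -
    have "e j * (\<Sum>i<n. e i) = (\<Sum>i<n. if i = j then e j else 0)"
      unfolding sum_distrib_left by (rule sum.cong) (auto simp: ee e(2))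
    then show ?thesis by (simp add: sum.delta)
  qed
  have T: "z \<in> T n \<longleftrightarrow> (\<forall>i<n. e i * z = 0)" for z n
  proof
    assume "z \<in> T n"
    then obtain s where "z = (1 - (\<Sum>i<n. e i)) * s" by (auto simp: T_def pri_iff)
    then show "\<forall>i<n. e i * z = 0"
      by (simp add: right_diff_distrib eS flip: mult.assoc)
  next
    assume "\<forall>i<n. e i * z = 0"
    then have "z = (1 - (\<Sum>i<n. e i)) * z" by (simp add: left_diff_distrib sum_distrib_right)
    then show "z \<in> T n" unfolding T_def by (metis pri_mult)
  qed
  obtain s where s: "is_join (range B) (pri s)" "\<And>C. C \<in> range B \<Longrightarrow> C \<subseteq> pri s"
    by (rule chain_join_exists[of "range B"]) (use B in auto)
  have chB: "\<forall>A\<in>range B. \<forall>B'\<in>range B. A \<subseteq> B' \<or> B' \<subseteq> A" using Bmono by (metis nle_le rangeE)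
  have chT: "\<forall>A\<in>range T. \<forall>B'\<in>range T. A \<subseteq> B' \<or> B' \<subseteq> A"
  proof -
    have "T n \<subseteq> T m" if "m \<le> n" for m n using that by (auto simp: T)
    then show ?thesis by (metis nle_le rangeE)
  qed
  have y0: "y 0 \<in> Q" if Q: "Q \<in> range pri" "pri s \<subseteq> Q" "T n \<subseteq> Q" for Q n
  proof -
    have "(\<Sum>i<n. b i * 1) \<in> B n" unfolding B_def mem_Collect_eq by (rule exI[of _ "\<lambda>_. 1"]) simp
    then have 1: "(\<Sum>i<n. b i) \<in> Q" using s(2)[of "B n"] Q by auto
    have "y n \<in> T n" by (simp add: T ey)
    then have 2: "y n \<in> Q" using Q by blast
    have "(\<Sum>i<n. b i) = y 0 - y n" unfolding b_def by (rule sum_lessThan_telescope')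
    then have "y 0 = (\<Sum>i<n. b i) + y n" by simp
    then show ?thesis using 1 2 Q(1) pri_add by auto
  qed
  have "\<exists>I\<in>range pri. (\<forall>C\<in>range T. I \<subseteq> C) \<and> (\<forall>Q\<in>range pri. pri s \<subseteq> Q \<and> I \<subseteq> Q \<longrightarrow> y 0 \<in> Q)"
    by (rule lower_continuous[OF _ chT]) (use y0 in \<open>auto simp: T_def\<close>)
  then obtain I where I: "I \<in> range pri" "\<And>C. C \<in> range T \<Longrightarrow> I \<subseteq> C"
    "\<And>Q. Q \<in> range pri \<Longrightarrow> pri s \<subseteq> Q \<Longrightarrow> I \<subseteq> Q \<Longrightarrow> y 0 \<in> Q" by metis
  then obtain i where "I = pri i" by auto
  with I have i: "\<And>n. pri i \<subseteq> T n" "\<And>Q. Q \<in> range pri \<Longrightarrow> pri s \<subseteq> Q \<Longrightarrow> pri i \<subseteq> Q \<Longrightarrow> y 0 \<in> Q"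
    by auto
  have ei: "e n * z = 0" if "z \<in> pri i" for n z using i(1)[of "Suc n"] that T by blast
  have "y 0 \<in> isum (pri s) (pri i)"
    using i(2) isum_principal[of s i] isum_upper[of s i] isum_upper[of i s] isum_commute by (metis rangeI)
  then obtain b0 t0 where bt: "y 0 = b0 + t0" "b0 \<in> pri s" "t0 \<in> pri i" by (auto simp: isum_iff)
  \<comment> \<open>Disjointness from \<open>s R\<close> is needed for \<open>y 0 R + i R\<close>,
    not just for \<open>y 0 R\<close>, because it is \<open>b0 = y 0 - t0\<close> that has to
    vanish.\<close>
  obtain d where d: "pri d = isum (pri (y 0)) (pri i)" by (rule isum_principal)
  have "z = 0" if z: "z \<in> pri d" "z \<in> B n" for z n
  proof -
    from z(1) obtain w t where wt: "w \<in> pri (y 0)" "t \<in> pri i" "z = w + t"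
      unfolding d isum_iff by (elim bexE)
    then obtain q where qt: "z = y 0 * q + t" "t \<in> pri i" by (auto simp: pri_iff[of w])
    obtain r where r: "z = (\<Sum>i<n. b i * r i)" using z by (auto simp: B_def)
    \<comment> \<open>\<open>F\<close> identifies all copies \<open>y j\<close>,
      \<open>j \<le> n\<close>, with \<open>p\<close>, so it kills the differences
      \<open>b j\<close>, \<open>j < n\<close>; the last of these involves
      \<open>y n\<close>.\<close>
    define F where "F = (\<Sum>i\<le>n. x i)"
    have Fy: "F * y j = p" if "j \<le> n" for j
      using that by (simp add: F_def sum_distrib_right xey)
    have Fb: "F * b j = 0" if "j < n" for j using that Fy by (simp add: b_def right_diff_distrib)
    have "F * z = 0" unfolding r sum_distrib_left by (rule sum.neutral) (simp add: Fb flip: mult.assoc)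
    moreover have "F * t = 0"
    proof -
      have "x j * t = x j * (e j * t)" for j by (metis xy(2) mult.assoc)
      then show ?thesis using ei[OF qt(2)] by (simp add: F_def sum_distrib_right)
    qed
    ultimately have "p * q = 0" using Fy[of 0] by (simp add: qt(1) distrib_left flip: mult.assoc)
    then have "y 0 * q = 0" by (metis xy(4) mult.assoc mult_zero_right)
    then have zt: "z = t" using qt by simp
    \<comment> \<open>\<open>E\<close> fixes every element of \<open>B n\<close> but kills
      \<open>i R\<close>, where \<open>z\<close> has just been located.\<close>
    define E where "E = (\<Sum>i\<le>n. e i)"
    have Ey: "E * y j = y j" if "j \<le> n" for j using that by (simp add: E_def sum_distrib_right ey)
    have "E * z = z" unfolding r sum_distrib_left
      by (rule sum.cong) (auto simp: b_def right_diff_distrib Ey simp flip: mult.assoc)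
    moreover have "E * z = 0" using ei qt(2) by (simp add: zt E_def sum_distrib_right)
    ultimately show "z = 0" by simp
  qed
  moreover have "0 \<in> B n" for n using B[of n] by (metis pri_zero rangeE)
  ultimately have dB: "pri d \<inter> B n = {0}" for n using pri_zero[of d] by blast
  have "pri d \<inter> pri s = {0}"
    by (rule chain_join_disjoint[OF _ chB s(1)]) (use B dB in auto)
  moreover have "b0 = y 0 - t0" using bt by simp
  moreover have "y 0 \<in> pri d" "t0 \<in> pri d" using d isum_upper[of "y 0" i] isum_upper[of i "y 0"] bt
    by (metis pri_self subsetD isum_commute)+
  ultimately have "b0 = 0" using bt(2) pri_diff by blast
  then have "y 0 = t0" using bt by simp
  then have "y 0 = 0" using ey[of 0 0] ei[OF bt(3), of 0] by simp
  then show "p = 0" using xy(1)[of 0] by simp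
qed

lemma no_infinite_copies:
  fixes e :: "nat \<Rightarrow> 'r"
  assumes "\<And>n. idem (e n)" "\<And>m n. m \<noteq> n \<Longrightarrow> e m * e n = 0" "\<And>n. a \<preceq> e n"
  shows "a = 0"
proof -
  obtain p where p: "idem p" "pri p = pri a" by (rule pri_idem_exists)
  then have "p \<preceq> e n" for n using assms(3)[of n] by (metis pri_self subord_pri subord_trans)
  then have "p = 0" using no_infinite_copies_idem assms p by blast
  then show ?thesis using p pri_eq_0 by (metis pri_0)
qed

text \<open>The one-sided inverses \<open>x\<close>, \<open>y\<close> behave like shifts: if the
  defect \<open>p = e - y * x\<close> were nonzero, the elements \<open>y ^ n * p * x ^ n\<close>
  would be infinitely many orthogonal copies of \<open>p\<close>.\<close>

lemma directly_finite:
  assumes "idem (e::'r)" "idem f" "e * f = f" "f * e = f" "e \<preceq> f"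
  shows "e = f"
proof -
  have ee: "e * e = e" and ff: "f * f = f" using assms by (auto simp: idem_def)
  obtain x y where xy: "x * y = e" "e * x = x" "x * f = x" "f * y = y" "y * e = y"
    using subord_idemE[OF assms(5,1,2)] .
  have xe: "x * e = x" by (metis xy(3) assms(4) mult.assoc)
  have ey: "e * y = y" by (metis xy(4) assms(3) mult.assoc)
  define p where "p = e - y * x"
  have yxyx: "y * x * (y * x) = y * x" by (metis xy(1,2) mult.assoc)
  have ep: "e * p = p" "p * e = p"
    by (simp_all add: p_def right_diff_distrib left_diff_distrib ee mult.assoc xe ey[THEN mult_assoc_subst])
  have pp: "p * p = p"
    by (simp add: p_def right_diff_distrib left_diff_distrib ee mult.assoc xe ey[THEN mult_assoc_subst] yxyx[unfolded mult.assoc])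
  have xp: "x * p = 0" by (simp add: p_def right_diff_distrib xe xy flip: mult.assoc)
  have py: "p * y = 0" by (simp add: p_def left_diff_distrib ey xy mult.assoc)
  have xyp: "x ^ n * (y ^ n * p) = p" for n
  proof (induction n)
    case (Suc n)
    have "e * (y ^ n * p) = y ^ n * p"
      by (cases n) (simp_all add: ep ey[THEN mult_assoc_subst] mult.assoc)
    then have "x * (y * (y ^ n * p)) = y ^ n * p" by (simp add: xy(1)[THEN mult_assoc_subst])
    moreover have "x ^ Suc n * (y ^ Suc n * p) = x ^ n * (x * (y * (y ^ n * p)))"
      by (simp only: power_Suc2[of x] power_Suc[of y] mult.assoc)
    ultimately show ?case using Suc by simp
  qed simp
  have pxy: "p * x ^ n * y ^ n = p" for n
  proof (induction n)
    case (Suc n)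
    have "p * x ^ n * e = p * x ^ n"
      by (cases n) (simp_all add: ep xe mult.assoc power_Suc2 del: power_Suc)
    then have "p * x ^ n * x * y = p * x ^ n" by (simp add: xy(1) mult.assoc)
    then show ?case using Suc by (metis mult.assoc power_Suc power_Suc2)
  qed simp
  define q where "q n = y ^ n * p * x ^ n" for n
  have cross: "x ^ m * (y ^ n * p) = 0" if "n < m" for m n
  proof -
    have "x ^ m = x ^ (m - Suc n) * (x * x ^ n)"
      using that by (metis Suc_leI le_add_diff_inverse2 power_Suc power_add)
    then have "x ^ m * (y ^ n * p) = x ^ (m - Suc n) * (x * (x ^ n * (y ^ n * p)))" by (simp add: mult.assoc)
    then show ?thesis by (simp add: xyp xp)
  qed
  have cross2: "p * x ^ m * y ^ n = 0" if "m < n" for m n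
  proof -
    have "y ^ n = y ^ m * y * y ^ (n - Suc m)"
      using that by (metis Suc_leI le_add_diff_inverse power_Suc2 power_add)
    then have "p * x ^ m * y ^ n = (p * x ^ m * y ^ m) * y * y ^ (n - Suc m)" by (simp add: mult.assoc)
    then show ?thesis by (simp add: pxy py)
  qed
  have qq: "q m * q n = (if m = n then q n else 0)" for m n
  proof -
    have q1: "q m * q n = y ^ m * p * (x ^ m * (y ^ n * p)) * x ^ n"
      by (simp add: q_def mult.assoc)
    have q2: "q m * q n = y ^ m * ((p * x ^ m * y ^ n) * p * x ^ n)"
      by (simp add: q_def mult.assoc)
    consider "m = n" | "n < m" | "m < n" by linarith
    then show ?thesis
    proof cases
      case 1
      have "q n * q n = y ^ n * p * p * x ^ n" using q1 1 xyp by simp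
      then show ?thesis using 1 by (simp add: q_def pp mult.assoc pp[THEN mult_assoc_subst])
    next
      case 2
      then show ?thesis using q1 cross by simp
    next
      case 3
      then show ?thesis using q2 cross2 by simp
    qed
  qed
  have "p \<preceq> q n" for n
  proof (rule subordI)
    have "x ^ n * q n * y ^ n = (x ^ n * (y ^ n * p)) * x ^ n * y ^ n" by (simp add: q_def mult.assoc)
    then show "p = x ^ n * q n * y ^ n" by (simp add: xyp pxy)
  qed
  then have "p = 0" using no_infinite_copies[of q p] qq by (simp add: idem_def)
  then have "e = y * x" by (simp add: p_def)
  then have "f * e = e" by (metis xy(4) mult.assoc)
  then show ?thesis using assms by simp
qed

section \<open>Halving of idempotents\<close>

lemma join_disjoint_pair:
  assumes F: "\<And>k. k \<in> K \<Longrightarrow> F k \<in> range (pri :: 'r \<Rightarrow> 'r set)" "\<And>k. k \<in> K \<Longrightarrow> G k \<in> range pri"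
    and mono: "\<And>k l. k \<in> K \<Longrightarrow> l \<in> K \<Longrightarrow> F k \<subseteq> F l \<and> G k \<subseteq> G l \<or> F l \<subseteq> F k \<and> G l \<subseteq> G k"
    and S: "is_join (F ` K) (pri s)" and T: "is_join (G ` K) (pri t)"
    and disj: "\<And>k. k \<in> K \<Longrightarrow> F k \<inter> G k = {0}"
  shows "pri s \<inter> pri t = {0}"
proof -
  have chF: "\<forall>A\<in>F ` K. \<forall>B\<in>F ` K. A \<subseteq> B \<or> B \<subseteq> A" using mono by blast
  have chG: "\<forall>A\<in>G ` K. \<forall>B\<in>G ` K. A \<subseteq> B \<or> B \<subseteq> A" using mono by blast
  \<comment> \<open>Upper continuity handles one chain at a time, so mixed indices are needed;
    simultaneous monotonicity reduces them to a common index.\<close>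
  have FG: "F k \<inter> G l = {0}" if kl: "k \<in> K" "l \<in> K" for k l
  proof -
    have "0 \<in> F k" "0 \<in> G l" using F kl by (metis imageE pri_zero)+
    moreover have "F k \<inter> G l \<subseteq> {0}" using mono[OF kl] disj[OF kl(1)] disj[OF kl(2)] by blast
    ultimately show ?thesis by blast
  qed
  have 1: "pri s \<inter> G l = {0}" if l: "l \<in> K" for l
  proof -
    obtain x where x: "G l = pri x" using F(2) l by blast
    have "\<forall>C\<in>F ` K. pri x \<inter> C = {0}" using FG l x by (metis Int_commute imageE)
    moreover have "F ` K \<subseteq> range pri" using F(1) by blast
    ultimately have "pri x \<inter> pri s = {0}" using chain_join_disjoint[OF _ chF S] by metis
    then show ?thesis using x by (simp add: Int_commute)
  qed
  show ?thesis
    by (rule chain_join_disjoint[OF _ chG T]) (use F 1 in auto)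
qed

definition no_atoms :: bool where
  "no_atoms \<longleftrightarrow> (\<forall>g::'r. idem g \<and> g \<noteq> 0 \<longrightarrow> (\<exists>d. idem d \<and> d \<noteq> 0 \<and> d \<noteq> g \<and> g * d = d \<and> d * g = d))"

text \<open>A proper nonzero subidempotent \<open>e\<close> splits \<open>d\<close> into two nonzero
  independent parts, and \<open>common_part\<close> finds isomorphic pieces \<open>u R\<close>,
  \<open>v R\<close> inside them.\<close>

lemma independent_double:
  assumes na: no_atoms and "pri g \<noteq> {0::'r}"
  obtains u v where "u \<in> pri g" "v \<in> pri g" "u \<noteq> 0" "\<And>s. u * s = 0 \<longleftrightarrow> v * s = 0"
    "\<And>s t. u * s = v * t \<Longrightarrow> u * s = 0"
proof -
  obtain d where d: "idem d" "pri d = pri g" by (rule pri_idem_exists)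
  have dd: "d * d = d" using d by (simp add: idem_def)
  have "d \<noteq> 0" using assms(2) d(2) pri_0 by metis
  then obtain e where e: "idem e" "e \<noteq> 0" "e \<noteq> d" "d * e = e" "e * d = e"
    using na d unfolding no_atoms_def by blast
  have ee: "e * e = e" using e by (simp add: idem_def)
  have n1: "pri e \<noteq> {0}" using e by (simp add: pri_eq_0)
  have n2: "pri (d - e) \<noteq> {0}" using e by (simp add: pri_eq_0)
  have "\<exists>u v. u \<in> pri e \<and> v \<in> pri (d - e) \<and> u \<noteq> 0 \<and> v \<noteq> 0 \<and> (\<forall>s. u * s = 0 \<longleftrightarrow> v * s = 0)"
    by (rule common_part[OF n1 n2]) (intro exI conjI allI)
  then obtain u v where uv: "u \<in> pri e" "v \<in> pri (d - e)" "u \<noteq> 0" "v \<noteq> 0" "\<And>s. u * s = 0 \<longleftrightarrow> v * s = 0"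
    by metis
  have eu: "e * u = u" by (rule pri_idem[OF e(1), THEN iffD1, OF uv(1)])
  have ev: "e * v = 0"
  proof -
    obtain s where "v = (d - e) * s" using uv(2) by (auto simp: pri_iff)
    then show ?thesis by (simp add: right_diff_distrib e(5) ee flip: mult.assoc)
  qed
  show thesis
  proof (rule that[OF _ _ uv(3,5)])
    show "u \<in> pri g" by (metis d e(4) eu mult.assoc pri_idem)
    have "d * v = v" using uv(2) by (auto simp: pri_iff right_diff_distrib dd e(4) simp flip: mult.assoc)
    then show "v \<in> pri g" by (metis d pri_mult)
    show "u * s = 0" if "u * s = v * t" for s t
      using arg_cong[OF that, of "\<lambda>x. e * x"] by (simp add: eu ev flip: mult.assoc)
  qed
qed

text \<open>Here \<open>C\<close> is the graph of an isomorphism between \<open>A\<close> and \<open>B\<close>.\<close>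

definition half_triples :: "'r \<Rightarrow> ('r set \<times> 'r set \<times> 'r set) set" where
  "half_triples g = {(A, B, C). A \<in> range pri \<and> B \<in> range pri \<and> C \<in> range pri \<and>
     A \<subseteq> pri g \<and> B \<subseteq> pri g \<and> A \<inter> B = {0} \<and> C \<inter> A = {0} \<and> C \<inter> B = {0} \<and>
     C \<subseteq> isum A B \<and> A \<subseteq> isum B C \<and> B \<subseteq> isum A C}"

definition triple_le :: "('r set \<times> 'r set \<times> 'r set) \<Rightarrow> ('r set \<times> 'r set \<times> 'r set) \<Rightarrow> bool" where
  "triple_le T T' \<longleftrightarrow> fst T \<subseteq> fst T' \<and> fst (snd T) \<subseteq> fst (snd T') \<and> snd (snd T) \<subseteq> snd (snd T')"

text \<open>A chain of triples is bounded by its componentwise joins. The inclusions survive because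
  joins are least upper bounds, the trivial intersections by
  \<open>join_disjoint_pair\<close>.\<close>

lemma half_triples_maximal:
  obtains M where "M \<in> half_triples g" "\<And>T. T \<in> half_triples g \<Longrightarrow> triple_le M T \<Longrightarrow> T = M"
proof -
  let ?H = "half_triples g"
  have po: "partial_order_on ?H (relation_of triple_le ?H)"
    by (rule partial_order_on_relation_ofI) (auto simp: triple_le_def)
  have ch: "\<exists>u\<in>?H. \<forall>a\<in>K. triple_le a u" if K: "K \<in> Chains (relation_of triple_le ?H)" for K
  proof -
    have KH: "K \<subseteq> ?H" and tot: "\<And>k l. k \<in> K \<Longrightarrow> l \<in> K \<Longrightarrow> triple_le k l \<or> triple_le l k"
      using K unfolding Chains_def relation_of_def by auto
    define p1 where "p1 = (\<lambda>T::'r set \<times> 'r set \<times> 'r set. fst T)"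
    define p2 where "p2 = (\<lambda>T::'r set \<times> 'r set \<times> 'r set. fst (snd T))"
    define p3 where "p3 = (\<lambda>T::'r set \<times> 'r set \<times> 'r set. snd (snd T))"
    have R: "p1 k \<in> range pri" "p2 k \<in> range pri" "p3 k \<in> range pri" if "k \<in> K" for k
      using KH that unfolding half_triples_def p1_def p2_def p3_def by auto
    have Q: "p1 k \<subseteq> pri g" "p2 k \<subseteq> pri g" "p1 k \<inter> p2 k = {0}" "p3 k \<inter> p1 k = {0}" "p3 k \<inter> p2 k = {0}"
      "p3 k \<subseteq> isum (p1 k) (p2 k)" "p1 k \<subseteq> isum (p2 k) (p3 k)" "p2 k \<subseteq> isum (p1 k) (p3 k)"
      if "k \<in> K" for k
    proof -
      obtain A B C where k: "k = (A, B, C)" by (cases k)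
      then have "(A, B, C) \<in> ?H" using KH that by blast
      then show "p1 k \<subseteq> pri g" "p2 k \<subseteq> pri g" "p1 k \<inter> p2 k = {0}" "p3 k \<inter> p1 k = {0}" "p3 k \<inter> p2 k = {0}"
        "p3 k \<subseteq> isum (p1 k) (p2 k)" "p1 k \<subseteq> isum (p2 k) (p3 k)" "p2 k \<subseteq> isum (p1 k) (p3 k)"
        by (simp_all add: k half_triples_def p1_def p2_def p3_def)
    qed
    have Rs: "p1 ` K \<subseteq> range pri" "p2 ` K \<subseteq> range pri" "p3 ` K \<subseteq> range pri" using R by blast+
    obtain a where a: "is_join (p1 ` K) (pri a)" "\<And>C. C \<in> p1 ` K \<Longrightarrow> C \<subseteq> pri a"
      "\<And>t. (\<And>C. C \<in> p1 ` K \<Longrightarrow> C \<subseteq> pri t) \<Longrightarrow> pri a \<subseteq> pri t"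
      using chain_join_exists[OF Rs(1)] by metis
    obtain b where b: "is_join (p2 ` K) (pri b)" "\<And>C. C \<in> p2 ` K \<Longrightarrow> C \<subseteq> pri b"
      "\<And>t. (\<And>C. C \<in> p2 ` K \<Longrightarrow> C \<subseteq> pri t) \<Longrightarrow> pri b \<subseteq> pri t"
      using chain_join_exists[OF Rs(2)] by metis
    obtain c where c: "is_join (p3 ` K) (pri c)" "\<And>C. C \<in> p3 ` K \<Longrightarrow> C \<subseteq> pri c"
      "\<And>t. (\<And>C. C \<in> p3 ` K \<Longrightarrow> C \<subseteq> pri t) \<Longrightarrow> pri c \<subseteq> pri t"
      using chain_join_exists[OF Rs(3)] by metis
    have up: "p1 k \<subseteq> pri a" "p2 k \<subseteq> pri b" "p3 k \<subseteq> pri c" if "k \<in> K" for k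
      using a(2) b(2) c(2) that by blast+
    have mono: "isum A B \<subseteq> isum A' B'" if "A \<subseteq> A'" "B \<subseteq> B'" for A A' B B' :: "'r set"
      using that by (auto simp: isum_def)
    obtain ab where ab: "pri ab = isum (pri a) (pri b)" by (rule isum_principal)
    obtain bc where bc: "pri bc = isum (pri b) (pri c)" by (rule isum_principal)
    obtain ac where ac: "pri ac = isum (pri a) (pri c)" by (rule isum_principal)
    have tot': "p1 k \<subseteq> p1 l \<and> p2 k \<subseteq> p2 l \<and> p3 k \<subseteq> p3 l \<or> p1 l \<subseteq> p1 k \<and> p2 l \<subseteq> p2 k \<and> p3 l \<subseteq> p3 k"
      if "k \<in> K" "l \<in> K" for k l
      using tot[OF that] unfolding triple_le_def p1_def p2_def p3_def by blast
    have "pri a \<inter> pri b = {0}"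
      by (rule join_disjoint_pair[of K p1 p2, OF R(1) R(2) _ a(1) b(1) Q(3)]) (assumption | (drule (1) tot', blast))+
    moreover have "pri c \<inter> pri a = {0}"
      by (rule join_disjoint_pair[of K p3 p1, OF R(3) R(1) _ c(1) a(1) Q(4)]) (assumption | (drule (1) tot', blast))+
    moreover have "pri c \<inter> pri b = {0}"
      by (rule join_disjoint_pair[of K p3 p2, OF R(3) R(2) _ c(1) b(1) Q(5)]) (assumption | (drule (1) tot', blast))+
    moreover have "pri c \<subseteq> pri ab"
    proof (rule c(3))
      fix C assume "C \<in> p3 ` K"
      then obtain k where "k \<in> K" "C = p3 k" by blast
      then show "C \<subseteq> pri ab" using Q(6)[of k] mono[OF up(1,2)] ab by (metis subset_trans)
    qed
    moreover have "pri a \<subseteq> pri bc"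
    proof (rule a(3))
      fix C assume "C \<in> p1 ` K"
      then obtain k where "k \<in> K" "C = p1 k" by blast
      then show "C \<subseteq> pri bc" using Q(7)[of k] mono[OF up(2,3)] bc by (metis subset_trans)
    qed
    moreover have "pri b \<subseteq> pri ac"
    proof (rule b(3))
      fix C assume "C \<in> p2 ` K"
      then obtain k where "k \<in> K" "C = p2 k" by blast
      then show "C \<subseteq> pri ac" using Q(8)[of k] mono[OF up(1,3)] ac by (metis subset_trans)
    qed
    moreover have "pri a \<subseteq> pri g" by (rule a(3)) (use Q(1) in blast)
    moreover have "pri b \<subseteq> pri g" by (rule b(3)) (use Q(2) in blast)
    ultimately have "(pri a, pri b, pri c) \<in> ?H" unfolding half_triples_def ab ac bc by auto
    then show ?thesis
      using up by (intro bexI[of _ "(pri a, pri b, pri c)"]) (auto simp: triple_le_def p1_def p2_def p3_def)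
  qed
  obtain M where "M \<in> ?H" "\<forall>T\<in>?H. triple_le M T \<longrightarrow> T = M"
    using predicate_Zorn[OF po ch] by blast
  then show thesis using that by blast
qed

text \<open>A maximal triple fills \<open>g R\<close>: otherwise a complement contains isomorphic
  independent \<open>u R\<close> and \<open>v R\<close>, and the triple can be enlarged by
  \<open>u\<close>, \<open>v\<close> and the graph generator \<open>u + v\<close>.\<close>

lemma halving_ideals:
  assumes na: no_atoms
  obtains a b c where "isum (pri a) (pri b) = pri (g::'r)" "pri a \<inter> pri b = {0}"
    "pri c \<inter> pri a = {0}" "pri c \<inter> pri b = {0}"
    "pri a \<subseteq> isum (pri b) (pri c)" "pri b \<subseteq> isum (pri a) (pri c)"
proof -
  obtain M where M: "M \<in> half_triples g" "\<And>T. T \<in> half_triples g \<Longrightarrow> triple_le M T \<Longrightarrow> T = M"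
    by (rule half_triples_maximal[of g]) blast
  then obtain a b c where abc: "M = (pri a, pri b, pri c)" and ab: "pri a \<inter> pri b = {0}"
    and g: "pri a \<subseteq> pri g" "pri b \<subseteq> pri g"
    and c: "pri c \<inter> pri a = {0}" "pri c \<inter> pri b = {0}" "pri c \<subseteq> isum (pri a) (pri b)"
    "pri a \<subseteq> isum (pri b) (pri c)" "pri b \<subseteq> isum (pri a) (pri c)"
    unfolding half_triples_def by auto
  obtain s where s: "pri s = isum (pri a) (pri b)" by (rule isum_principal)
  have sg: "pri s \<subseteq> pri g" unfolding s by (rule isum_least[OF g])
  obtain d where d: "pri d \<subseteq> pri g" "pri s \<inter> pri d = {0}" "isum (pri s) (pri d) = pri g"
    using relative_complement[OF sg] by metis
  have "pri d = {0}"
  proof (rule ccontr)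
    assume "pri d \<noteq> {0}"
    then obtain u v where uv: "u \<in> pri d" "v \<in> pri d" "u \<noteq> 0" "\<And>s. u * s = 0 \<longleftrightarrow> v * s = 0"
      "\<And>s t. u * s = v * t \<Longrightarrow> u * s = 0"
      by (rule independent_double[OF na]) blast
    define w where "w = u + v"
    have ind: "x = 0 \<and> z = 0" if "x \<in> pri s" "z \<in> pri d" "x + z = 0" for x z
    proof -
      have "x = - z" using that(3) by (rule eq_neg_iff_add_eq_0[THEN iffD2])
      then have "x \<in> pri d" using that(2) by (simp add: pri_minus)
      then have "x = 0" using that(1) d(2) by blast
      then show ?thesis using that(3) by simp
    qed
    have in_d: "u * q \<in> pri d" "v * q \<in> pri d" for q using uv(1,2) by (auto intro: pri_mult_right)
    have in_s: "a * q \<in> pri s" "b * q \<in> pri s" "c * q \<in> pri s" for q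
      using s isum_upper[of a b] isum_upper[of b a] c(3) isum_commute by (metis pri_mult subsetD)+
    obtain a' where a': "pri a' = isum (pri a) (pri u)" by (rule isum_principal)
    obtain b' where b': "pri b' = isum (pri b) (pri v)" by (rule isum_principal)
    obtain c' where c': "pri c' = isum (pri c) (pri w)" by (rule isum_principal)
    have "x = 0" if x: "x \<in> pri a'" "x \<in> pri b'" for x
    proof -
      obtain p q where pq: "x = a * p + u * q" using x(1) unfolding a' isum_pri_iff by metis
      obtain r t where rt: "x = b * r + v * t" using x(2) unfolding b' isum_pri_iff by metis
      have e: "(a * p - b * r) + (u * q - v * t) = 0" using pq rt by (simp add: algebra_simps)
      have "a * p - b * r = 0 \<and> u * q - v * t = 0"
        by (rule ind[OF _ _ e]) (auto intro!: pri_diff in_s in_d)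
      then have 1: "a * p = b * r" "u * q = v * t" by simp_all
      then have "u * q = 0" using uv(5) by blast
      moreover have "a * p = 0" using 1(1) ab pri_mult by (metis IntI singletonD)
      ultimately show "x = 0" using pq by simp
    qed
    then have t1: "pri a' \<inter> pri b' = {0}" by auto
    have "x = 0" if x: "x \<in> pri c'" "x \<in> pri a'" for x
    proof -
      obtain p q where pq: "x = a * p + u * q" using x(2) unfolding a' isum_pri_iff by metis
      obtain r t where rt: "x = c * r + w * t" using x(1) unfolding c' isum_pri_iff by metis
      have e: "(c * r - a * p) + (u * t + v * t - u * q) = 0" using pq rt by (simp add: algebra_simps w_def)
      have "c * r - a * p = 0 \<and> u * t + v * t - u * q = 0"
        by (rule ind[OF _ _ e]) (auto intro!: pri_diff pri_add in_s in_d)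
      then have 1: "c * r = a * p" "u * (q - t) = v * t" by (simp_all add: algebra_simps)
      then have "u * (q - t) = 0" using uv(5) by blast
      then have "w * t = 0" using 1(2) uv(4)[of t] by (simp add: w_def distrib_right)
      moreover have "c * r = 0" using 1(1) c(1) pri_mult by (metis IntI singletonD)
      ultimately show "x = 0" using rt by simp
    qed
    then have t2: "pri c' \<inter> pri a' = {0}" by auto
    have "x = 0" if x: "x \<in> pri c'" "x \<in> pri b'" for x
    proof -
      obtain p q where pq: "x = b * p + v * q" using x(2) unfolding b' isum_pri_iff by metis
      obtain r t where rt: "x = c * r + w * t" using x(1) unfolding c' isum_pri_iff by metis
      have e: "(c * r - b * p) + (u * t + v * t - v * q) = 0" using pq rt by (simp add: algebra_simps w_def)
      have "c * r - b * p = 0 \<and> u * t + v * t - v * q = 0"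
        by (rule ind[OF _ _ e]) (auto intro!: pri_diff pri_add in_s in_d)
      then have 1: "c * r = b * p" "u * t = v * (q - t)" by (simp_all add: algebra_simps)
      then have "u * t = 0" using uv(5) by blast
      then have "w * t = 0" using uv(4)[of t] by (simp add: w_def distrib_right)
      moreover have "c * r = 0" using 1(1) c(2) pri_mult by (metis IntI singletonD)
      ultimately show "x = 0" using rt by simp
    qed
    then have t3: "pri c' \<inter> pri b' = {0}" by auto
    have ups: "a \<in> pri a'" "u \<in> pri a'" "b \<in> pri b'" "v \<in> pri b'" "c \<in> pri c'" "w \<in> pri c'"
      unfolding a' b' c' using isum_upper by (metis pri_self subsetD)+
    have le: "pri a \<subseteq> pri a'" "pri b \<subseteq> pri b'" "pri c \<subseteq> pri c'" using ups by (simp_all add: pri_subset_iff)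
    have mono: "isum A B \<subseteq> isum A' B'" if "A \<subseteq> A'" "B \<subseteq> B'" for A A' B B' :: "'r set"
      using that by (auto simp: isum_def)
    obtain s' where s': "pri s' = isum (pri a') (pri b')" by (rule isum_principal)
    obtain s2 where s2: "pri s2 = isum (pri b') (pri c')" by (rule isum_principal)
    obtain s3 where s3: "pri s3 = isum (pri a') (pri c')" by (rule isum_principal)
    have ups': "pri a' \<subseteq> pri s'" "pri b' \<subseteq> pri s'" "pri b' \<subseteq> pri s2" "pri c' \<subseteq> pri s2"
      "pri a' \<subseteq> pri s3" "pri c' \<subseteq> pri s3"
      unfolding s' s2 s3 by (rule isum_upper)+
    have "c \<in> pri s'" unfolding s' using c(3) mono[OF le(1,2)] pri_self by blast
    moreover have "w \<in> pri s'" unfolding w_def using ups ups' by (intro pri_add) auto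
    ultimately have t4: "pri c' \<subseteq> pri s'" unfolding c' by (intro isum_least) (simp_all add: pri_subset_iff)
    have "a \<in> pri s2" unfolding s2 using c(4) mono[OF le(2,3)] pri_self by blast
    moreover have "u = w - v" by (simp add: w_def)
    moreover have "w - v \<in> pri s2" using ups ups' by (intro pri_diff) auto
    ultimately have t5: "pri a' \<subseteq> pri s2" unfolding a' by (intro isum_least) (simp_all add: pri_subset_iff)
    have "b \<in> pri s3" unfolding s3 using c(5) mono[OF le(1,3)] pri_self by blast
    moreover have "v = w - u" by (simp add: w_def)
    moreover have "w - u \<in> pri s3" using ups ups' by (intro pri_diff) auto
    ultimately have t6: "pri b' \<subseteq> pri s3" unfolding b' by (intro isum_least) (simp_all add: pri_subset_iff)
    have uvg: "u \<in> pri g" "v \<in> pri g" using subsetD[OF d(1)] uv by metis+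
    have "pri a' \<subseteq> pri g" unfolding a' by (rule isum_least) (use g(1) uvg in \<open>simp_all add: pri_subset_iff\<close>)
    moreover have "pri b' \<subseteq> pri g" unfolding b' by (rule isum_least) (use g(2) uvg in \<open>simp_all add: pri_subset_iff\<close>)
    ultimately have "(pri a', pri b', pri c') \<in> half_triples g"
      unfolding half_triples_def using t1 t2 t3 t4 t5 t6 s' s2 s3 by simp
    moreover have "triple_le M (pri a', pri b', pri c')" using le by (simp add: abc triple_le_def)
    ultimately have "pri a' = pri a" using M(2) abc by blast
    then have "u \<in> pri s" using ups(2) in_s(1)[of 1] by (metis mult_1_right pri_subset_iff subsetD)
    then show False using d(2) uv(1,3) by blast
  qed
  then have "pri g = pri s" using d(3) by (auto simp: isum_def)
  then show thesis using that[of a b c] s ab c by simp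
qed

lemma halving:
  assumes na: no_atoms and g: "idem (g::'r)"
  obtains g1 g2 where "idem g1" "idem g2" "g1 + g2 = g" "g1 * g2 = 0" "g2 * g1 = 0" "g1 \<preceq> g2" "g2 \<preceq> g1"
proof -
  obtain a b c where abc: "isum (pri a) (pri b) = pri (g::'r)" "pri a \<inter> pri b = {0}"
    "pri c \<inter> pri a = {0}" "pri c \<inter> pri b = {0}"
    "pri a \<subseteq> isum (pri b) (pri c)" "pri b \<subseteq> isum (pri a) (pri c)"
    by (rule halving_ideals[OF na, of g]) blast
  have ab: "a \<preceq> b" "b \<preceq> a" using abc perspective_subord[of a c b] perspective_subord[of b c a]
    by (simp_all add: Int_commute)
  obtain p where p: "\<And>x. x \<in> pri a \<Longrightarrow> p * x = x" "\<And>x. x \<in> pri b \<Longrightarrow> p * x = 0"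
    by (rule projection[OF abc(2)]) blast
  have ag: "a \<in> pri g" "b \<in> pri g" unfolding abc(1)[symmetric] using isum_upper by (metis pri_self subsetD)+
  have gg: "g * g = g" using g by (simp add: idem_def)
  \<comment> \<open>Cutting the projection along \<open>b R\<close> down to \<open>g\<close> turns
    the two ideals into the ranges of orthogonal idempotents \<open>g1\<close> and
    \<open>g - g1\<close>.\<close>
  define g1 where "g1 = p * g"
  define g2 where "g2 = g - g1"
  have dec: "\<exists>r t. g * x = a * r + b * t \<and> g1 * x = a * r \<and> g2 * x = b * t" for x
  proof -
    have "g * x \<in> isum (pri a) (pri b)" unfolding abc(1) by simp
    then obtain r t where rt: "g * x = a * r + b * t" unfolding isum_pri_iff by metis
    have "g1 * x = p * (a * r) + p * (b * t)" by (simp add: g1_def mult.assoc rt distrib_left)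
    then have "g1 * x = a * r" using p by simp
    moreover then have "g2 * x = b * t" using rt by (simp add: g2_def left_diff_distrib)
    ultimately show ?thesis using rt by blast
  qed
  have gx: "g * x = x" if "x \<in> pri a \<or> x \<in> pri b" for x
    using that ag g pri_idem by (metis pri_mult_right pri_iff)
  have g1x: "g1 * x = x" if "x \<in> pri a" for x using that gx p by (simp add: g1_def mult.assoc)
  have g1y: "g1 * x = 0" if "x \<in> pri b" for x using that gx p by (simp add: g1_def mult.assoc)
  have i1: "g1 \<in> pri a" "g2 \<in> pri b" using dec[of 1] by auto
  have m: "g1 * g1 = g1" "g1 * g2 = 0" using g1x g1y i1 by blast+
  have m2: "g2 * g1 = 0" using gx i1 m by (simp add: g2_def left_diff_distrib)
  have m3: "g2 * g2 = g2" using gx[of g2] i1 m by (simp add: g2_def[of] left_diff_distrib)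
  have "a = g1 * a" "b = g2 * b" using g1x g1y gx by (simp_all add: g2_def left_diff_distrib)
  then have "a \<preceq> g1" "b \<preceq> g2" by (metis subord_mult_right)+
  moreover have "g1 \<preceq> a" "g2 \<preceq> b" using i1 subord_pri by blast+
  ultimately have "g1 \<preceq> g2" "g2 \<preceq> g1" using ab subord_trans by blast+
  then show thesis using that[of g1 g2] m m2 m3 by (simp add: idem_def g2_def)
qed

text \<open>If instead \<open>g1 \<preceq> f1\<close>, then also \<open>g2 \<preceq> f2\<close>, so
  \<open>g1 + g2\<close> has a copy \<open>h1 + h2\<close> inside \<open>f1 + f2\<close>. Direct
  finiteness forces equality, and multiplying by \<open>f1\<close> gives
  \<open>f1 = h1\<close>.\<close>

lemma half_subord:
  assumes f: "idem (f1::'r)" "idem f2" "f1 * f2 = 0" "f2 * f1 = 0" "f1 \<preceq> f2"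
    and g: "idem g1" "idem g2" "g2 \<preceq> g1" and le: "f1 + f2 \<preceq> g1 + g2"
  shows "f1 \<preceq> g1"
proof (rule comparable[of f1 g1])
  assume gf: "g1 \<preceq> f1"
  obtain h1 where h1: "idem h1" "h1 * f1 = h1" "f1 * h1 = h1" "h1 \<preceq> g1" "g1 \<preceq> h1"
    using subord_subidem[OF gf f(1) g(1)] .
  have "g2 \<preceq> f2" using g(3) gf f(5) subord_trans by blast
  then obtain h2 where h2: "idem h2" "h2 * f2 = h2" "f2 * h2 = h2" "h2 \<preceq> g2" "g2 \<preceq> h2"
    using subord_subidem[OF _ f(2) g(2)] by metis
  have hh: "h1 * h2 = 0" "h2 * h1 = 0"
    using f(3,4) h1(2,3) h2(2,3) by (metis mult.assoc mult_zero_left mult_zero_right)+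
  have fh: "f1 * h2 = 0" "f2 * h1 = 0" "h1 * f2 = 0" "h2 * f1 = 0"
    using f(3,4) h1(2,3) h2(2,3) by (metis mult.assoc mult_zero_left mult_zero_right)+
  have "g1 + g2 \<preceq> h1 + h2" by (rule subord_add[OF h1(5) h2(5) h1(1) h2(1) hh])
  then have le': "f1 + f2 \<preceq> h1 + h2" using le subord_trans by blast
  have "f1 + f2 = h1 + h2"
  proof (rule directly_finite[OF _ _ _ _ le'])
    show "idem (f1 + f2)" "idem (h1 + h2)" using f h1 h2 hh by (simp_all add: idem_def algebra_simps)
    show "(f1 + f2) * (h1 + h2) = h1 + h2" "(h1 + h2) * (f1 + f2) = h1 + h2"
      by (simp_all add: algebra_simps fh h1 h2)
  qed
  then have "f1 * (f1 + f2) = f1 * (h1 + h2)" by simp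
  then have "f1 = h1" using f h1 fh by (simp add: distrib_left idem_def)
  then show ?thesis using h1 by simp
qed

end

section \<open>The rank function\<close>

definition rankfun :: "('r::ring_1 \<Rightarrow> real) \<Rightarrow> bool" where
  "rankfun \<rho> \<longleftrightarrow> (\<forall>a. 0 \<le> \<rho> a \<and> \<rho> a \<le> 1) \<and> \<rho> 1 = 1 \<and>
     (\<forall>a b. \<rho> (a * b) \<le> \<rho> a \<and> \<rho> (a * b) \<le> \<rho> b) \<and>
     (\<forall>e f. idem e \<and> idem f \<and> e * f = 0 \<and> f * e = 0 \<longrightarrow> \<rho> (e + f) = \<rho> e + \<rho> f) \<and>
     (\<forall>a. a \<noteq> 0 \<longrightarrow> 0 < \<rho> a)"

lemma rankfun_subord: "rankfun \<rho> \<Longrightarrow> a \<preceq> b \<Longrightarrow> \<rho> a \<le> \<rho> b"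
  unfolding rankfun_def subord_def by (metis order_trans)

lemma rankfun_zero: "rankfun \<rho> \<Longrightarrow> \<rho> 0 = 0"
  unfolding rankfun_def using idem_0 by (metis add_cancel_right_left mult_zero_left add.right_neutral)

text \<open>
  At level \<open>n\<close> the unit is divided into \<open>N0 * r ^ n\<close> equivalent pieces, and every idempotent is
  measured up to \<open>d\<close> pieces. Without minimal idempotents, repeated halving gives \<open>r = 2\<close> and
  \<open>d = 1\<close>; otherwise \<open>r = 1\<close> and \<open>d = 0\<close>, the pieces being minimal idempotents.
\<close>

locale rank_scale = continuous_regular_ring ty for ty :: "'r::ring_1 itself" +
  fixes N0 r d :: nat and w :: "nat \<Rightarrow> nat \<Rightarrow> 'r"
  assumes N0: "0 < N0" and r: "0 < r"
    and fine: "0 < \<epsilon> \<Longrightarrow> \<exists>n. real d / real (N0 * r ^ n) < \<epsilon>"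
    and w_idem: "k < N0 * r ^ n \<Longrightarrow> idem (w n k)"
    and w_orth: "k < N0 * r ^ n \<Longrightarrow> l < N0 * r ^ n \<Longrightarrow> k \<noteq> l \<Longrightarrow> w n k * w n l = 0"
    and w_subord: "k < N0 * r ^ n \<Longrightarrow> l < N0 * r ^ n \<Longrightarrow> w n k \<preceq> w n l"
    and w_sum: "(\<Sum>k<N0 * r ^ n. w n k) = 1"
    and w_refine: "k < N0 * r ^ n \<Longrightarrow> w n k = (\<Sum>j = k * r..<k * r + r. w (Suc n) j)"
    and w_approx: "idem e \<Longrightarrow> \<exists>k l. (\<Sum>i<k. w n i) \<preceq> e \<and> e \<preceq> (\<Sum>i<l. w n i) \<and> k \<le> l \<and> l \<le> k + d \<and> l \<le> N0 * r ^ n"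
    and w_small: "idem e \<Longrightarrow> e \<noteq> 0 \<Longrightarrow> \<exists>n. w n 0 \<preceq> e"
begin

section \<open>Measuring with equivalent pieces\<close>

abbreviation N :: "nat \<Rightarrow> nat" where "N n \<equiv> N0 * r ^ n"

definition u :: "nat \<Rightarrow> nat set \<Rightarrow> 'r" where "u n I = sum (w n) I"

abbreviation v :: "nat \<Rightarrow> nat \<Rightarrow> 'r" where "v n k \<equiv> u n {..<k}"

lemma N_pos: "0 < N n" using N0 r by simp

lemma w_mult: "k < N n \<Longrightarrow> l < N n \<Longrightarrow> w n k * w n l = (if k = l then w n k else 0)"
  using w_idem w_orth by (auto simp: idem_def)

lemma u_mult:
  assumes "I \<subseteq> {..<N n}" "J \<subseteq> {..<N n}"
  shows "u n I * u n J = u n (I \<inter> J)"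
proof -
  have fin: "finite I" "finite J" using assms finite_subset by blast+
  have "u n I * u n J = (\<Sum>i\<in>I. \<Sum>j\<in>J. w n i * w n j)" by (simp add: u_def sum_product)
  also have "\<dots> = (\<Sum>i\<in>I. \<Sum>j\<in>J. if i = j then w n i else 0)"
    by (intro sum.cong refl w_mult) (use assms in auto)
  also have "\<dots> = (\<Sum>i\<in>I. if i \<in> J then w n i else 0)" using fin by (simp add: sum.delta')
  also have "\<dots> = u n (I \<inter> J)" using fin by (simp add: u_def sum.inter_restrict)
  finally show ?thesis .
qed

lemma u_idem: "I \<subseteq> {..<N n} \<Longrightarrow> idem (u n I)"
  by (simp add: idem_def u_mult)

lemma u_orth: "I \<subseteq> {..<N n} \<Longrightarrow> J \<subseteq> {..<N n} \<Longrightarrow> I \<inter> J = {} \<Longrightarrow> u n I * u n J = 0"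
  by (simp add: u_mult) (simp add: u_def)

lemma u_Un: "finite I \<Longrightarrow> finite J \<Longrightarrow> I \<inter> J = {} \<Longrightarrow> u n (I \<union> J) = u n I + u n J"
  by (simp add: u_def sum.union_disjoint)

lemma u_subord:
  "finite I \<Longrightarrow> I \<subseteq> {..<N n} \<Longrightarrow> J \<subseteq> {..<N n} \<Longrightarrow> card I \<le> card J \<Longrightarrow> u n I \<preceq> u n J"
proof (induction I arbitrary: J rule: finite_induct)
  case empty
  then show ?case by (simp add: u_def)
next
  case (insert i I)
  have fin: "finite J" using insert.prems finite_subset by blast
  have "J \<noteq> {}" using insert by auto
  then obtain j where j: "j \<in> J" by blast
  have "card I \<le> card (J - {j})" using insert j fin by simp
  then have "u n I \<preceq> u n (J - {j})" using insert.IH[of "J - {j}"] insert.prems by auto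
  moreover have "w n i \<preceq> u n {j}" using insert j w_subord[of i n j] by (auto simp: u_def)
  ultimately have "w n i + u n I \<preceq> u n {j} + u n (J - {j})"
  proof (intro subord_add)
    have "{j} \<subseteq> {..<N n}" "J - {j} \<subseteq> {..<N n}" using insert.prems j by auto
    then show "idem (u n {j})" "idem (u n (J - {j}))"
      "u n {j} * u n (J - {j}) = 0" "u n (J - {j}) * u n {j} = 0"
      by (auto intro!: u_idem u_orth)
  qed
  moreover have "u n {j} + u n (J - {j}) = u n J" using u_Un[of "{j}" "J - {j}" n] fin j by (simp add: insert_absorb)
  moreover have "u n (insert i I) = w n i + u n I" using insert by (simp add: u_def)
  ultimately show ?case by simp
qed

lemma v_N: "v n (N n) = 1" using w_sum by (simp add: u_def)

lemma w_nonzero: assumes "k < N n" shows "w n k \<noteq> 0"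
proof
  assume "w n k = 0"
  then have "w n l = 0" if "l < N n" for l using w_subord[OF that assms] by simp
  then have "v n (N n) = 0" by (simp add: u_def)
  then show False using v_N[of n] by simp
qed

text \<open>Direct finiteness makes counting faithful: for \<open>l < k\<close> the two partial sums
  would coincide, but piece \<open>l\<close> occurs in only one of them.\<close>

lemma v_le: assumes "v n k \<preceq> v n l" "k \<le> N n" "l \<le> N n" shows "k \<le> l"
proof (rule ccontr)
  assume n: "\<not> k \<le> l"
  have "v n k = v n l"
  proof (rule directly_finite[OF _ _ _ _ assms(1)])
    show "idem (v n k)" "idem (v n l)" by (rule u_idem; use assms in auto)+
    have "{..<k} \<inter> {..<l} = {..<l}" "{..<l} \<inter> {..<k} = {..<l}" using n by auto
    then show "v n k * v n l = v n l" "v n l * v n k = v n l"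
      using assms u_mult[of "{..<k}" n "{..<l}"] u_mult[of "{..<l}" n "{..<k}"] by simp_all
  qed
  moreover have "v n k * u n {l} = u n {l}" "v n l * u n {l} = 0"
    using assms n u_mult[of "{..<k}" n "{l}"] u_orth[of "{..<l}" n "{l}"] by auto
  ultimately have "u n {l} = 0" by simp
  then show False using w_nonzero[of l n] assms n by (simp add: u_def)
qed

lemma v_refine: "k \<le> N n \<Longrightarrow> v n k = v (n + m) (k * r ^ m)"
proof (induction m)
  case (Suc m)
  have kN: "k * r ^ m \<le> N (n + m)" using Suc.prems by (simp add: power_add)
  have "v (n + m) (k * r ^ m) = (\<Sum>i<k * r ^ m. \<Sum>j = i * r..<i * r + r. w (Suc (n + m)) j)"
    unfolding u_def by (rule sum.cong[OF refl], rule w_refine) (use kN in auto)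
  also have "\<dots> = v (Suc (n + m)) (k * r ^ m * r)" unfolding u_def by (rule sum.nat_group)
  finally show ?case using Suc by (simp add: ac_simps)
qed simp

text \<open>The dimension uses upper bounds only, which makes monotonicity immediate. Lower bounds
  enter through \<open>D_approx\<close>, where the two differ by at most \<open>d\<close>
  pieces.\<close>

definition D :: "'r \<Rightarrow> real" where
  "D a = Inf {real k / real (N n) | k n. k \<le> N n \<and> a \<preceq> v n k}"

lemma D_bdd: "bdd_below {real k / real (N n) | k n. k \<le> N n \<and> a \<preceq> v n k}"
  by (rule bdd_belowI[of _ 0]) auto

lemma D_le: "k \<le> N n \<Longrightarrow> a \<preceq> v n k \<Longrightarrow> D a \<le> real k / real (N n)"
  unfolding D_def by (rule cInf_lower[OF _ D_bdd]) blast

lemma D_ge: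
  assumes "\<And>n k. k \<le> N n \<Longrightarrow> a \<preceq> v n k \<Longrightarrow> x \<le> real k / real (N n)"
  shows "x \<le> D a"
  unfolding D_def
proof (rule cInf_greatest)
  have "real (N 0) / real (N 0) \<in> {real k / real (N n) | k n. k \<le> N n \<and> a \<preceq> v n k}"
    using v_N[of 0] subord_one[of a] by (metis (mono_tags, lifting) mem_Collect_eq order_refl)
  then show "{real k / real (N n) | k n. k \<le> N n \<and> a \<preceq> v n k} \<noteq> {}" by blast
qed (use assms in auto)

lemma D_nonneg: "0 \<le> D a" by (rule D_ge) simp

lemma D_le_1: "D a \<le> 1"
  using D_le[of "N 0" 0 a] v_N[of 0] N_pos[of 0] by simp

lemma D_subord: "a \<preceq> b \<Longrightarrow> D a \<le> D b"
  by (rule D_ge) (metis D_le subord_trans)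

lemma v_compare:
  assumes "k \<le> N n" "l \<le> N m" "v n k \<preceq> v m l"
  shows "real k / real (N n) \<le> real l / real (N m)"
proof -
  have "v (n + m) (k * r ^ m) \<preceq> v (n + m) (l * r ^ n)"
    using assms v_refine[of k n m] v_refine[of l m n] by (simp add: add.commute)
  then have "k * r ^ m \<le> l * r ^ n"
    by (rule v_le) (use assms in \<open>simp_all add: power_add\<close>)
  then have "real k * real r ^ m \<le> real l * real r ^ n" by (metis of_nat_le_iff of_nat_mult of_nat_power)
  then show ?thesis using N0 r by (simp add: field_simps)
qed

lemma D_v: "k \<le> N n \<Longrightarrow> D (v n k) = real k / real (N n)"
  by (intro antisym D_le D_ge v_compare) auto

lemma D_approx:
  assumes "idem e"
  obtains k l where "v n k \<preceq> e" "e \<preceq> v n l" "k \<le> l" "l \<le> N n"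
    "real k / real (N n) \<le> D e" "D e \<le> real l / real (N n)" "real l / real (N n) \<le> real k / real (N n) + real d / real (N n)"
proof -
  obtain k l where kl: "v n k \<preceq> e" "e \<preceq> v n l" "k \<le> l" "l \<le> k + d" "l \<le> N n"
    using w_approx[OF assms, of n] unfolding u_def by metis
  have "D (v n k) \<le> D e" using kl by (intro D_subord)
  then have "real k / real (N n) \<le> D e" using D_v[of k n] kl by simp
  moreover have "real l / real (N n) \<le> real k / real (N n) + real d / real (N n)"
    unfolding add_divide_distrib[symmetric] by (rule divide_right_mono) (use kl in auto)
  ultimately show thesis using that kl D_le[of l n e] by blast
qed

text \<open>At level \<open>n\<close>, pieces for \<open>e\<close> and pieces for \<open>f\<close>
  are placed side by side; the resulting error of \<open>2 * d\<close> pieces vanishes for suitable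
  \<open>n\<close>.\<close>

lemma D_add:
  assumes e: "idem e" and f: "idem f" and ef: "e * f = 0" "f * e = 0"
  shows "D (e + f) = D e + D f"
proof -
  have ee: "e * e = e" "f * f = f" using e f by (auto simp: idem_def)
  have "\<bar>D (e + f) - (D e + D f)\<bar> \<le> 2 * (real d / real (N n))" for n
  proof -
    obtain k l where kl: "v n k \<preceq> e" "e \<preceq> v n l" "k \<le> l" "l \<le> N n"
      "real k / real (N n) \<le> D e" "D e \<le> real l / real (N n)" "real l / real (N n) \<le> real k / real (N n) + real d / real (N n)"
      using D_approx[OF e, of n] .
    obtain k' l' where kl': "v n k' \<preceq> f" "f \<preceq> v n l'" "k' \<le> l'" "l' \<le> N n"
      "real k' / real (N n) \<le> D f" "D f \<le> real l' / real (N n)" "real l' / real (N n) \<le> real k' / real (N n) + real d / real (N n)"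
      using D_approx[OF f, of n] .
    have up: "D (e + f) \<le> real l / real (N n) + real l' / real (N n)"
    proof (cases "l + l' \<le> N n")
      case True
      have "v n (l + l') = v n l + u n {l..<l + l'}"
        using u_Un[of "{..<l}" "{l..<l + l'}" n] by (simp add: ivl_disj_un ivl_disj_int)
      moreover have "e + f \<preceq> v n l + u n {l..<l + l'}"
      proof (rule subord_add[OF kl(2)])
        have "v n l' \<preceq> u n {l..<l + l'}" by (rule u_subord) (use True in auto)
        with kl'(2) show "f \<preceq> u n {l..<l + l'}" by (rule subord_trans)
        have "{l..<l + l'} \<subseteq> {..<N n}" "{..<l} \<subseteq> {..<N n}" using True by auto
        then show "idem (v n l)" "idem (u n {l..<l + l'})"
          "v n l * u n {l..<l + l'} = 0" "u n {l..<l + l'} * v n l = 0"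
          by (auto intro!: u_idem u_orth)
      qed
      ultimately have "e + f \<preceq> v n (l + l')" by simp
      then show ?thesis using D_le[OF True] by (simp add: add_divide_distrib)
    next
      case False
      then have "1 \<le> real (l + l') / real (N n)" using N_pos[of n] by (simp add: field_simps flip: of_nat_mult of_nat_add of_nat_power)
      then show ?thesis using D_le_1[of "e + f"] by (simp add: add_divide_distrib)
    qed
    \<comment> \<open>Otherwise \<open>f\<close> contains an \<open>f'\<close> with
      \<open>e + f' = 1\<close> that fits into \<open>N n - k\<close> pieces. Orthogonality to
      \<open>e\<close> gives \<open>f = f'\<close>, so \<open>k'\<close> pieces would fit into fewer
      than \<open>k'\<close>.\<close>
    have kk: "k + k' \<le> N n"
    proof (rule ccontr)
      assume neg: "\<not> ?thesis"
      have k'': "N n - k \<le> k'" "k \<le> N n" "k' \<le> N n" using neg kl kl' by auto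
      have "v n (N n - k) \<preceq> v n k'" by (rule u_subord) (use k'' in auto)
      then have "v n (N n - k) \<preceq> f" using kl'(1) by (rule subord_trans)
      then obtain f' where f': "idem f'" "f' * f = f'" "f * f' = f'" "f' \<preceq> v n (N n - k)" "v n (N n - k) \<preceq> f'"
        using subord_subidem[OF _ f, of "v n (N n - k)"] u_idem[of "{..<N n - k}" n] by auto
      have ef': "e * f' = 0" "f' * e = 0" using f' ef by (metis mult.assoc mult_zero_left mult_zero_right)+
      have "u n {k..<N n} \<preceq> v n (N n - k)" by (rule u_subord) auto
      then have "u n {k..<N n} \<preceq> f'" using f'(5) by (rule subord_trans)
      then have "v n k + u n {k..<N n} \<preceq> e + f'" by (rule subord_add[OF kl(1) _ e f'(1) ef'])
      moreover have "v n k + u n {k..<N n} = 1"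
        using u_Un[of "{..<k}" "{k..<N n}" n] k'' v_N[of n] by (simp add: ivl_disj_un ivl_disj_int)
      ultimately have "1 \<preceq> e + f'" by simp
      then have "1 = e + f'" 
      proof (rule directly_finite[rotated 4])
        show "idem (e + f')" using ee f' ef' by (simp add: idem_def algebra_simps)
      qed simp_all
      then have "f * 1 = f * (e + f')" by simp
      then have "f = f'" using ef f' by (simp add: distrib_left)
      then have "v n k' \<preceq> v n (N n - k)" using kl'(1) f'(4) subord_trans by blast
      then have "k' \<le> N n - k" using v_le k'' by auto
      then show False using neg k'' by simp
    qed
    have "u n {k..<k + k'} \<preceq> v n k'" by (rule u_subord) (use kk in auto)
    then have "u n {k..<k + k'} \<preceq> f" using kl'(1) by (rule subord_trans)
    then have "v n k + u n {k..<k + k'} \<preceq> e + f" by (rule subord_add[OF kl(1) _ e f ef])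
    moreover have "v n k + u n {k..<k + k'} = v n (k + k')"
      using u_Un[of "{..<k}" "{k..<k + k'}" n] by (simp add: ivl_disj_un ivl_disj_int)
    ultimately have "D (v n (k + k')) \<le> D (e + f)" by (simp add: D_subord)
    then have "real k / real (N n) + real k' / real (N n) \<le> D (e + f)"
      using D_v[OF kk] by (simp add: add_divide_distrib)
    then show ?thesis using up kl kl' by linarith
  qed
  note bound = this
  have "\<bar>D (e + f) - (D e + D f)\<bar> \<le> 0 + \<epsilon>" if \<epsilon>: "0 < \<epsilon>" for \<epsilon>
  proof -
    obtain n where "real d / real (N n) < \<epsilon> / 2" using fine[OF half_gt_zero[OF \<epsilon>]] by blast
    then show ?thesis using bound[of n] by linarith
  qed
  then have "\<bar>D (e + f) - (D e + D f)\<bar> \<le> 0" by (rule field_le_epsilon)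
  then show ?thesis by simp
qed

lemma D_positive: assumes "a \<noteq> 0" shows "0 < D a"
proof -
  obtain e where e: "idem e" "pri e = pri a" by (rule pri_idem_exists)
  then have "e \<noteq> 0" using assms pri_eq_0 by metis
  then obtain n where n: "w n 0 \<preceq> e" using w_small e by blast
  have "e \<preceq> a" using e by (metis pri_self subord_pri)
  then have "v n 1 \<preceq> a" using n by (simp add: u_def) (metis subord_trans)
  then have "D (v n 1) \<le> D a" by (rule D_subord)
  moreover have "D (v n 1) = 1 / real (N n)"
  proof -
    have "1 \<le> N n" using N_pos[of n] by linarith
    from D_v[OF this] show ?thesis by simp
  qed
  moreover have "0 < 1 / real (N n)" using N_pos[of n] by simp
  ultimately show ?thesis by linarith
qed

lemma D_rankfun: "rankfun D"
  unfolding rankfun_def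
proof (intro conjI allI impI)
  show "D 1 = 1" using D_v[of "N 0" 0] v_N[of 0] N_pos[of 0] by simp
  show "0 \<le> D a" "D a \<le> 1" for a by (rule D_nonneg D_le_1)+
  show "D (a * b) \<le> D a" for a b by (rule D_subord[OF subord_mult_right])
  show "D (a * b) \<le> D b" for a b by (rule D_subord[OF subord_mult_left])
  show "D (e + f) = D e + D f" if "idem e \<and> idem f \<and> e * f = 0 \<and> f * e = 0" for e f
    using that by (simp add: D_add)
  show "0 < D a" if "a \<noteq> 0" for a using that by (rule D_positive)
qed

text \<open>A rank function gives the same value \<open>1 / N n\<close> to the \<open>N n\<close>
  equivalent pieces, hence agrees with \<open>D\<close> on all \<open>v n k\<close>; other values
  are squeezed between these.\<close>

lemma rankfun_unique: assumes "rankfun \<rho>" shows "\<rho> = D"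
proof
  fix a
  have mono: "x \<preceq> y \<Longrightarrow> \<rho> x \<le> \<rho> y" for x y by (rule rankfun_subord[OF assms])
  have u: "\<rho> (u n I) = real (card I) * \<rho> (w n 0)" if "finite I" "I \<subseteq> {..<N n}" for n I
    using that
  proof (induction I rule: finite_induct)
    case empty
    then show ?case using rankfun_zero[OF assms] by (simp add: u_def)
  next
    case (insert i I)
    have "\<rho> (u n {i} + u n I) = \<rho> (u n {i}) + \<rho> (u n I)"
    proof -
      have "idem (u n {i})" "idem (u n I)" "u n {i} * u n I = 0" "u n I * u n {i} = 0"
        using insert by (auto intro!: u_idem u_orth)
      then show ?thesis using assms unfolding rankfun_def by blast
    qed
    moreover have "\<rho> (u n {i}) = \<rho> (w n 0)"
      using w_subord[of i n 0] w_subord[of 0 n i] insert N_pos[of n] by (auto simp: u_def intro!: antisym mono)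
    ultimately show ?case using insert u_Un[of "{i}" I n] by (simp add: algebra_simps)
  qed
  have w0: "\<rho> (w n 0) = 1 / real (N n)" for n
  proof -
    have "1 = real (N n) * \<rho> (w n 0)"
      using u[of "{..<N n}" n] v_N[of n] assms by (simp add: rankfun_def)
    then show ?thesis using N_pos[of n] by (simp add: field_simps)
  qed
  have v: "\<rho> (v n k) = real k / real (N n)" if "k \<le> N n" for n k
    using u[of "{..<k}" n] w0 that by simp
  show "\<rho> a = D a"
  proof (rule antisym)
    show "\<rho> a \<le> D a" by (rule D_ge) (metis mono v)
    obtain e where e: "idem e" "pri e = pri a" by (rule pri_idem_exists)
    have ea: "e \<preceq> a" "a \<preceq> e" using e by (metis pri_self subord_pri)+
    have "D a \<le> \<rho> a + \<epsilon>" if \<epsilon>: "0 < \<epsilon>" for \<epsilon>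
    proof -
      obtain n where n: "real d / real (N n) < \<epsilon>" using fine[OF \<epsilon>] by blast
      obtain k l where kl: "v n k \<preceq> e" "e \<preceq> v n l" "k \<le> l" "l \<le> N n"
        "real k / real (N n) \<le> D e" "D e \<le> real l / real (N n)" "real l / real (N n) \<le> real k / real (N n) + real d / real (N n)"
        using D_approx[OF e(1), of n] .
      have "D a \<le> D e" by (rule D_subord[OF ea(2)])
      moreover have "real k / real (N n) \<le> \<rho> e" using mono[OF kl(1)] v[of k n] kl by simp
      moreover have "\<rho> e \<le> \<rho> a" by (rule mono[OF ea(1)])
      ultimately show ?thesis using n kl by linarith
    qed
    then show "D a \<le> \<rho> a" by (rule field_le_epsilon)
  qed
qed

end

context continuous_regular_ring
begin

section \<open>Scales from halving and from minimal idempotents\<close>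

definition halves :: "'r \<Rightarrow> 'r \<Rightarrow> 'r \<Rightarrow> bool" where
  "halves g g1 g2 \<longleftrightarrow> idem g1 \<and> idem g2 \<and> g1 + g2 = g \<and> g1 * g2 = 0 \<and> g2 * g1 = 0 \<and> g1 \<preceq> g2 \<and> g2 \<preceq> g1"

text \<open>Both halves are read off one chosen pair, so that they belong to the same
  decomposition.\<close>

definition half :: "bool \<Rightarrow> 'r \<Rightarrow> 'r" where
  "half b g = (let p = SOME p. halves g (fst p) (snd p) in if b then fst p else snd p)"

primrec tree :: "'r \<Rightarrow> nat \<Rightarrow> nat \<Rightarrow> 'r" where
  "tree g 0 k = g"
| "tree g (Suc n) k = half (even k) (tree g n (k div 2))"

lemma half_halves: assumes no_atoms "idem g" shows "halves g (half True g) (half False g)"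
proof -
  have "\<exists>p. halves g (fst p) (snd p)"
    using halving[OF assms] unfolding halves_def by (metis fst_conv snd_conv)
  from someI_ex[OF this] show ?thesis unfolding half_def Let_def by (simp only: if_True if_False)
qed

context
  assumes na: no_atoms
begin

lemma half_idem: "idem g \<Longrightarrow> idem (half b g)"
  using half_halves[OF na, of g] by (cases b) (simp_all add: halves_def)

lemma half_below: assumes "idem g" shows "half b g * g = half b g" "g * half b g = half b g"
proof -
  obtain x y where xy: "x = half True g" "y = half False g" by simp
  have h: "halves g x y" unfolding xy by (rule half_halves[OF na assms])
  then have g: "g = x + y" and h: "x * x = x" "y * y = y" "x * y = 0" "y * x = 0"
    by (auto simp: halves_def idem_def)
  have "x * g = x" "g * x = x" "y * g = y" "g * y = y" by (simp_all add: g distrib_left distrib_right h)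
  then show "half b g * g = half b g" "g * half b g = half b g" using xy by (cases b; simp)+
qed

lemma half_orth: "idem g \<Longrightarrow> b \<noteq> c \<Longrightarrow> half b g * half c g = 0"
  using half_halves[OF na, of g] by (cases b; cases c) (simp_all add: halves_def)

lemma half_subord_half: "idem g \<Longrightarrow> half b g \<preceq> half c g"
  using half_halves[OF na, of g] by (cases b; cases c) (simp_all add: halves_def)

lemma half_sum: "idem g \<Longrightarrow> half True g + half False g = g"
  using half_halves[OF na, of g] by (simp add: halves_def)

lemma tree_idem: "idem g \<Longrightarrow> idem (tree g n k)"
  by (induction n arbitrary: k) (simp_all add: half_idem)

lemma tree_split: "idem g \<Longrightarrow> tree g n k = tree g (Suc n) (2 * k) + tree g (Suc n) (Suc (2 * k))"
  using half_sum[OF tree_idem] by simp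

lemma tree_orth: "idem g \<Longrightarrow> k < 2 ^ n \<Longrightarrow> l < 2 ^ n \<Longrightarrow> k \<noteq> l \<Longrightarrow> tree g n k * tree g n l = 0"
proof (induction n arbitrary: k l)
  case (Suc n)
  let ?x = "tree g n (k div 2)" and ?y = "tree g n (l div 2)"
  have i: "idem ?x" "idem ?y" using Suc.prems tree_idem by blast+
  show ?case
  proof (cases "k div 2 = l div 2")
    case True
    then have "even k \<noteq> even l" using Suc.prems(4) by presburger
    then show ?thesis using half_orth[OF i(1), of "even k" "even l"] True by simp
  next
    case False
    have "?x * ?y = 0" using Suc.IH[of "k div 2" "l div 2"] Suc.prems False by auto
    moreover have "half (even k) ?x * half (even l) ?y = half (even k) ?x * (?x * ?y) * half (even l) ?y"
      by (metis half_below(1)[OF i(1)] half_below(2)[OF i(2)] mult.assoc)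
    ultimately show ?thesis by simp
  qed
qed simp

text \<open>Equivalent parents have equivalent halves by \<open>half_subord\<close>, so equivalence
  spreads from the root to all nodes of a level.\<close>

lemma tree_subord: "idem g \<Longrightarrow> tree g n k \<preceq> tree g n l"
proof (induction n arbitrary: k l)
  case (Suc n)
  let ?x = "tree g n (k div 2)" and ?y = "tree g n (l div 2)"
  have i: "idem ?x" "idem ?y" using Suc.prems tree_idem by blast+
  have xy: "?x \<preceq> ?y" using Suc by blast
  have "half True ?x \<preceq> half True ?y"
  proof (rule half_subord)
    show "half True ?x + half False ?x \<preceq> half True ?y + half False ?y"
      using xy half_sum i by simp
    show "half True ?x * half False ?x = 0" "half False ?x * half True ?x = 0"
      using half_orth[OF i(1), of True False] half_orth[OF i(1), of False True] by simp_all
  qed (use i half_idem half_subord_half in auto)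
  then show ?case using half_subord_half[OF i(1)] half_subord_half[OF i(2)]
    by simp (metis subord_trans)
qed simp

lemma tree_sum_refine: "idem g \<Longrightarrow> tree g n k = (\<Sum>j = k * 2..<k * 2 + 2. tree g (Suc n) j)"
  using tree_split[of g n k] by (simp add: numeral_2_eq_2 mult.commute)

lemma tree_sum: "idem g \<Longrightarrow> (\<Sum>k<2 ^ n. tree g n k) = g"
proof (induction n)
  case (Suc n)
  have "(\<Sum>k<2 ^ n. tree g n k) = (\<Sum>k<2 ^ n. \<Sum>j = k * 2..<k * 2 + 2. tree g (Suc n) j)"
    by (rule sum.cong[OF refl tree_sum_refine[OF Suc.prems]])
  also have "\<dots> = (\<Sum>k<2 ^ n * 2. tree g (Suc n) k)" by (rule sum.nat_group)
  finally show ?case using Suc by (simp add: mult.commute)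
qed (simp add: lessThan_Suc)

lemma tree_below: assumes g: "idem g" shows "g * tree g n k = tree g n k \<and> tree g n k * g = tree g n k"
proof (induction n arbitrary: k)
  case 0
  then show ?case using g by (simp add: idem_def)
next
  case (Suc n)
  let ?x = "tree g n (k div 2)" and ?h = "half (even k) (tree g n (k div 2))"
  have h: "?h * ?x = ?h" "?x * ?h = ?h" by (rule half_below[OF tree_idem[OF g]])+
  have "g * ?h = ?h" "?h * g = ?h" using Suc[of "k div 2"] h by (metis mult.assoc)+
  then show ?case by (simp only: tree.simps)
qed

text \<open>The right children along the leftmost branch form an infinite orthogonal sequence.
  Orthogonality holds because later ones lie below the earlier nodes of that branch.\<close>

lemma tree_zero_small: "idem g \<Longrightarrow> tree g n 0 * tree g (Suc (n + m)) 1 = tree g (Suc (n + m)) 1"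
  "idem g \<Longrightarrow> tree g (Suc (n + m)) 1 * tree g n 0 = tree g (Suc (n + m)) 1"
proof -
  assume g: "idem g"
  have z: "tree g n 0 * tree g (n + m) 0 = tree g (n + m) 0 \<and> tree g (n + m) 0 * tree g n 0 = tree g (n + m) 0"
  proof (induction m)
    case 0
    then show ?case using tree_idem[OF g] by (simp add: idem_def)
  next
    case (Suc m)
    obtain x y h where xyh: "x = tree g (n + m) 0" "y = tree g n 0" "h = half True (tree g (n + m) 0)" by simp
    have "h * x = h" "x * h = h" unfolding xyh by (rule half_below[OF tree_idem[OF g]])+
    moreover have "y * x = x" "x * y = x" using Suc xyh by simp_all
    ultimately have "y * h = h" "h * y = h" by (metis mult.assoc)+
    moreover have "h = tree g (n + Suc m) 0" by (simp add: xyh)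
    ultimately show ?case using xyh(2) by simp
  qed
  obtain x y h where xyh: "x = tree g (n + m) 0" "y = tree g n 0" "h = half False (tree g (n + m) 0)" by simp
  have "h * x = h" "x * h = h" unfolding xyh by (rule half_below[OF tree_idem[OF g]])+
  moreover have "y * x = x" "x * y = x" using z xyh by simp_all
  ultimately have "y * h = h" "h * y = h" by (metis mult.assoc)+
  moreover have "h = tree g (Suc (n + m)) 1" by (simp add: xyh)
  ultimately show "tree g n 0 * tree g (Suc (n + m)) 1 = tree g (Suc (n + m)) 1"
    "tree g (Suc (n + m)) 1 * tree g n 0 = tree g (Suc (n + m)) 1" using xyh by simp_all
qed

text \<open>Otherwise comparability makes \<open>e\<close> subordinate to the nodes of every level,
  so \<open>e\<close> would have copies in infinitely many orthogonal nodes.\<close>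

lemma tree_small: assumes "idem e" "e \<noteq> 0" shows "\<exists>n. tree 1 n 0 \<preceq> e"
proof (rule ccontr)
  assume neg: "\<nexists>n. tree 1 n 0 \<preceq> e"
  have le: "e \<preceq> tree 1 n 0" for n
    by (rule comparable[of e "tree 1 n 0"]) (use neg in auto)
  define q where "q n = tree 1 (Suc n) 1" for n
  have i: "idem (q n)" for n by (simp add: q_def tree_idem del: tree.simps)
  have o: "q m * q n = 0 \<and> q n * q m = 0" if mn: "m < n" for m n
  proof -
    obtain j where n: "n = Suc m + j" using less_imp_Suc_add[OF mn] by auto
    have z: "tree 1 (Suc m) 0 * q n = q n" "q n * tree 1 (Suc m) 0 = q n"
      unfolding q_def n by (rule tree_zero_small[OF idem_1])+
    have "(1::nat) < 2 ^ Suc m" by (rule one_less_power) simp_all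
    then have "tree 1 (Suc m) 1 * tree 1 (Suc m) 0 = 0" "tree 1 (Suc m) 0 * tree 1 (Suc m) 1 = 0"
      using tree_orth[OF idem_1, of 1 "Suc m" 0] tree_orth[OF idem_1, of 0 "Suc m" 1]
      by (simp_all del: tree.simps)
    then show ?thesis unfolding q_def[of m] using z by (metis mult.assoc mult_zero_left mult_zero_right)
  qed
  have "e \<preceq> q n" for n unfolding q_def by (rule subord_trans[OF le tree_subord[OF idem_1]])
  moreover have "q m * q n = 0" if "m \<noteq> n" for m n using o that by (metis nat_neq_iff)
  ultimately have "e = 0" using no_infinite_copies[OF i] by blast
  then show False using assms by simp
qed

lemma tree_scale: "rank_scale 1 2 1 (tree 1)"
proof
  show "\<exists>n. real 1 / real (1 * 2 ^ n) < \<epsilon>" if "0 < \<epsilon>" for \<epsilon>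
    using real_arch_pow_inv[OF that, of "1/2"] by (simp add: power_divide)
  show "\<exists>k l. (\<Sum>i<k. tree 1 n i) \<preceq> e \<and> e \<preceq> (\<Sum>i<l. tree 1 n i) \<and> k \<le> l \<and> l \<le> k + 1 \<and> l \<le> 1 * 2 ^ n"
    if "idem e" for e n
  proof -
    let ?P = "\<lambda>k. k \<le> 2 ^ n \<and> (\<Sum>i<k. tree 1 n i) \<preceq> e"
    \<comment> \<open>\<open>k\<close> is the largest count that fits into \<open>e\<close>;
      comparability then lets \<open>e\<close> fit into \<open>k + 1\<close> pieces, whence
      \<open>d = 1\<close>.\<close>
    define k where "k = (GREATEST k. ?P k)"
    have P: "?P 0" by simp
    have k: "?P k" unfolding k_def by (rule GreatestI_nat[of ?P 0 "2 ^ n"]) (use P in auto)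
    have max: "j \<le> k" if "?P j" for j unfolding k_def by (rule Greatest_le_nat[of ?P j "2 ^ n"]) (use that in auto)
    show ?thesis
    proof (cases "k = 2 ^ n")
      case True
      then have "e \<preceq> (\<Sum>i<k. tree 1 n i)" using tree_sum[OF idem_1, of n] by simp
      then show ?thesis using k by (intro exI[of _ k]) auto
    next
      case False
      then have "\<not> ?P (Suc k)" using max[of "Suc k"] by auto
      then have "\<not> (\<Sum>i<Suc k. tree 1 n i) \<preceq> e" using k False by auto
      then have "e \<preceq> (\<Sum>i<Suc k. tree 1 n i)" using comparable[of e "\<Sum>i<Suc k. tree 1 n i"] by blast
      then show ?thesis using k False by (intro exI[of _ k] exI[of _ "Suc k"]) auto
    qed
  qed
  show "idem (tree 1 n k)" "tree 1 n k \<preceq> tree 1 n l" for n k l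
    by (rule tree_idem[OF idem_1], rule tree_subord[OF idem_1])
  show "tree 1 n k * tree 1 n l = 0" if "k < 1 * 2 ^ n" "l < 1 * 2 ^ n" "k \<noteq> l" for n k l
    by (rule tree_orth[OF idem_1]) (use that in auto)
  show "(\<Sum>k<1 * 2 ^ n. tree 1 n k) = 1" for n using tree_sum[OF idem_1, of n] by (simp only: mult_1)
  show "tree 1 n k = (\<Sum>j = k * 2..<k * 2 + 2. tree 1 (Suc n) j)" for n k
    by (rule tree_sum_refine[OF idem_1])
  show "\<exists>n. tree 1 n 0 \<preceq> e" if "idem e" "e \<noteq> 0" for e by (rule tree_small[OF that])
qed simp_all

end

lemma atom_subord:
  assumes M: "idem (M::'r)" "M \<noteq> 0" "\<And>d. idem d \<Longrightarrow> M * d = d \<Longrightarrow> d * M = d \<Longrightarrow> d = 0 \<or> d = M"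
    and e: "idem e" "e \<noteq> 0"
  shows "M \<preceq> e"
proof (rule comparable[of M e])
  assume "e \<preceq> M"
  then obtain e' where e': "idem e'" "e' * M = e'" "M * e' = e'" "e' \<preceq> e" "e \<preceq> e'"
    using subord_subidem[OF _ M(1) e(1)] by metis
  have "e' \<noteq> 0" using e'(5) e(2) by auto
  then have "e' = M" using M(3) e' by blast
  then show ?thesis using e' by simp
qed

text \<open>Copies of \<open>M\<close> are split off greedily until \<open>1\<close> is exhausted;
  an infinite run would contradict \<open>no_infinite_copies\<close>. The pieces are not refined
  further, so all levels share the same \<open>w\<close>.\<close>

lemma atom_scale:
  assumes M: "idem (M::'r)" "M \<noteq> 0" "\<And>d. idem d \<Longrightarrow> M * d = d \<Longrightarrow> d * M = d \<Longrightarrow> d = 0 \<or> d = M"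
  obtains N0 w where "rank_scale N0 1 0 w" "\<And>a::'r. a \<noteq> 0 \<Longrightarrow> w 0 0 \<preceq> a"
proof -
  have small: "M \<preceq> e" if "idem e" "e \<noteq> 0" for e
    by (rule atom_subord[OF M(1,2) _ that]) (rule M(3))
  have "\<exists>p. idem s \<and> s \<noteq> 1 \<longrightarrow> idem p \<and> p * s = 0 \<and> s * p = 0 \<and> p \<preceq> M \<and> M \<preceq> p" for s
  proof (cases "idem s \<and> s \<noteq> 1")
    case True
    have "idem (1 - s)" "1 - s \<noteq> 0" using True by (auto simp: idem_def algebra_simps)
    then obtain p where p: "idem p" "p * (1 - s) = p" "(1 - s) * p = p" "p \<preceq> M" "M \<preceq> p"
      using subord_subidem[OF small[of "1 - s"] _ M(1)] by metis
    then have "p * s = 0" "s * p = 0" by (simp_all add: algebra_simps)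
    then show ?thesis using p by blast
  qed auto
  then obtain pick where pick: "\<And>s. idem s \<Longrightarrow> s \<noteq> 1 \<Longrightarrow>
      idem (pick s) \<and> pick s * s = 0 \<and> s * pick s = 0 \<and> pick s \<preceq> M \<and> M \<preceq> pick s"
    by metis
  define S where "S = rec_nat 0 (\<lambda>_ s. if s = 1 then s else s + pick s)"
  have S: "S 0 = 0" "\<And>n. S (Suc n) = (if S n = 1 then S n else S n + pick (S n))" by (simp_all add: S_def)
  have Si: "idem (S n)" for n
  proof (induction n)
    case (Suc n)
    show ?case
    proof (cases "S n = 1")
      case False
      then show ?thesis using Suc pick[OF Suc False] by (simp add: S idem_def algebra_simps)
    qed (use Suc in \<open>simp add: S\<close>)
  qed (simp add: S)
  define w where "w n = pick (S n)" for n
  have Sw: "S n = (\<Sum>i<n. w i)" if "\<forall>i<n. S i \<noteq> 1" for n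
    using that
  proof (induction n)
    case (Suc n)
    have "S (Suc n) = S n + w n" using Suc.prems by (simp add: S w_def)
    then show ?case using Suc by simp
  qed (simp add: S)
  have wp: "idem (w n)" "w n * S n = 0" "S n * w n = 0" "w n \<preceq> M" "M \<preceq> w n" if "S n \<noteq> 1" for n
    using pick[OF Si that] by (simp_all add: w_def)
  have Swl: "S n * w m = w m \<and> w m * S n = w m" if "m < n" "\<forall>i<n. S i \<noteq> 1" for m n
    using that
  proof (induction n)
    case (Suc n)
    have n1: "S n \<noteq> 1" using Suc.prems by simp
    have s: "S (Suc n) = S n + w n" using n1 by (simp add: S w_def)
    show ?case
    proof (cases "m = n")
      case True
      then show ?thesis using wp[OF n1] by (simp add: s distrib_left distrib_right idem_def)
    next
      case False
      then have IH: "S n * w m = w m" "w m * S n = w m" using Suc by auto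
      have "w n * w m = 0" "w m * w n = 0" using wp(2,3)[OF n1] IH by (metis mult.assoc mult_zero_left mult_zero_right)+
      then show ?thesis by (simp add: s distrib_left distrib_right IH)
    qed
  qed simp
  have wo: "w m * w n = 0 \<and> w n * w m = 0" if "m < n" "\<forall>i\<le>n. S i \<noteq> 1" for m n
  proof -
    have a: "S n * w m = w m" "w m * S n = w m" using Swl[OF that(1)] that(2) by auto
    have b: "w n * S n = 0" "S n * w n = 0" using wp that by auto
    show ?thesis by (metis a b mult.assoc mult_zero_left mult_zero_right)
  qed
  have "\<exists>n. S n = 1"
  proof (rule ccontr)
    assume neg: "\<nexists>n. S n = 1"
    have "w m * w n = 0" if "m \<noteq> n" for m n
      using wo[of m n] wo[of n m] neg that by (metis nat_neq_iff)
    then have "M = 0" using no_infinite_copies[of w M] wp neg by blast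
    then show False using M(2) by simp
  qed
  define K where "K = (LEAST n. S n = 1)"
  have K: "S K = 1" unfolding K_def by (rule LeastI_ex) fact
  have K': "S i \<noteq> 1" if "i < K" for i using not_less_Least[of i "\<lambda>n. S n = 1"] that unfolding K_def by blast
  have K0: "0 < K" using K S(1) by (cases K) auto
  have wK: "idem (w i)" "w i \<preceq> M" "M \<preceq> w i" if "i < K" for i using wp K' that by auto
  have wKo: "w i * w j = 0" if "i < K" "j < K" "i \<noteq> j" for i j
    using wo[of i j] wo[of j i] K' that by (metis le_less_trans nat_neq_iff)
  have sum1: "(\<Sum>i<K. w i) = 1" using Sw[of K] K K' by simp
  have psum: "S j = (\<Sum>i<j. w i)" if "j \<le> K" for j using Sw[of j] K' that by simp
  have scale: "rank_scale K 1 0 (\<lambda>_. w)"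
  proof
    show "0 < K" by (rule K0)
    show "\<exists>k l. (\<Sum>i<k. w i) \<preceq> e \<and> e \<preceq> (\<Sum>i<l. w i) \<and> k \<le> l \<and> l \<le> k + 0 \<and> l \<le> K * 1 ^ n"
      if e: "idem e" for e and n :: nat
    proof -
      let ?P = "\<lambda>k. k \<le> K \<and> (\<Sum>i<k. w i) \<preceq> e"
      define k where "k = (GREATEST k. ?P k)"
      have P: "?P 0" by simp
      have k: "?P k" unfolding k_def by (rule GreatestI_nat[of ?P 0 K]) (use P in auto)
      have max: "j \<le> k" if "?P j" for j unfolding k_def by (rule Greatest_le_nat[of ?P j K]) (use that in auto)
      have "S k \<preceq> e" using k psum by simp
      then obtain e' where e': "idem e'" "e' * e = e'" "e * e' = e'" "e' \<preceq> S k" "S k \<preceq> e'"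
        using subord_subidem[OF _ e Si] by metis
      \<comment> \<open>A nonzero remainder \<open>e - e'\<close> would contain one more copy of
        \<open>M\<close>, so the count is exact and \<open>d = 0\<close>.\<close>
      have "e = e'"
      proof (rule ccontr)
        assume ne: "e \<noteq> e'"
        have ee: "e * e = e" "e' * e' = e'" using e e' by (auto simp: idem_def)
        show False
        proof (cases "k = K")
          case True
          then have "1 \<preceq> e'" using e'(5) K by simp
          then have "1 = e'" using directly_finite[of 1 e'] e'(1) by simp
          then show False using ne e' by simp
        next
          case False
          then have kK: "k < K" using k by simp
          have i: "idem (e - e')" by (simp add: idem_def algebra_simps ee e')
          then have "M \<preceq> e - e'" using small ne by simp
          then have "w k \<preceq> e - e'" using wK(2)[OF kK] subord_trans by blast
          then have "S k + w k \<preceq> e' + (e - e')"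
            by (intro subord_add[OF e'(5) _ e'(1) i]) (simp_all add: algebra_simps ee e')
          then have "?P (Suc k)" using kK psum[of k] by simp
          then show False using max[of "Suc k"] by simp
        qed
      qed
      then have "e \<preceq> (\<Sum>i<k. w i)" using e'(4) psum k by simp
      then show ?thesis using k by (intro exI[of _ k]) auto
    qed
    show "\<exists>n. w 0 \<preceq> e" if "idem e" "e \<noteq> 0" for e
      using small[OF that] wK(2)[OF K0] subord_trans by blast
    show "w k \<preceq> w l" if "k < K * 1 ^ n" "l < K * 1 ^ n" for k l and n :: nat
      using wK[of k] wK[of l] that subord_trans by auto
    show "idem (w k)" if "k < K * 1 ^ n" for n k :: nat using wK that by simp
    show "w k * w l = 0" if "k < K * 1 ^ n" "l < K * 1 ^ n" "k \<noteq> l" for n k l :: nat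
      by (rule wKo) (use that in simp_all)
    show "(\<Sum>k<K * 1 ^ n. w k) = 1" for n :: nat using sum1 by simp
    show "w k = (\<Sum>j = k * 1..<k * 1 + 1. w j)" for k by simp
  qed simp_all
  have "w 0 \<preceq> a" if a: "a \<noteq> 0" for a
  proof -
    obtain e where e: "idem e" "pri e = pri a" by (rule pri_idem_exists)
    then have "e \<noteq> 0" using a pri_eq_0 by metis
    then have "M \<preceq> e" using small e by blast
    moreover have "e \<preceq> a" using e by (metis pri_self subord_pri)
    ultimately show ?thesis using wK(2)[OF K0] subord_trans by blast
  qed
  then show thesis using that[OF scale] by blast
qed

text \<open>The atomic case is recorded as a positive lower bound for nonzero ranks, since this is
  what contradicts non-discreteness of the rank metric.\<close>

theorem rank_function_dichotomy:
  obtains \<rho> where "rankfun (\<rho> :: 'r \<Rightarrow> real)" "\<And>\<rho>'. rankfun \<rho>' \<Longrightarrow> \<rho>' = \<rho>"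
    "no_atoms \<or> (\<exists>\<epsilon>>0. \<forall>a. a \<noteq> 0 \<longrightarrow> \<epsilon> \<le> \<rho> a)"
proof (cases no_atoms)
  case True
  interpret rank_scale ty 1 2 1 "tree 1" by (rule tree_scale[OF True])
  show thesis using that D_rankfun rankfun_unique True by blast
next
  case False
  then obtain M where M: "idem M" "M \<noteq> 0" "\<And>d. idem d \<Longrightarrow> M * d = d \<Longrightarrow> d * M = d \<Longrightarrow> d = 0 \<or> d = (M::'r)"
    unfolding no_atoms_def by blast
  obtain N0 w where sc: "rank_scale N0 1 0 w" and small: "\<And>a. a \<noteq> 0 \<Longrightarrow> w 0 0 \<preceq> (a::'r)"
    using atom_scale[OF M] by blast
  interpret rank_scale ty N0 1 0 w by (rule sc)
  have "D (w 0 0) \<le> D a" if "a \<noteq> 0" for a using small[OF that] by (rule D_subord)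
  moreover have "0 < D (w 0 0)" using D_positive w_nonzero[of 0 0] N0 by simp
  ultimately show thesis using that[OF D_rankfun rankfun_unique] by blast
qed

end

section \<open>Algebraic elements\<close>

definition central :: "'r::ring_1 \<Rightarrow> bool" where
  "central z \<longleftrightarrow> (\<forall>x. z * x = x * z)"

text \<open>
  The elements \<open>x\<close>, \<open>c x\<close>, ..., \<open>c ^ (m - 1) x\<close> are right linearly independent over the corner
  \<open>g R g\<close>, with coordinate functionals \<open>y j\<close>; \<open>top_order\<close> expresses that \<open>m\<close> is maximal.
\<close>

definition dual :: "'r::ring_1 \<Rightarrow> nat \<Rightarrow> 'r \<Rightarrow> 'r \<Rightarrow> (nat \<Rightarrow> 'r) \<Rightarrow> bool" where
  "dual c m x g y \<longleftrightarrow> idem g \<and> g \<noteq> 0 \<and> x * g = x \<and>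
     (\<forall>i<m. \<forall>j<m. y j * (c ^ i * x) = (if i = j then g else 0))"

definition top_order :: "'r::ring_1 \<Rightarrow> 'r \<Rightarrow> nat \<Rightarrow> bool" where
  "top_order c e m \<longleftrightarrow> (\<forall>x g y. e * x = x \<and> dual c m x g y \<longrightarrow>
     c ^ m * x = (\<Sum>j<m. c ^ j * x * (y j * (c ^ m * x))))"

definition algebraic_on :: "'r::ring_1 \<Rightarrow> 'r \<Rightarrow> nat \<Rightarrow> bool" where
  "algebraic_on c e d \<longleftrightarrow> (\<exists>\<mu>. (\<forall>j<d. central (\<mu> j)) \<and> c ^ d * e = (\<Sum>j<d. \<mu> j * (c ^ j * e)))"

lemma central_left_commute: "central z \<Longrightarrow> x * (z * y) = z * (x * y)"
  unfolding central_def by (metis mult.assoc)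

lemma dual_normalize: "dual c m x g y \<Longrightarrow> dual c m x g (\<lambda>j. g * y j)"
  by (simp add: dual_def idem_def mult.assoc)

lemma dual_sum:
  assumes "dual c m x g y" "j < m"
  shows "y j * (\<Sum>i<m. c ^ i * x * s i) = g * s j"
proof -
  have "y j * (\<Sum>i<m. c ^ i * x * s i) = (\<Sum>i<m. y j * (c ^ i * x) * s i)"
    by (simp add: sum_distrib_left mult.assoc)
  also have "\<dots> = (\<Sum>i<m. if i = j then g * s j else 0)"
    by (rule sum.cong) (use assms in \<open>auto simp: dual_def\<close>)
  also have "\<dots> = g * s j" using assms(2) by (simp add: sum.delta)
  finally show ?thesis .
qed

text \<open>If \<open>d < m\<close>, then \<open>y d\<close> maps \<open>c ^ d * x\<close> to
  \<open>g\<close> but kills the lower powers by which the relation expresses it; so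
  \<open>g\<close> would be zero.\<close>

lemma dual_order_bound:
  assumes alg: "algebraic_on c e d" and x: "e * x = x" and dual: "dual c m x g y"
  shows "m \<le> d"
proof (rule ccontr)
  assume "\<not> m \<le> d"
  then have d: "d < m" by simp
  obtain \<mu> where \<mu>: "\<forall>j<d. central (\<mu> j)" "c ^ d * e = (\<Sum>j<d. \<mu> j * (c ^ j * e))"
    using alg unfolding algebraic_on_def by blast
  have "g = y d * (c ^ d * x)" using dual d by (simp add: dual_def)
  also have "c ^ d * x = (c ^ d * e) * x" by (simp add: mult.assoc x)
  also have "\<dots> = (\<Sum>j<d. \<mu> j * (c ^ j * x))"
    unfolding \<mu>(2) sum_distrib_right by (simp add: mult.assoc x)
  also have "y d * \<dots> = (\<Sum>j<d. \<mu> j * (y d * (c ^ j * x)))"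
    unfolding sum_distrib_left by (rule sum.cong) (use \<mu>(1) central_left_commute in auto)
  also have "\<dots> = 0" by (rule sum.neutral) (use dual d in \<open>simp add: dual_def\<close>)
  finally show False using dual by (simp add: dual_def)
qed

context continuous_regular_ring
begin

text \<open>As in Gram-Schmidt orthogonalization, \<open>p\<close> projects onto the span of the
  lower powers and \<open>t\<close> is the residue of \<open>c ^ m * x\<close>. Regularity gives a
  functional for \<open>t\<close> after shrinking \<open>g\<close> to \<open>g'\<close>.\<close>

lemma dual_extend:
  assumes dual: "dual c m x (g::'r) y"
    and neq: "c ^ m * x \<noteq> (\<Sum>j<m. c ^ j * x * (y j * (c ^ m * x)))"
  obtains g' y' where "dual c (Suc m) (x * g') g' y'"
proof -
  have gg: "g * g = g" and xg: "x * g = x"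
    and yx: "\<And>i j. i < m \<Longrightarrow> j < m \<Longrightarrow> y j * (c ^ i * x) = (if i = j then g else 0)"
    using dual by (simp_all add: dual_def idem_def)
  define p where "p = (\<Sum>j<m. c ^ j * x * y j)"
  define t where "t = c ^ m * x - p * (c ^ m * x)"
  have pcx: "p * (c ^ i * x) = c ^ i * x" if "i < m" for i
  proof -
    have "p * (c ^ i * x) = (\<Sum>j<m. c ^ j * x * (y j * (c ^ i * x)))"
      by (simp add: p_def sum_distrib_right mult.assoc)
    also have "\<dots> = (\<Sum>j<m. if i = j then c ^ i * x else 0)"
      by (rule sum.cong) (use yx that xg in \<open>auto simp: mult.assoc\<close>)
    finally show ?thesis using that by (simp add: sum.delta)
  qed
  have "t \<noteq> 0" using neq by (simp add: t_def p_def sum_distrib_right mult.assoc)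
  have tg: "t * g = t" by (simp add: t_def left_diff_distrib mult.assoc xg)
  obtain t' where t': "t * t' * t = t" using regular by blast
  define s where "s = g * t'"
  define g' where "g' = s * t"
  have tg': "t * g' = t" by (metis g'_def s_def mult.assoc t' tg)
  have g'g': "g' * g' = g'" by (metis g'_def mult.assoc tg')
  have gg': "g * g' = g'" by (simp add: g'_def s_def gg flip: mult.assoc)
  have "g' \<noteq> 0" using tg' \<open>t \<noteq> 0\<close> by auto
  define ym where "ym = s * (1 - p)"
  have ym1: "ym * (c ^ m * (x * g')) = g'"
  proof -
    have "ym * (c ^ m * (x * g')) = s * (t * g')" by (simp add: ym_def t_def algebra_simps)
    then show ?thesis by (simp only: tg' g'_def[symmetric])
  qed
  have ym2: "ym * (c ^ i * (x * g')) = 0" if "i < m" for i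
  proof -
    have "ym * (c ^ i * (x * g')) = s * (c ^ i * x - p * (c ^ i * x)) * g'"
      by (simp add: ym_def algebra_simps)
    then show ?thesis using pcx[OF that] by simp
  qed
  \<comment> \<open>The old functionals are corrected by multiples of \<open>ym\<close> so that they
    vanish on the new vector \<open>c ^ m * (x * g')\<close>.\<close>
  define y' where "y' j = (if j = m then ym else g' * (y j - y j * (c ^ m * x) * ym))" for j
  have "dual c (Suc m) (x * g') g' y'"
    unfolding dual_def
  proof (intro conjI allI impI)
    show "idem g'" using g'g' by (simp add: idem_def)
    show "x * g' * g' = x * g'" by (simp add: mult.assoc g'g')
    fix i j assume ij: "i < Suc m" "j < Suc m"
    show "y' j * (c ^ i * (x * g')) = (if i = j then g' else 0)"
    proof (cases "j = m")
      case True
      then show ?thesis using ij ym1 ym2[of i] by (auto simp: y'_def less_Suc_eq)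
    next
      case False
      then have j: "j < m" using ij by simp
      have e: "y' j * (c ^ i * (x * g')) = g' * (y j * (c ^ i * x) * g' - y j * (c ^ m * x) * (ym * (c ^ i * (x * g'))))"
        using False by (simp add: y'_def left_diff_distrib mult.assoc)
      show ?thesis
      proof (cases "i = m")
        case True
        then show ?thesis using e ym1 False by simp
      next
        case im: False
        then have "i < m" using ij by simp
        then show ?thesis using ym2 yx[of i j] j gg' g'g' by (simp add: e)
      qed
    qed
  qed (fact \<open>g' \<noteq> 0\<close>)
  then show thesis by (rule that)
qed

lemma top_order_exists:
  assumes e: "idem (e::'r)" "e \<noteq> 0" and alg: "algebraic_on c e d"
  obtains m x g y where "0 < m" "m \<le> d" "top_order c e m" "e * x = x" "dual c m x g y"
    "\<And>m' x' g' y'. e * x' = x' \<Longrightarrow> dual c m' x' g' y' \<Longrightarrow> m' \<le> m"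
proof -
  define P where "P m \<longleftrightarrow> (\<exists>x g y. e * x = x \<and> dual c m x g y)" for m
  have bound: "m \<le> d" if "P m" for m using that dual_order_bound[OF alg] unfolding P_def by blast
  \<comment> \<open>Order \<open>1\<close> is always attained, by \<open>x = e\<close>; hence the
    maximal order is positive.\<close>
  have "dual c 1 e e (\<lambda>_. e)" using e by (simp add: dual_def idem_def)
  then have P1: "P 1" unfolding P_def using e(1) by (auto simp: idem_def)
  define m where "m = (GREATEST m. P m)"
  have Pm: "P m" unfolding m_def by (rule GreatestI_nat[of P, OF P1]) (rule bound)
  have max: "m' \<le> m" if "P m'" for m' unfolding m_def by (rule Greatest_le_nat[of P, OF that]) (rule bound)
  obtain x g y where xgy: "e * x = x" "dual c m x g y" using Pm unfolding P_def by blast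
  have "top_order c e m" unfolding top_order_def
  proof (intro allI impI)
    fix x g y assume a: "e * x = x \<and> dual c m x g y"
    show "c ^ m * x = (\<Sum>j<m. c ^ j * x * (y j * (c ^ m * x)))"
    proof (rule ccontr)
      assume "\<not> ?thesis"
      then obtain g' y' where "dual c (Suc m) (x * g') g' y'" using dual_extend[of c m x g y] a by blast
      moreover have "e * (x * g') = x * g'" using a by (simp flip: mult.assoc)
      ultimately have "P (Suc m)" unfolding P_def by blast
      then show False using max[of "Suc m"] by simp
    qed
  qed
  then show thesis using that[of m x g y] max[OF P1] bound[OF Pm] xgy max unfolding P_def by fastforce
qed

section \<open>Centrality of the coefficients\<close>

lemma simple_ring:
  assumes na: no_atoms and "(a::'r) \<noteq> 0"
  obtains n u v where "(\<Sum>i<n::nat. u i * a * v i) = 1"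
proof -
  obtain e where e: "idem e" "pri e = pri a" by (rule pri_idem_exists)
  then have e0: "e \<noteq> 0" using assms pri_eq_0 by metis
  obtain n where n: "tree 1 n 0 \<preceq> e" using tree_small[OF na e(1) e0] by blast
  have "e \<preceq> a" using e by (metis pri_self subord_pri)
  \<comment> \<open>One piece below \<open>a\<close> suffices, since all pieces of its level are
    equivalent and sum to \<open>1\<close>.\<close>
  then have "tree 1 n k \<preceq> a" for k using n tree_subord[OF na idem_1, of n k 0] by (meson subord_trans)
  then have "\<exists>x y. tree 1 n k = x * a * y" for k unfolding subord_def by blast
  then obtain u v where uv: "\<And>k. tree 1 n k = u k * a * v k" by metis
  have "(\<Sum>i<2 ^ n. u i * a * v i) = 1" using tree_sum[OF na idem_1, of n] by (simp add: uv)
  then show thesis by (rule that)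
qed

text \<open>By simplicity \<open>1\<close> is a sum of terms \<open>u i * g * v i\<close>; replacing
  \<open>g\<close> by \<open>t\<close> in them extends \<open>t\<close> from the corner to a central
  element of the whole ring.\<close>

lemma corner_center:
  assumes na: no_atoms and g: "idem (g::'r)" "g \<noteq> 0" and t: "g * t = t" "t * g = t"
    and comm: "\<And>x. t * (g * x * g) = g * x * g * t"
  obtains z where "central z" "t = z * g"
proof -
  obtain n u v where uv: "(\<Sum>i<n::nat. u i * g * v i) = 1" by (rule simple_ring[OF na g(2)])
  \<comment> \<open>In this form \<open>t\<close> and \<open>g\<close> exchange places across an
    arbitrary factor, as the double sums below require.\<close>
  have c: "t * x * g = g * x * t" for x
    using comm[of x] t by (metis mult.assoc)
  define z where "z = (\<Sum>i<n. u i * t * v i)"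
  have "z * r = r * z" for r
  proof -
    have "z * r = (\<Sum>i<n. u i * t * v i * r) * (\<Sum>j<n. u j * g * v j)"
      by (simp add: uv z_def sum_distrib_right)
    also have "\<dots> = (\<Sum>i<n. \<Sum>j<n. u i * t * v i * r * (u j * g * v j))" by (rule sum_product)
    also have "\<dots> = (\<Sum>i<n. \<Sum>j<n. (u i * g * v i) * (r * (u j * t * v j)))"
    proof (intro sum.cong refl)
      fix i j
      have "u i * t * v i * r * (u j * g * v j) = u i * (t * (v i * r * u j) * g) * v j" by (simp add: mult.assoc)
      also have "\<dots> = u i * (g * (v i * r * u j) * t) * v j" by (simp only: c)
      finally show "u i * t * v i * r * (u j * g * v j) = (u i * g * v i) * (r * (u j * t * v j))"
        by (simp add: mult.assoc)
    qed
    also have "\<dots> = (\<Sum>i<n. u i * g * v i) * (\<Sum>j<n. r * (u j * t * v j))" by (rule sum_product[symmetric])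
    finally show ?thesis by (simp add: uv z_def sum_distrib_left)
  qed
  then have z: "central z" by (simp add: central_def)
  have "z * g = g * z" using z by (simp add: central_def)
  also have "\<dots> = (\<Sum>i<n. t * (u i * g * v i))"
    unfolding z_def sum_distrib_left
  proof (rule sum.cong[OF refl])
    fix i show "g * (u i * t * v i) = t * (u i * g * v i)" using c[of "u i"] by (metis mult.assoc)
  qed
  also have "\<dots> = t" unfolding sum_distrib_left[symmetric] uv by simp
  finally show thesis using that z by simp
qed

text \<open>
  Let \<open>v\<close> map one half \<open>g1\<close> of \<open>g\<close> to the other. Maximality of \<open>m\<close>, applied to \<open>x (g1 + v u)\<close> for
  all \<open>u\<close> in \<open>g1 R g1\<close>, forces the coefficients of \<open>c ^ m x g1\<close> into the center of that corner.
\<close>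

lemma central_coefficients:
  assumes na: no_atoms and top: "top_order c e m" and ex: "e * x = (x::'r)" and dual0: "dual c m x g y0"
  obtains x1 g1 y1 \<mu> where "e * x1 = x1" "dual c m x1 g1 y1" "\<And>j. j < m \<Longrightarrow> central (\<mu> j)"
    "c ^ m * x1 = (\<Sum>j<m. \<mu> j * (c ^ j * x1))"
proof -
  define y where "y j = g * y0 j" for j
  have dual: "dual c m x g y" unfolding y_def by (rule dual_normalize[OF dual0])
  have g: "idem g" "g \<noteq> 0" and xg: "x * g = x"
    and yx: "\<And>i j. i < m \<Longrightarrow> j < m \<Longrightarrow> y j * (c ^ i * x) = (if i = j then g else 0)"
    using dual by (simp_all add: dual_def)
  have gy: "g * y j = y j" for j using g by (simp add: y_def idem_def flip: mult.assoc)
  define r where "r j = y j * (c ^ m * x)" for j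
  have gr: "g * r j = r j" for j by (simp add: r_def gy flip: mult.assoc)
  have cx: "c ^ m * x = (\<Sum>j<m. c ^ j * x * r j)"
    using top ex dual unfolding top_order_def r_def by blast
  obtain g1 g2 where h: "idem g1" "idem g2" "g1 + g2 = g" "g1 * g2 = 0" "g2 * g1 = 0" "g1 \<preceq> g2" "g2 \<preceq> g1"
    using halving[OF na g(1)] by metis
  have g11: "g1 * g1 = g1" and g22: "g2 * g2 = g2" using h by (auto simp: idem_def)
  have g1g: "g1 * g = g1" "g * g1 = g1" "g2 * g = g2" "g * g2 = g2"
    unfolding h(3)[symmetric] by (simp_all add: distrib_left distrib_right h(4,5) g11 g22)
  have g10: "g1 \<noteq> 0" using h g by auto
  obtain v' v where v: "v' * v = g1" "g1 * v' = v'" "v' * g2 = v'" "g2 * v = v" "v * g1 = v"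
    using subord_idemE[OF h(6,1,2)] .
  have vv: "g1 * v = 0" "v' * g1 = 0" "v' * g = v'" "g * v = v"
    using v h(4,5) g1g by (metis mult.assoc mult_zero_left mult_zero_right)+
  \<comment> \<open>\<open>top_order\<close> applied to \<open>x * q\<close> says that every such
    \<open>q\<close> is an eigenvector of each \<open>r i\<close>, with eigenvalue
    \<open>b * (r i * q)\<close> in the corner of \<open>g1\<close>.\<close>
  have key: "r i * q = q * (b * (r i * q))"
    if q: "g * q = q" "q * g1 = q" and b: "b * g = b" "b * q = g1" "g1 * b = b" and i: "i < m" for b q i
  proof -
    have "dual c m (x * q) g1 (\<lambda>j. b * y j)"
      unfolding dual_def
    proof (intro conjI allI impI)
      show "x * q * g1 = x * q" by (simp add: mult.assoc q)
      fix i j assume "i < m" "j < m"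
      have "b * y j * (c ^ i * (x * q)) = b * (y j * (c ^ i * x)) * q" by (simp add: mult.assoc)
      then show "b * y j * (c ^ i * (x * q)) = (if i = j then g1 else 0)"
        using yx[OF \<open>i < m\<close> \<open>j < m\<close>] b by simp
    qed (use h g10 in auto)
    moreover have "e * (x * q) = x * q" by (simp add: ex flip: mult.assoc)
    ultimately have "c ^ m * (x * q) = (\<Sum>j<m. c ^ j * (x * q) * (b * y j * (c ^ m * (x * q))))"
      using top unfolding top_order_def by blast
    moreover have "c ^ m * (x * q) = (\<Sum>j<m. c ^ j * x * (r j * q))"
      unfolding mult.assoc[of "c ^ m" x q, symmetric] cx sum_distrib_right by (simp add: mult.assoc)
    moreover have "c ^ j * (x * q) * (b * y j * (c ^ m * (x * q))) = c ^ j * x * (q * (b * (r j * q)))" for j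
      by (simp add: r_def mult.assoc)
    ultimately have "(\<Sum>j<m. c ^ j * x * (r j * q)) = (\<Sum>j<m. c ^ j * x * (q * (b * (r j * q))))" by simp
    then have "y i * (\<Sum>j<m. c ^ j * x * (r j * q)) = y i * (\<Sum>j<m. c ^ j * x * (q * (b * (r j * q))))" by simp
    then have "g * (r i * q) = g * (q * (b * (r i * q)))" using dual_sum[OF dual i] by simp
    moreover have "g * (r i * q) = r i * q" by (metis gr mult.assoc)
    moreover have "g * (q * (b * (r i * q))) = q * (b * (r i * q))" by (metis q(1) mult.assoc)
    ultimately show ?thesis by simp
  qed
  define t where "t i = g1 * r i * g1" for i
  have K0: "r i * g1 = t i" if "i < m" for i
    using key[of g1 g1 i] that g11 g1g by (simp add: t_def flip: mult.assoc)
  have K2: "g1 * (r i * v) = 0" if "i < m" for i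
  proof -
    have "r i * v = v * (v' * (r i * v))" by (rule key) (use v vv that in auto)
    then have "g1 * (r i * v) = g1 * v * (v' * (r i * v))" by (metis mult.assoc)
    then show ?thesis by (simp add: vv)
  qed
  have K1: "v' * (r i * v) * u = u * t i" if i: "i < m" and u: "g1 * u = u" "u * g1 = u" for i u
  proof -
    \<comment> \<open>\<open>g1\<close> and \<open>v'\<close> read off the two components
      \<open>g1\<close> and \<open>u\<close> of \<open>q\<close>. Comparing the components of the
      eigenvector equation relates \<open>t i\<close> to its counterpart on the other half.\<close>
    define q where "q = g1 + v * u"
    have q: "r i * q = q * (g1 * (r i * q))"
    proof (rule key[OF _ _ _ _ _ i])
      show "g * q = q" by (simp add: q_def distrib_left g1g vv flip: mult.assoc)
      show "q * g1 = q" by (simp add: q_def distrib_right mult.assoc u g11)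
      show "g1 * q = g1" by (simp add: q_def distrib_left g11 vv flip: mult.assoc)
    qed (use g1g g11 in auto)
    have v'q: "v' * q = u" by (simp add: q_def distrib_left vv v(1) u flip: mult.assoc)
    have riq: "r i * q = t i + r i * v * u" by (simp add: q_def distrib_left K0[OF i] mult.assoc)
    have "v' * (r i * q) = u * (g1 * (r i * q))" using q v'q by (metis mult.assoc)
    moreover have "v' * (r i * q) = v' * (r i * v) * u"
      using vv by (simp add: riq distrib_left t_def flip: mult.assoc)
    moreover have "g1 * (r i * q) = t i"
      using K2[OF i] by (simp add: riq distrib_left t_def g11 flip: mult.assoc)
    ultimately show ?thesis by simp
  qed
  have t1: "g1 * t i = t i" "t i * g1 = t i" for i
    by (simp_all add: t_def g11 mult.assoc) (simp add: g11 flip: mult.assoc)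
  have tu: "t i * u = u * t i" if i: "i < m" and u: "g1 * u = u" "u * g1 = u" for i u
  proof -
    have "v' * (r i * v) * g1 = g1 * t i" by (rule K1[OF i g11 g11])
    then have "v' * (r i * v) = t i" using v(5) t1 by (simp add: mult.assoc)
    then show ?thesis using K1[OF i u] by simp
  qed
  have "\<exists>z. central z \<and> t i = z * g1" if i: "i < m" for i
  proof -
    have "t i * (g1 * x * g1) = g1 * x * g1 * t i" for x
      by (rule tu[OF i]) (simp_all add: g11 mult.assoc, simp add: g11 flip: mult.assoc)
    then show ?thesis using corner_center[OF na h(1) g10 t1] by metis
  qed
  then obtain \<mu> where \<mu>: "\<And>i. i < m \<Longrightarrow> central (\<mu> i) \<and> t i = \<mu> i * g1" by metis
  show thesis
  proof (rule that[of "x * g1" g1 "\<lambda>j. g1 * y j" \<mu>])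
    show "e * (x * g1) = x * g1" by (simp add: ex flip: mult.assoc)
    show "dual c m (x * g1) g1 (\<lambda>j. g1 * y j)"
      unfolding dual_def
    proof (intro conjI allI impI)
      show "x * g1 * g1 = x * g1" by (simp add: mult.assoc g11)
      fix i j assume "i < m" "j < m"
      have "g1 * y j * (c ^ i * (x * g1)) = g1 * (y j * (c ^ i * x)) * g1" by (simp add: mult.assoc)
      then show "g1 * y j * (c ^ i * (x * g1)) = (if i = j then g1 else 0)"
        using yx[OF \<open>i < m\<close> \<open>j < m\<close>] by (simp add: g1g g11)
    qed (use h g10 in auto)
    have "c ^ m * (x * g1) = (\<Sum>j<m. c ^ j * x * (r j * g1))"
      unfolding mult.assoc[symmetric] cx sum_distrib_right by (simp add: mult.assoc)
    also have "\<dots> = (\<Sum>j<m. \<mu> j * (c ^ j * (x * g1)))"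
    proof (rule sum.cong[OF refl])
      fix j assume "j \<in> {..<m}"
      then have j: "j < m" by simp
      have "c ^ j * x * (r j * g1) = c ^ j * x * (\<mu> j * g1)" using K0[OF j] \<mu>[OF j] by simp
      also have "\<dots> = \<mu> j * (c ^ j * x * g1)" using \<mu>[OF j] by (simp add: central_left_commute)
      finally show "c ^ j * x * (r j * g1) = \<mu> j * (c ^ j * (x * g1))" by (simp add: mult.assoc)
    qed
    finally show "c ^ m * (x * g1) = (\<Sum>j<m. \<mu> j * (c ^ j * (x * g1)))" .
  qed (use \<mu> in blast)
qed

section \<open>Rank estimates and the annihilating polynomial\<close>

lemma sum_ideal_generator:
  fixes n :: nat
  assumes "\<And>x::'r. x \<in> pri c \<longleftrightarrow> (\<exists>s. x = (\<Sum>i<n. b i * s i))" and i: "i < n"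
  shows "b i \<in> pri c"
proof -
  have "b i = (\<Sum>j<n. b j * (if j = i then 1 else 0))"
    using i by (simp add: sum.delta if_distrib cong: if_cong)
  then show ?thesis unfolding assms(1) by (rule exI[of _ "\<lambda>j. if j = i then 1 else 0"])
qed

text \<open>Subadditivity is derived from additivity: \<open>a + b\<close> lies in the ideal of
  \<open>e + g\<close>, where \<open>e R = a R\<close> and \<open>g\<close> is orthogonal to
  \<open>e\<close> and subordinate to \<open>b\<close>.\<close>

lemma rankfun_add:
  assumes "rankfun \<rho>"
  shows "\<rho> (a + b) \<le> \<rho> a + \<rho> (b::'r)"
proof -
  note mono = rankfun_subord[OF assms]
  obtain e where e: "idem e" "pri e = pri a" by (rule pri_idem_exists)
  obtain g where g: "idem g" "e * g = 0" "g * e = 0" "pri (e + g) = isum (pri e) (pri b)" "g \<preceq> b"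
    using isum_idem[OF e(1)] by metis
  have "a + b \<in> pri (e + g)" unfolding g(4) e(2) isum_iff using pri_self by blast
  then have "\<rho> (a + b) \<le> \<rho> (e + g)" by (intro mono subord_pri)
  also have "\<dots> = \<rho> e + \<rho> g" using assms e(1) g unfolding rankfun_def by blast
  also have "\<rho> e \<le> \<rho> a" using e by (intro mono) (metis pri_self subord_pri)
  also have "\<rho> g \<le> \<rho> b" by (rule mono[OF g(5)])
  finally show ?thesis by simp
qed

lemma rankfun_sum:
  assumes "rankfun \<rho>" "\<And>i. i < n \<Longrightarrow> \<rho> (f i :: 'r) \<le> B"
  shows "\<rho> (\<Sum>i<n. f i) \<le> real n * B"
  using assms(2)
proof (induction n)
  case 0
  then show ?case using rankfun_zero[OF assms(1)] by simp
next
  case (Suc n)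
  have "\<rho> (\<Sum>i<n. f i) \<le> real n * B" using Suc by simp
  moreover have "\<rho> (f n) \<le> B" using Suc.prems by simp
  moreover have "\<rho> ((\<Sum>i<n. f i) + f n) \<le> \<rho> (\<Sum>i<n. f i) + \<rho> (f n)" by (rule rankfun_add[OF assms(1)])
  ultimately show ?case by (simp add: algebra_simps)
qed

lemma rankfun_tree:
  assumes na: no_atoms and \<rho>: "rankfun \<rho>" and g: "idem (g::'r)"
  shows "\<rho> (tree g n k) = \<rho> g / 2 ^ n"
proof (induction n arbitrary: k)
  case (Suc n)
  let ?x = "tree g n (k div 2)"
  have x: "idem ?x" by (rule tree_idem[OF na g])
  have "halves ?x (half True ?x) (half False ?x)" by (rule half_halves[OF na x])
  then have h: "idem (half True ?x)" "idem (half False ?x)" "half True ?x + half False ?x = ?x"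
    "half True ?x * half False ?x = 0" "half False ?x * half True ?x = 0"
    "half True ?x \<preceq> half False ?x" "half False ?x \<preceq> half True ?x" unfolding halves_def by auto
  have "\<rho> (half True ?x + half False ?x) = \<rho> (half True ?x) + \<rho> (half False ?x)"
    using \<rho> h(1,2,4,5) unfolding rankfun_def by blast
  moreover have "\<rho> (half True ?x) = \<rho> (half False ?x)"
    by (rule antisym) (rule rankfun_subord[OF \<rho>], rule h)+
  ultimately have "\<rho> (half b ?x) = \<rho> ?x / 2" for b using h(3) by (cases b) simp_all
  then show ?case using Suc by simp
qed simp

lemma small_idem:
  assumes na: no_atoms and \<rho>: "rankfun \<rho>" and g: "idem (g::'r)" "g \<noteq> 0" and \<epsilon>: "0 < \<epsilon>"
  obtains k where "idem k" "k \<noteq> 0" "g * k = k" "k * g = k" "\<rho> k < \<epsilon>"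
proof -
  obtain n where "(1/2) ^ n < \<epsilon>" using real_arch_pow_inv[OF \<epsilon>, of "1/2"] by auto
  then have n: "1 / 2 ^ n < \<epsilon>" by (simp add: power_divide)
  let ?k = "tree g n 0"
  have \<rho>k: "\<rho> ?k = \<rho> g / 2 ^ n" by (rule rankfun_tree[OF na \<rho> g(1)])
  have g01: "0 < \<rho> g" "\<rho> g \<le> 1" using \<rho> g(2) unfolding rankfun_def by auto
  have "\<rho> g / 2 ^ n \<le> 1 / 2 ^ n" using g01 by (simp add: divide_right_mono)
  then have "\<rho> ?k < \<epsilon>" using \<rho>k n by linarith
  moreover have "?k \<noteq> 0" using \<rho>k g01 rankfun_zero[OF \<rho>] by auto
  ultimately show thesis using that tree_idem[OF na g(1)] tree_below[OF na g(1)] by blast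
qed

text \<open>
  If the relation failed on \<open>e\<close>, the polynomial \<open>F\<close> would be injective on a nonzero \<open>k R\<close> of
  arbitrarily small rank. For some nonzero \<open>a\<close> in \<open>k R\<close>, there is a copy \<open>x b\<close> of \<open>a\<close> that is
  independent of everything \<open>c\<close> generates from \<open>e k\<close>; maximality of \<open>m\<close>, applied to \<open>x b + e a\<close>,
  yields \<open>F e a = 0\<close>.
\<close>

lemma annihilating_polynomial:
  assumes na: no_atoms and \<rho>: "rankfun (\<rho> :: 'r \<Rightarrow> real)"
    and ei: "idem (e::'r)" and alg: "algebraic_on c e d"
    and top: "top_order c e m" and ex: "e * x = x" and dual0: "dual c m x g y0"
    and \<mu>: "\<And>j. j < m \<Longrightarrow> central (\<mu> j)" and cx: "c ^ m * x = (\<Sum>j<m. \<mu> j * (c ^ j * x))"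
  shows "c ^ m * e = (\<Sum>j<m. \<mu> j * (c ^ j * e))"
proof (rule ccontr)
  define F where "F = c ^ m - (\<Sum>j<m. \<mu> j * c ^ j)"
  have F: "F * z = c ^ m * z - (\<Sum>j<m. \<mu> j * (c ^ j * z))" for z
    by (simp add: F_def left_diff_distrib sum_distrib_right mult.assoc)
  assume "c ^ m * e \<noteq> (\<Sum>j<m. \<mu> j * (c ^ j * e))"
  then have Fe: "F * e \<noteq> 0" by (simp add: F)
  define y where "y j = g * y0 j" for j
  have dual: "dual c m x g y" unfolding y_def by (rule dual_normalize[OF dual0])
  have g: "idem g" "g \<noteq> 0" and xg: "x * g = x"
    and yx: "\<And>i j. i < m \<Longrightarrow> j < m \<Longrightarrow> y j * (c ^ i * x) = (if i = j then g else 0)"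
    using dual by (simp_all add: dual_def)
  have gg: "g * g = g" using g by (simp add: idem_def)
  have gy: "g * y j = y j" for j by (simp add: y_def gg flip: mult.assoc)
  define t where "t = F * e"
  obtain t' where t': "t * t' * t = t" using regular by blast
  \<comment> \<open>Left multiplication by \<open>t = F * e\<close> is injective on
    \<open>k0 R\<close>, so the final contradiction is a nonzero element of \<open>k R\<close>
    killed by \<open>t\<close>.\<close>
  define k0 where "k0 = t' * t"
  have k0: "idem k0" "k0 \<noteq> 0"
  proof -
    show "idem k0" unfolding idem_def k0_def by (metis t' mult.assoc)
    show "k0 \<noteq> 0" using t' Fe by (auto simp: k0_def t_def mult.assoc)
  qed
  have \<rho>g: "0 < \<rho> g" using \<rho> g unfolding rankfun_def by blast
  \<comment> \<open>The ideal generated by \<open>c\<close> from \<open>e * k\<close> has rank at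
    most \<open>d * \<rho> k\<close>, and its \<open>m\<close> coordinates together at most
    \<open>m * d * \<rho> k\<close>, which has to stay below \<open>\<rho> g\<close>. The summand
    \<open>1\<close> keeps the denominator positive.\<close>
  obtain k where k: "idem k" "k \<noteq> 0" "k0 * k = k" "\<rho> k < \<rho> g / (real m * real d + 1)"
  proof -
    have "0 < \<rho> g / (real m * real d + 1)" using \<rho>g by (intro divide_pos_pos add_nonneg_pos) auto
    from small_idem[OF na \<rho> k0 this] show thesis using that by metis
  qed
  have small: "real m * (real d * \<rho> k) < \<rho> g"
  proof -
    have pos: "0 < real m * real d + 1" by (simp add: add_nonneg_pos)
    have "\<rho> k * (real m * real d + 1) < \<rho> g" using k(4) pos by (simp add: pos_less_divide_eq)
    moreover have "0 \<le> \<rho> k" using \<rho> by (simp add: rankfun_def)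
    ultimately show ?thesis by (simp add: algebra_simps)
  qed
  obtain \<nu> where \<nu>: "\<forall>j<d. central (\<nu> j)" "c ^ d * e = (\<Sum>j<d. \<nu> j * (c ^ j * e))"
    using alg unfolding algebraic_on_def by blast
  obtain w where w: "\<And>z. z \<in> pri w \<longleftrightarrow> (\<exists>s. z = (\<Sum>i<d. (c ^ i * e * k) * s i))"
    using sum_ideal[where n = d and b = "\<lambda>i. c ^ i * e * k"] by blast
  have gen: "c ^ i * e * k \<in> pri w" if "i < d" for i by (rule sum_ideal_generator[OF w that])
  \<comment> \<open>The relation of degree \<open>d\<close> closes the span of the first
    \<open>d\<close> powers under \<open>c\<close>, so one rank bound covers all powers.\<close>
  have gend: "c ^ d * e * k \<in> pri w"
  proof -
    have "c ^ d * e * k = (\<Sum>j<d. (c ^ j * e * k) * \<nu> j)"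
      unfolding \<nu>(2) sum_distrib_right by (rule sum.cong) (use \<nu>(1) in \<open>auto simp: central_def mult.assoc\<close>)
    then show ?thesis using w by blast
  qed
  have inv: "c * z \<in> pri w" if z: "z \<in> pri w" for z
  proof -
    obtain s where s: "z = (\<Sum>i<d. (c ^ i * e * k) * s i)" using z w by blast
    have "c * (c ^ i * e * k * s i) \<in> pri w" if "i < d" for i
    proof -
      have "c ^ Suc i * e * k \<in> pri w" using gen[of "Suc i"] gend that by (cases "Suc i = d") (auto simp del: power_Suc)
      then show ?thesis by (metis mult.assoc power_Suc pri_mult_right)
    qed
    then show ?thesis unfolding s sum_distrib_left by (intro pri_sum) simp
  qed
  have ek: "c ^ i * e * k \<in> pri w" for i
  proof (induction i)
    case 0
    then show ?case using gen[of 0] gend by (cases "d = 0") auto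
  next
    case (Suc i)
    then show ?case using inv by (simp add: mult.assoc)
  qed
  have \<rho>w: "\<rho> w \<le> real d * \<rho> k"
  proof -
    obtain s where s: "w = (\<Sum>i<d. (c ^ i * e * k) * s i)" using w pri_self by blast
    show ?thesis unfolding s
    proof (rule rankfun_sum[OF \<rho>])
      fix i
      show "\<rho> (c ^ i * e * k * s i) \<le> \<rho> k"
        by (rule rankfun_subord[OF \<rho>], rule subordI[of _ "c ^ i * e" _ "s i"]) simp
    qed
  qed
  obtain \<xi> where \<xi>: "\<And>z. z \<in> pri \<xi> \<longleftrightarrow> (\<exists>s. z = (\<Sum>i<m. (c ^ i * x) * s i))"
    using sum_ideal[where n = m and b = "\<lambda>i. c ^ i * x"] by blast
  obtain u where u: "pri u = pri w \<inter> pri \<xi>" by (rule Int_principal)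
  have "u \<in> pri w" using u pri_self by blast
  then have \<rho>u: "\<rho> u \<le> \<rho> w" by (intro rankfun_subord[OF \<rho>] subord_pri)
  \<comment> \<open>\<open>\<gamma> R\<close> contains the coordinates of those elements of
    \<open>w R\<close> that lie in the span of the \<open>c ^ i * x\<close>. A complement
    \<open>\<delta> R\<close> in \<open>g R\<close> thus consists of directions whose strings avoid
    \<open>w R\<close>.\<close>
  obtain \<gamma> where \<gamma>: "\<And>z. z \<in> pri \<gamma> \<longleftrightarrow> (\<exists>s. z = (\<Sum>j<m. (y j * u) * s j))"
    using sum_ideal[where n = m and b = "\<lambda>j. y j * u"] by blast
  have yu: "y j * u \<in> pri \<gamma>" if "j < m" for j by (rule sum_ideal_generator[OF \<gamma> that])
  have \<gamma>g: "pri \<gamma> \<subseteq> pri g"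
  proof
    fix z assume "z \<in> pri \<gamma>"
    then obtain s where s: "z = (\<Sum>j<m. (y j * u) * s j)" using \<gamma> by blast
    have "g * z = z" unfolding s sum_distrib_left by (rule sum.cong) (simp_all add: gy flip: mult.assoc)
    then show "z \<in> pri g" by (metis pri_mult)
  qed
  have \<rho>\<gamma>: "\<rho> \<gamma> < \<rho> g"
  proof -
    obtain s where s: "\<gamma> = (\<Sum>j<m. (y j * u) * s j)" using \<gamma> pri_self by blast
    have "\<rho> \<gamma> \<le> real m * \<rho> u" unfolding s
    proof (rule rankfun_sum[OF \<rho>])
      fix j
      show "\<rho> (y j * u * s j) \<le> \<rho> u"
        by (rule rankfun_subord[OF \<rho>], rule subordI[of _ "y j" _ "s j"]) simp
    qed
    also have "\<dots> \<le> real m * (real d * \<rho> k)" using \<rho>u \<rho>w by (intro mult_left_mono) auto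
    finally show ?thesis using small by simp
  qed
  obtain \<delta> where \<delta>: "pri \<delta> \<subseteq> pri g" "pri \<gamma> \<inter> pri \<delta> = {0}" "isum (pri \<gamma>) (pri \<delta>) = pri g"
    using relative_complement[OF \<gamma>g] by metis
  have \<delta>0: "pri \<delta> \<noteq> {0}"
  proof
    assume "pri \<delta> = {0}"
    then have "pri g = pri \<gamma>" using \<delta>(3) by (auto simp: isum_def)
    then have "\<rho> g \<le> \<rho> \<gamma>" by (intro rankfun_subord[OF \<rho>]) (metis pri_self subord_pri)
    then show False using \<rho>\<gamma> by simp
  qed
  have kn0: "pri k \<noteq> {0}" using k(2) pri_eq_0 by metis
  have "\<exists>a b. a \<in> pri k \<and> b \<in> pri \<delta> \<and> a \<noteq> 0 \<and> (\<forall>s. a * s = 0 \<longleftrightarrow> b * s = 0)"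
    by (rule common_part[OF kn0 \<delta>0]) (intro exI conjI allI)
  then obtain a b where ab: "a \<in> pri k" "b \<in> pri \<delta>" "a \<noteq> 0" "\<And>s. a * s = 0 \<longleftrightarrow> b * s = 0" by metis
  obtain a' where a': "a * a' * a = a" using regular by blast
  define \<kappa> where "\<kappa> = a' * a"
  have a\<kappa>: "a * \<kappa> = a" by (simp add: \<kappa>_def a' flip: mult.assoc)
  have \<kappa>: "idem \<kappa>" "\<kappa> \<noteq> 0"
  proof -
    show "idem \<kappa>" unfolding idem_def \<kappa>_def by (metis a' mult.assoc)
    show "\<kappa> \<noteq> 0" using a\<kappa> ab(3) by auto
  qed
  have "a * (1 - \<kappa>) = 0" by (simp add: right_diff_distrib a\<kappa>)
  then have "b * (1 - \<kappa>) = 0" using ab(4) by blast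
  then have b\<kappa>: "b * \<kappa> = b" by (simp add: right_diff_distrib)
  have ker: "\<kappa> * s = 0" if "b * s = 0" for s using ab(4)[of s] that by (simp add: \<kappa>_def mult.assoc)
  obtain \<beta> where \<beta>: "\<kappa> = \<beta> * b" by (rule left_factor[of b \<kappa>]) (use ker in auto)
  have gb: "g * b = b" using ab(2) \<delta>(1) g(1) pri_idem by (metis subsetD)
  have ka: "k * a = a" using ab(1) k(1) pri_idem by metis
  obtain \<xi>' where \<xi>': "\<And>z. z \<in> pri \<xi>' \<longleftrightarrow> (\<exists>s. z = (\<Sum>i<m. (c ^ i * x * b) * s i))"
    using sum_ideal[where n = m and b = "\<lambda>i. c ^ i * x * b"] by blast
  have gen': "c ^ i * x * b \<in> pri \<xi>'" if "i < m" for i by (rule sum_ideal_generator[OF \<xi>' that])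
  have "z = 0" if z: "z \<in> pri \<xi>'" "z \<in> pri w" for z
  proof -
    obtain s where s: "z = (\<Sum>i<m. (c ^ i * x * b) * s i)" using z \<xi>' by blast
    then have s': "z = (\<Sum>i<m. c ^ i * x * (b * s i))" by (simp add: mult.assoc)
    then have "\<exists>s. z = (\<Sum>i<m. c ^ i * x * s i)" by (rule exI[of _ "\<lambda>i. b * s i"])
    then have "z \<in> pri \<xi>" by (simp only: \<xi>)
    then have "z \<in> pri u" using u z by blast
    then obtain q where q: "z = u * q" by (auto simp: pri_iff)
    have "b * s j = 0" if j: "j < m" for j
    proof -
      have "y j * z = g * (b * s j)" unfolding s' by (rule dual_sum[OF dual j])
      then have "b * s j = y j * u * q" using gb q by (simp flip: mult.assoc)
      then have "b * s j \<in> pri \<gamma>" using yu[OF j] pri_mult_right by metis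
      moreover have "b * s j \<in> pri \<delta>" using ab(2) by (rule pri_mult_right)
      ultimately show ?thesis using \<delta>(2) by (metis IntI singletonD)
    qed
    then show "z = 0" by (simp add: s')
  qed
  then have "pri \<xi>' \<inter> pri w = {0}" by auto
  then obtain p where p: "\<And>z. z \<in> pri \<xi>' \<Longrightarrow> p * z = z" "\<And>z. z \<in> pri w \<Longrightarrow> p * z = 0"
    by (rule projection) blast
  \<comment> \<open>\<open>p\<close> sees only the component \<open>x * b\<close>, so
    \<open>v\<close> has the same coefficients as \<open>x\<close>. Then \<open>F * v = 0\<close>
    and \<open>F * (x * b) = 0\<close> isolate \<open>F * e * a\<close>.\<close>
  define v where "v = x * b + e * a"
  have pv: "p * (c ^ i * v) = p * (c ^ i * x * b)" for i
  proof -
    have "c ^ i * e * a \<in> pri w" using pri_mult_right[OF ek, of i a] ka by (simp add: mult.assoc)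
    then have "p * (c ^ i * e * a) = 0" by (rule p(2))
    then show ?thesis by (simp add: v_def distrib_left mult.assoc)
  qed
  have dual_v: "dual c m v \<kappa> (\<lambda>j. \<beta> * (y j * p))"
    unfolding dual_def
  proof (intro conjI allI impI)
    show "v * \<kappa> = v" by (simp add: v_def distrib_right mult.assoc a\<kappa> b\<kappa>)
    fix i j assume i: "i < m" and j: "j < m"
    have "\<beta> * (y j * p) * (c ^ i * v) = \<beta> * (y j * (p * (c ^ i * v)))" by (simp add: mult.assoc)
    also have "p * (c ^ i * v) = c ^ i * x * b" using pv p(1)[OF gen'[OF i]] by simp
    also have "\<beta> * (y j * (c ^ i * x * b)) = \<beta> * (y j * (c ^ i * x)) * b" by (simp add: mult.assoc)
    finally show "\<beta> * (y j * p) * (c ^ i * v) = (if i = j then \<kappa> else 0)"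
      using yx[OF i j] gb by (simp add: \<beta> mult.assoc)
  qed (use \<kappa> in auto)
  have ev: "e * v = v" using ei by (simp add: v_def distrib_left ex idem_def flip: mult.assoc)
  have cxb: "c ^ m * x * b = (\<Sum>i<m. \<mu> i * (c ^ i * x * b))"
    unfolding cx sum_distrib_right by (simp add: mult.assoc)
  have coeff: "\<beta> * (y j * p) * (c ^ m * v) = \<mu> j * \<kappa>" if j: "j < m" for j
  proof -
    have "c ^ m * x * b = (\<Sum>i<m. c ^ i * x * (\<mu> i * b))"
      unfolding cxb by (rule sum.cong) (simp_all only: lessThan_iff central_left_commute[OF \<mu>])
    moreover have "c ^ m * x * b \<in> pri \<xi>'"
      unfolding cxb by (rule pri_sum) (metis central_def gen' lessThan_iff \<mu> pri_mult_right)
    ultimately have "p * (c ^ m * v) = (\<Sum>i<m. c ^ i * x * (\<mu> i * b))" using pv p(1) by simp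
    then have "y j * (p * (c ^ m * v)) = g * (\<mu> j * b)" using dual_sum[OF dual j] by simp
    then have "\<beta> * (y j * p) * (c ^ m * v) = \<beta> * (g * (\<mu> j * b))" by (simp add: mult.assoc)
    also have "\<dots> = \<mu> j * \<kappa>"
      unfolding central_left_commute[OF \<mu>[OF j]] by (simp only: gb \<beta>)
    finally show ?thesis .
  qed
  have "c ^ m * v = (\<Sum>j<m. c ^ j * v * (\<beta> * (y j * p) * (c ^ m * v)))"
    using top ev dual_v unfolding top_order_def by blast
  also have "\<dots> = (\<Sum>j<m. \<mu> j * (c ^ j * v))"
  proof (rule sum.cong[OF refl])
    fix j assume "j \<in> {..<m}"
    then have j: "j < m" by simp
    have "v * \<kappa> = v" using dual_v by (simp add: dual_def)
    have "c ^ j * v * (\<beta> * (y j * p) * (c ^ m * v)) = c ^ j * v * (\<mu> j * \<kappa>)" by (simp only: coeff[OF j])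
    also have "\<dots> = \<mu> j * (c ^ j * (v * \<kappa>))"
      unfolding central_left_commute[OF \<mu>[OF j]] by (simp only: mult.assoc)
    finally show "c ^ j * v * (\<beta> * (y j * p) * (c ^ m * v)) = \<mu> j * (c ^ j * v)"
      by (simp only: \<open>v * \<kappa> = v\<close>)
  qed
  finally have "F * v = 0" by (simp add: F)
  moreover have "F * (x * b) = 0" using cxb by (simp add: F mult.assoc)
  ultimately have "t * a = 0" by (simp add: v_def t_def distrib_left mult.assoc)
  then have "k0 * a = 0" by (simp add: k0_def mult.assoc)
  moreover have "k0 * a = a" using k(3) ka by (metis mult.assoc)
  ultimately show False using ab(3) by simp
qed

end

section \<open>Embedding a corner into the commutant\<close>

lemma inverse_power_cancel:
  assumes "c * a = (1::'r::ring_1)" "j \<le> i"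
  shows "c ^ i * a ^ j = c ^ (i - j)"
  using assms(2)
proof (induction j)
  case (Suc j)
  then have "c ^ i * a ^ j = c ^ (i - Suc j) * c"
    by (metis Suc_diff_Suc Suc_le_lessD Suc_leD power_Suc2)
  then have "c ^ i * (a ^ j * a) = c ^ (i - Suc j) * (c * a)" by (simp flip: mult.assoc)
  then show ?case using assms(1) by (simp add: power_commutes)
qed simp

context continuous_regular_ring
begin

text \<open>The supremum projects onto the join \<open>S R\<close> of the ranges along an ideal
  \<open>i R\<close> inside all kernels. Lower continuity shows that the two span the unit, upper
  continuity that they are independent. The last two properties let annihilators from either side
  pass to the supremum.\<close>

lemma chain_idem_join:
  assumes C: "\<And>f. f \<in> \<C> \<Longrightarrow> idem (f::'r)"
    and tot: "\<And>f f'. f \<in> \<C> \<Longrightarrow> f' \<in> \<C> \<Longrightarrow> f * f' = f \<and> f' * f = f \<or> f * f' = f' \<and> f' * f = f'"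
  obtains s where "idem s" "\<And>f. f \<in> \<C> \<Longrightarrow> f * s = f \<and> s * f = f"
    "\<And>t. (\<And>f. f \<in> \<C> \<Longrightarrow> t * f = 0) \<Longrightarrow> t * s = 0"
    "\<And>x. (\<And>f. f \<in> \<C> \<Longrightarrow> f * x = 0) \<Longrightarrow> s * x = 0"
proof (cases "\<C> = {}")
  case True
  then show thesis using that[of 0] by simp
next
  case False
  have ff: "f * f = f" if "f \<in> \<C>" for f using C that by (simp add: idem_def)
  have ch: "\<forall>A\<in>pri ` \<C>. \<forall>B\<in>pri ` \<C>. A \<subseteq> B \<or> B \<subseteq> A"
  proof (intro ballI)
    fix A B assume "A \<in> pri ` \<C>" "B \<in> pri ` \<C>"
    then obtain f f' where "f \<in> \<C>" "f' \<in> \<C>" "A = pri f" "B = pri f'" by blast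
    then show "A \<subseteq> B \<or> B \<subseteq> A" using tot[of f f'] by (metis pri_mult pri_subset_iff)
  qed
  have ch': "\<forall>A\<in>(\<lambda>f. pri (1 - f)) ` \<C>. \<forall>B\<in>(\<lambda>f. pri (1 - f)) ` \<C>. A \<subseteq> B \<or> B \<subseteq> A"
  proof (intro ballI)
    fix A B assume "A \<in> (\<lambda>f. pri (1 - f)) ` \<C>" "B \<in> (\<lambda>f. pri (1 - f)) ` \<C>"
    then obtain f f' where f: "f \<in> \<C>" "f' \<in> \<C>" "A = pri (1 - f)" "B = pri (1 - f')" by blast
    have "f * f' = f \<Longrightarrow> (1 - f) * (1 - f') = 1 - f'" "f' * f = f' \<Longrightarrow> (1 - f') * (1 - f) = 1 - f"
      by (simp_all add: algebra_simps)
    then show "A \<subseteq> B \<or> B \<subseteq> A" using tot[OF f(1,2)] f(3,4) by (metis pri_mult pri_subset_iff)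
  qed
  have Cr: "pri ` \<C> \<subseteq> range pri" by blast
  obtain S where S: "is_join (pri ` \<C>) (pri S)" "\<And>A. A \<in> pri ` \<C> \<Longrightarrow> A \<subseteq> pri S"
    "\<And>t. (\<And>A. A \<in> pri ` \<C> \<Longrightarrow> A \<subseteq> pri t) \<Longrightarrow> pri S \<subseteq> pri t"
    using chain_join_exists[OF Cr] by metis
  have fS: "f \<in> pri S" if "f \<in> \<C>" for f using S(2)[of "pri f"] that pri_subset_iff by blast
  have "\<exists>I\<in>range pri. (\<forall>A\<in>(\<lambda>f. pri (1 - f)) ` \<C>. I \<subseteq> A) \<and>
      (\<forall>T\<in>range pri. pri S \<subseteq> T \<and> I \<subseteq> T \<longrightarrow> 1 \<in> T)"
  proof (rule lower_continuous[OF _ ch'])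
    show "\<forall>A\<in>(\<lambda>f. pri (1 - f)) ` \<C>. \<forall>T\<in>range pri. pri S \<subseteq> T \<and> A \<subseteq> T \<longrightarrow> 1 \<in> T"
    proof (intro ballI impI)
      fix A T assume A: "A \<in> (\<lambda>f. pri (1 - f)) ` \<C>" and T: "T \<in> range pri" "pri S \<subseteq> T \<and> A \<subseteq> T"
      then obtain f t where f: "f \<in> \<C>" "A = pri (1 - f)" "T = pri t" by blast
      then have "f \<in> pri t" "1 - f \<in> pri t" using T fS by (metis subsetD, metis pri_self subsetD)
      then have "f + (1 - f) \<in> pri t" by (rule pri_add)
      then show "1 \<in> T" using f by simp
    qed
  qed (use False in auto)
  then obtain I where I: "I \<in> range pri" "\<And>A. A \<in> (\<lambda>f. pri (1 - f)) ` \<C> \<Longrightarrow> I \<subseteq> A"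
    "\<And>T. T \<in> range pri \<Longrightarrow> pri S \<subseteq> T \<Longrightarrow> I \<subseteq> T \<Longrightarrow> 1 \<in> T" by metis
  then obtain i where i: "I = pri i" by blast
  have fI: "f * x = 0" if "f \<in> \<C>" "x \<in> pri i" for f x
  proof -
    have "x \<in> pri (1 - f)" using I(2)[of "pri (1 - f)"] that i by blast
    then obtain s where "x = (1 - f) * s" by (auto simp: pri_iff)
    then show ?thesis using ff[OF that(1)] by (simp add: right_diff_distrib flip: mult.assoc)
  qed
  have disj: "pri z \<inter> pri S = {0}" if z: "\<And>f. f \<in> \<C> \<Longrightarrow> f * z = 0" for z
  proof (rule chain_join_disjoint[OF Cr ch S(1)], intro ballI)
    fix A assume "A \<in> pri ` \<C>"
    then obtain f where f: "f \<in> \<C>" "A = pri f" by blast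
    have "x = 0" if "x \<in> pri z" "x \<in> pri f" for x
    proof -
      have "f * x = x" using that(2) C[OF f(1)] pri_idem by blast
      moreover have "f * x = 0" using that(1) z[OF f(1)] by (auto simp: pri_iff simp flip: mult.assoc)
      ultimately show ?thesis by simp
    qed
    then show "pri z \<inter> A = {0}" using f(2) by auto
  qed
  have "pri S \<inter> pri i = {0}" using disj[of i] fI[OF _ pri_self] by (simp add: Int_commute)
  then obtain p where p: "\<And>x. x \<in> pri S \<Longrightarrow> p * x = x" "\<And>x. x \<in> pri i \<Longrightarrow> p * x = 0"
    by (rule projection) blast
  obtain si where si: "pri si = isum (pri S) (pri i)" by (rule isum_principal)
  have "1 \<in> pri si"
  proof (rule I(3))
    show "pri S \<subseteq> pri si" "I \<subseteq> pri si" unfolding si i by (rule isum_upper)+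
  qed simp
  then obtain \<alpha> \<beta> where ab: "1 = \<alpha> + \<beta>" "\<alpha> \<in> pri S" "\<beta> \<in> pri i" unfolding si isum_iff by (elim bexE)
  have "p = p * (\<alpha> + \<beta>)" using ab(1) by (metis mult_1_right)
  also have "\<dots> = \<alpha>" unfolding distrib_left p(1)[OF ab(2)] p(2)[OF ab(3)] by simp
  finally have p\<alpha>: "p = \<alpha>" .
  have fp: "f * p = f" if "f \<in> \<C>" for f
  proof -
    have "f * (\<alpha> + \<beta>) = f" using ab(1) by (metis mult_1_right)
    then show ?thesis using fI[OF that ab(3)] p\<alpha> by (simp add: distrib_left)
  qed
  show thesis
  proof (rule that[of p])
    show "idem p" unfolding idem_def using p(1) ab(2) p\<alpha> by simp
    show "f * p = f \<and> p * f = f" if "f \<in> \<C>" for f using fp p(1) fS that by simp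
    show "t * p = 0" if t: "\<And>f. f \<in> \<C> \<Longrightarrow> t * f = 0" for t
    proof -
      obtain k where k: "idem k" "\<And>x. t * x = 0 \<longleftrightarrow> k * x = x" by (rule kernel_idem[of t]) blast
      have "pri S \<subseteq> pri k"
      proof (rule S(3))
        fix A assume "A \<in> pri ` \<C>"
        then obtain f where f: "f \<in> \<C>" "A = pri f" by blast
        then have "k * f = f" using t k(2) by blast
        then show "A \<subseteq> pri k" using f(2) by (metis pri_mult pri_subset_iff)
      qed
      then have "p \<in> pri k" using ab(2) p\<alpha> by blast
      then show ?thesis using k pri_idem by blast
    qed
    show "p * x = 0" if x: "\<And>f. f \<in> \<C> \<Longrightarrow> f * x = 0" for x
    proof -
      have "f * (p * x) = 0" if "f \<in> \<C>" for f using fp[OF that] x[OF that] by (simp flip: mult.assoc)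
      then have "pri (p * x) \<inter> pri S = {0}" by (rule disj)
      moreover have "p * x \<in> pri S" using ab(2) p\<alpha> pri_mult_right by blast
      ultimately show ?thesis by (metis IntI pri_self singletonD)
    qed
  qed
qed

end

text \<open>
  The elements \<open>Q n k\<close>, \<open>k < 2 ^ n\<close>, form a refining sequence of decompositions of \<open>e\<close> into
  idempotents that commute with \<open>c\<close> and have rank \<open>O(2 ^ - n)\<close>.
\<close>

definition divisible :: "('r::ring_1 \<Rightarrow> real) \<Rightarrow> 'r \<Rightarrow> 'r \<Rightarrow> bool" where
  "divisible \<rho> c e \<longleftrightarrow> (\<exists>(Q :: nat \<Rightarrow> nat \<Rightarrow> 'r) (C :: real). Q 0 0 = e \<and>
     (\<forall>n k l. k < 2 ^ n \<longrightarrow> l < 2 ^ n \<longrightarrow> Q n k * Q n l = (if k = l then Q n k else 0)) \<and>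
     (\<forall>n k. c * Q n k = Q n k * c \<and> e * Q n k = Q n k \<and> Q n k * e = Q n k \<and>
        Q n k = Q (Suc n) (2 * k) + Q (Suc n) (2 * k + 1) \<and> \<rho> (Q n k) \<le> C / 2 ^ n))"

lemma divisible_zero: "rankfun \<rho> \<Longrightarrow> divisible \<rho> c 0"
  unfolding divisible_def by (intro exI[of _ "\<lambda>_ _. 0"] exI[of _ 0]) (simp add: rankfun_zero)

locale annihilated_idem = continuous_regular_ring ty for ty :: "'r::ring_1 itself" +
  fixes a c e :: 'r and m :: nat and \<mu> :: "nat \<Rightarrow> 'r"
  assumes ac: "a * c = 1" and ca: "c * a = 1" and e_idem: "idem e" and ec: "e * c = c * e"
    and m: "0 < m" and central_\<mu>: "j < m \<Longrightarrow> central (\<mu> j)"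
    and rel: "c ^ m * e = (\<Sum>j<m. \<mu> j * (c ^ j * e))"
begin

text \<open>
  The \<open>h i\<close> are the Horner quotients of the polynomial with coefficients \<open>p k\<close>, which annihilates
  \<open>c\<close> on \<open>e\<close>. They make \<open>bez f\<close> commute with \<open>c\<close>, and for separating \<open>F\<close> the map \<open>bez\<close> is an
  embedding of the corner of \<open>F\<close> into the commutant of \<open>c\<close>.
\<close>

definition p :: "nat \<Rightarrow> 'r" where "p k = (if k < m then - \<mu> k else 1)"

definition h :: "nat \<Rightarrow> 'r" where "h i = (\<Sum>k=i..m. p k * c ^ (k - i))"

definition bez :: "'r \<Rightarrow> 'r" where "bez f = (\<Sum>i<m. c ^ i * f * (h (Suc i) * a ^ (m - 1)))"

text \<open>The condition makes the ideals \<open>c ^ i f R\<close>, \<open>i < m\<close>,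
  independent: for \<open>j < m\<close>, \<open>f * a ^ j\<close> maps \<open>c ^ j * f\<close> to
  \<open>f\<close> and kills \<open>c ^ i * f\<close> for \<open>i < j\<close>.\<close>

definition separating :: "'r \<Rightarrow> bool" where
  "separating f \<longleftrightarrow> idem f \<and> e * f = f \<and> f * e = f \<and> (\<forall>s. 0 < s \<longrightarrow> s < m \<longrightarrow> f * (a ^ s * f) = 0)"

lemma central_p: "central (p k)"
  using central_\<mu> by (simp add: p_def central_def)

lemma ec_power: "e * c ^ i = c ^ i * e"
  using ec by (metis power_commuting_commutes)

lemma ea: "e * a = a * e"
  by (metis ac ca ec mult.assoc mult_1_left mult_1_right)

lemma ea_power: "e * a ^ i = a ^ i * e"
  using ea by (metis power_commuting_commutes)

lemma commute_a: "c * x = x * c \<Longrightarrow> a * x = x * a"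
  by (metis ac ca mult.assoc mult_1_left mult_1_right)

lemma h_Suc: "i < m \<Longrightarrow> h i = p i + c * h (Suc i)"
proof -
  assume i: "i < m"
  have "h i = p i * c ^ (i - i) + (\<Sum>k=Suc i..m. p k * c ^ (k - i))"
    unfolding h_def using i by (intro sum.atLeast_Suc_atMost) simp
  also have "(\<Sum>k=Suc i..m. p k * c ^ (k - i)) = c * h (Suc i)"
    unfolding h_def sum_distrib_left
  proof (rule sum.cong[OF refl])
    fix k assume "k \<in> {Suc i..m}"
    then have "c ^ (k - i) = c * c ^ (k - Suc i)" by (metis Suc_diff_le atLeastAtMost_iff diff_Suc_Suc power_Suc)
    then show "p k * c ^ (k - i) = c * (p k * c ^ (k - Suc i))"
      unfolding central_left_commute[OF central_p] by (simp only:)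
  qed
  finally show ?thesis by simp
qed

lemma h_m: "h m = 1" by (simp add: h_def p_def)

lemma h_commute: "x * c = c * x \<Longrightarrow> x * h i = h i * x"
proof -
  assume x: "x * c = c * x"
  have "x * c ^ k = c ^ k * x" for k using x by (metis power_commuting_commutes)
  then show ?thesis unfolding h_def sum_distrib_left sum_distrib_right
    by (intro sum.cong refl) (metis central_p central_left_commute mult.assoc)
qed

lemma h0: "h 0 * e = 0" "e * h 0 = 0"
proof -
  have "h 0 = (\<Sum>k<m. p k * c ^ k) + c ^ m"
    by (simp add: h_def p_def atMost_atLeast0[symmetric] lessThan_Suc_atMost[symmetric])
  then have "h 0 * e = c ^ m * e - (\<Sum>k<m. \<mu> k * (c ^ k * e))"
    by (simp add: p_def left_diff_distrib sum_distrib_right mult.assoc sum_negf)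
  then show "h 0 * e = 0" using rel by simp
  then show "e * h 0 = 0" using h_commute[OF ec] by simp
qed

text \<open>By Horner's recursion the commutator telescopes to
  \<open>h 0 * f * a ^ (m - 1) - f * h 0 * a ^ (m - 1)\<close>, as for a Bezoutian. Here
  \<open>h 0\<close> is the polynomial evaluated at \<open>c\<close>, which annihilates
  \<open>e\<close>.\<close>

lemma bez_commute:
  assumes f: "e * f = f" "f * e = f"
  shows "c * bez f = bez f * c"
proof -
  define b where "b = a ^ (m - 1)"
  have bc: "b * c = c * b" unfolding b_def using ac ca by (metis power_commuting_commutes)
  define G where "G i = c ^ i * f * (h i * b)" for i
  have hc: "h i * c = c * h i" for i using h_commute[of c i] by simp
  have step: "c * (c ^ i * f * (h (Suc i) * b)) - c ^ i * f * (h (Suc i) * b) * c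
      = (G (Suc i) - G i) + p i * c ^ i * (f * b)" if i: "i < m" for i
  proof -
    have "c ^ i * f * (h (Suc i) * b) * c = c ^ i * f * ((c * h (Suc i)) * b)"
      by (simp add: mult.assoc bc) (simp add: hc flip: mult.assoc)
    also have "c * h (Suc i) = h i - p i" using h_Suc[OF i] by simp
    also have "c ^ i * f * ((h i - p i) * b) = G i - c ^ i * f * (p i * b)"
      by (simp add: G_def left_diff_distrib right_diff_distrib)
    also have "c ^ i * f * (p i * b) = p i * c ^ i * (f * b)"
      unfolding central_left_commute[OF central_p] by (simp add: mult.assoc)
    finally show ?thesis by (simp add: G_def mult.assoc)
  qed
  have "c * bez f - bez f * c = (\<Sum>i<m. (G (Suc i) - G i) + p i * c ^ i * (f * b))"
    unfolding bez_def sum_distrib_left sum_distrib_right sum_subtractf[symmetric] b_def[symmetric]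
    by (rule sum.cong[OF refl]) (use step in simp)
  also have "\<dots> = G m - G 0 + (\<Sum>i<m. p i * c ^ i) * (f * b)"
    by (simp add: sum.distrib sum_lessThan_telescope sum_distrib_right)
  also have "G 0 = 0"
  proof -
    have "f * h 0 = f * (e * h 0)" using f(2) by (metis mult.assoc)
    then show ?thesis using h0 by (simp add: G_def flip: mult.assoc)
  qed
  also have "G m = c ^ m * (f * b)" by (simp add: G_def h_m mult.assoc)
  also have "c ^ m * (f * b) - 0 + (\<Sum>i<m. p i * c ^ i) * (f * b) = h 0 * (f * b)"
    by (simp add: h_def p_def atMost_atLeast0[symmetric] lessThan_Suc_atMost[symmetric] distrib_right add.commute)
  also have "\<dots> = (h 0 * e) * (f * b)" using f(1) by (metis mult.assoc)
  finally show ?thesis using h0 by simp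
qed

lemma bez_add: "bez (f + f') = bez f + bez f'"
  by (simp add: bez_def distrib_left distrib_right sum.distrib)

lemma bez_e:
  assumes f: "e * f = f" "f * e = f"
  shows "e * bez f = bez f" "bez f * e = bez f"
proof -
  have "e * (c ^ i * f * x) = c ^ i * f * x" for i x
    using f(1) ec_power by (metis mult.assoc)
  then show "e * bez f = bez f" by (simp add: bez_def sum_distrib_left)
  have "h (Suc i) * a ^ (m - 1) * e = e * (h (Suc i) * a ^ (m - 1))" for i
    using ea_power h_commute[OF ec] by (metis mult.assoc)
  then have "c ^ i * f * (h (Suc i) * a ^ (m - 1)) * e = c ^ i * f * (h (Suc i) * a ^ (m - 1))" for i
    using f(2) by (metis mult.assoc)
  then show "bez f * e = bez f" by (simp add: bez_def sum_distrib_right)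
qed

text \<open>Expanding \<open>h\<close>, each term contains \<open>f * a ^ s * f'\<close> with
  \<open>s < m\<close>, and \<open>separating\<close> leaves only \<open>s = 0\<close>. This occurs
  only for \<open>i = 0\<close> and the leading coefficient \<open>1\<close>.\<close>

lemma bez_absorb:
  assumes F: "separating F" and f: "f * F = f" "F * f' = f'"
  shows "bez f * f' = f * f'"
proof -
  have z: "f * (c ^ j * a ^ (m - 1) * f') = (if j = m - 1 then f * f' else 0)" if "j \<le> m - 1" for j
  proof -
    have "c ^ j * a ^ (m - 1) = a ^ (m - 1 - j)"
    proof -
      have "m - 1 = j + (m - 1 - j)" using that by simp
      then have "a ^ (m - 1) = a ^ j * a ^ (m - 1 - j)" by (metis power_add)
      moreover have "c ^ j * a ^ j = 1" using inverse_power_cancel[OF ca, of j j] by simp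
      ultimately show ?thesis by (simp flip: mult.assoc)
    qed
    then have "f * (c ^ j * a ^ (m - 1) * f') = f * (F * (a ^ (m - 1 - j) * F)) * f'"
      using f by (metis mult.assoc)
    moreover have "F * (a ^ (m - 1 - j) * F) = (if j = m - 1 then F else 0)"
      using F that m unfolding separating_def idem_def by auto
    ultimately show ?thesis using f by auto
  qed
  have t: "f * (h (Suc i) * a ^ (m - 1) * f') = (if i = 0 then f * f' else 0)" if i: "i < m" for i
  proof -
    have "f * (h (Suc i) * a ^ (m - 1) * f') = (\<Sum>k=Suc i..m. p k * (f * (c ^ (k - Suc i) * a ^ (m - 1) * f')))"
      unfolding h_def sum_distrib_right sum_distrib_left
      by (intro sum.cong refl) (simp add: mult.assoc central_left_commute[OF central_p])
    also have "\<dots> = (\<Sum>k=Suc i..m. if k = m then (if i = 0 then f * f' else 0) else 0)"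
      by (rule sum.cong[OF refl], subst z) (use i in \<open>auto simp: p_def\<close>)
    finally show ?thesis using i by (simp add: sum.delta)
  qed
  have "bez f * f' = (\<Sum>i<m. c ^ i * (f * (h (Suc i) * a ^ (m - 1) * f')))"
    by (simp add: bez_def sum_distrib_right mult.assoc)
  also have "\<dots> = (\<Sum>i<m. if i = 0 then f * f' else 0)"
    by (rule sum.cong[OF refl]) (use t in auto)
  finally show ?thesis using m by (simp add: sum.delta)
qed

text \<open>Since \<open>bez f\<close> commutes with \<open>c\<close>, it passes through the powers
  in \<open>bez f'\<close> and meets \<open>f'\<close>, where \<open>bez_absorb\<close> replaces it
  by \<open>f\<close>.\<close>

lemma bez_mult:
  assumes F: "separating F" and f: "f * F = f" "F * f = f" "f' * F = f'" "F * f' = f'"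
  shows "bez f * bez f' = bez (f * f')"
proof -
  have fe: "e * f = f" "f * e = f" using F f unfolding separating_def by (metis mult.assoc)+
  have "bez f * c ^ i = c ^ i * bez f" for i
    using bez_commute[OF fe] by (metis power_commuting_commutes)
  then have "bez f * (c ^ i * f' * x) = c ^ i * (f * f') * x" for i x
    using bez_absorb[OF F f(1,4)] by (metis mult.assoc)
  then show ?thesis by (simp add: bez_def[of f'] bez_def[of "f * f'"] sum_distrib_left)
qed

text \<open>\<open>F * a ^ (m - 1)\<close> picks out the summand \<open>i = m - 1\<close> of
  \<open>bez F\<close>, whose cofactor \<open>h m\<close> is \<open>1\<close>. The powers of
  \<open>a\<close> then cancel because \<open>bez F\<close> commutes with them.\<close>

lemma bez_fix:
  assumes F: "separating F"
  shows "F * bez F = F"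
proof -
  have fe: "e * F = F" "F * e = F" and FF: "F * F = F" using F by (auto simp: separating_def idem_def)
  have z: "F * a ^ (m - 1) * (c ^ i * F) = (if i = m - 1 then F else 0)" if i: "i < m" for i
  proof -
    have "a ^ (m - 1) * c ^ i = a ^ (m - 1 - i)" using inverse_power_cancel[OF ac] i by simp
    then have "F * a ^ (m - 1) * (c ^ i * F) = F * (a ^ (m - 1 - i) * F)" by (metis mult.assoc)
    then show ?thesis using F FF i unfolding separating_def by auto
  qed
  have "F * a ^ (m - 1) * bez F = (\<Sum>i<m. F * a ^ (m - 1) * (c ^ i * F) * (h (Suc i) * a ^ (m - 1)))"
    by (simp add: bez_def sum_distrib_left mult.assoc)
  also have "\<dots> = (\<Sum>i<m. if i = m - 1 then F * a ^ (m - 1) else 0)"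
    by (rule sum.cong[OF refl], subst z) (use m h_m in auto)
  also have "\<dots> = F * a ^ (m - 1)" using m by (simp add: sum.delta)
  finally have "F * a ^ (m - 1) * bez F = F * a ^ (m - 1)" .
  moreover have "a ^ (m - 1) * bez F = bez F * a ^ (m - 1)"
    using commute_a[OF bez_commute[OF fe]] by (metis power_commuting_commutes)
  ultimately have "F * bez F * a ^ (m - 1) * c ^ (m - 1) = F * a ^ (m - 1) * c ^ (m - 1)" by (metis mult.assoc)
  moreover have "a ^ (m - 1) * c ^ (m - 1) = 1" using inverse_power_cancel[OF ac, of "m - 1" "m - 1"] by simp
  ultimately show ?thesis by (simp add: mult.assoc)
qed

text \<open>The two annihilator properties of \<open>chain_idem_join\<close>, applied to the left
  and the right factor in turn, carry the condition on \<open>a ^ s\<close> over to the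
  supremum.\<close>

lemma separating_maximal:
  obtains F where "separating F" "\<And>F'. separating F' \<Longrightarrow> F * F' = F \<Longrightarrow> F' * F = F \<Longrightarrow> F' = F"
proof -
  let ?P = "\<lambda>f f'. f * f' = f \<and> f' * f = (f::'r)"
  let ?A = "Collect separating"
  have po: "partial_order_on ?A (relation_of ?P ?A)"
  proof (rule partial_order_on_relation_ofI)
    show "?P f f" if "f \<in> ?A" for f using that by (simp add: separating_def idem_def)
    show "?P f f''" if "?P f f'" "?P f' f''" for f f' f'' using that by (metis mult.assoc)
    show "f = f'" if "?P f f'" "?P f' f" for f f' using that by metis
  qed
  have ch: "\<exists>s\<in>?A. \<forall>f\<in>\<C>. ?P f s" if \<C>: "\<C> \<in> Chains (relation_of ?P ?A)" for \<C>
  proof -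
    have sep: "separating f" if "f \<in> \<C>" for f
      using \<C> that unfolding Chains_def relation_of_def by blast
    have tot: "?P f f' \<or> ?P f' f" if "f \<in> \<C>" "f' \<in> \<C>" for f f'
      using \<C> that unfolding Chains_def relation_of_def by blast
    obtain s where s: "idem s" "\<And>f. f \<in> \<C> \<Longrightarrow> f * s = f \<and> s * f = f"
      "\<And>t. (\<And>f. f \<in> \<C> \<Longrightarrow> t * f = 0) \<Longrightarrow> t * s = 0"
      "\<And>x. (\<And>f. f \<in> \<C> \<Longrightarrow> f * x = 0) \<Longrightarrow> s * x = 0"
    proof (rule chain_idem_join[of \<C>])
      show "idem f" if "f \<in> \<C>" for f using sep[OF that] by (simp add: separating_def)
      show "f * f' = f \<and> f' * f = f \<or> f * f' = f' \<and> f' * f = f'" if "f \<in> \<C>" "f' \<in> \<C>" for f f'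
        using tot[OF that] by blast
    qed blast
    have "(1 - e) * s = 0" by (rule s(3)) (use sep in \<open>simp add: separating_def left_diff_distrib\<close>)
    then have es: "e * s = s" by (simp add: left_diff_distrib)
    have "s * (1 - e) = 0" by (rule s(4)) (use sep in \<open>simp add: separating_def right_diff_distrib\<close>)
    then have se: "s * e = s" by (simp add: right_diff_distrib)
    have "s * (a ^ j * s) = 0" if j: "0 < j" "j < m" for j
    proof -
      have "f * a ^ j * f' = 0" if f: "f \<in> \<C>" "f' \<in> \<C>" for f f'
      proof -
        have *: "f * a ^ j * f = 0" "f' * a ^ j * f' = 0"
          using sep f j unfolding separating_def by (simp_all add: mult.assoc)
        show ?thesis using tot[OF f]
        proof
          assume "?P f f'"
          then have "f * a ^ j * f' = f * (f' * a ^ j * f')" by (metis mult.assoc)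
          then show ?thesis using * by simp
        next
          assume "?P f' f"
          then have "f * a ^ j * f' = f * a ^ j * f * f'" by (metis mult.assoc)
          then show ?thesis using * by simp
        qed
      qed
      then have "f * a ^ j * s = 0" if "f \<in> \<C>" for f using s(3)[of "f * a ^ j"] that by blast
      then show ?thesis using s(4)[of "a ^ j * s"] by (simp add: mult.assoc)
    qed
    then have "separating s" using s(1) es se by (simp add: separating_def)
    then show ?thesis using s(2) by blast
  qed
  obtain F where "F \<in> ?A" "\<forall>f\<in>?A. ?P F f \<longrightarrow> f = F" using predicate_Zorn[OF po ch] by blast
  then show thesis using that by blast
qed

text \<open>\<open>z\<close> is the coordinate of \<open>c ^ (m - 1) * x\<close>, so
  \<open>F = x * z * c ^ (m - 1)\<close> is an idempotent fixing \<open>x\<close>. A power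
  \<open>a ^ s\<close> between two factors \<open>F\<close> lowers the exponent and leads to a
  vector on which \<open>z\<close> vanishes.\<close>

lemma separating_of_dual:
  assumes e': "e' * e' = e'" "e' * c = c * e'" "e * e' = e'" "e' * e = e'"
    and x: "e' * x = x" and dual: "dual c m x g y"
  obtains F where "separating F" "F \<noteq> 0" "e' * F = F" "F * e' = F"
proof -
  have g: "g * g = g" "x * g = x" "g \<noteq> 0" and yx: "\<And>i j. i < m \<Longrightarrow> j < m \<Longrightarrow> y j * (c ^ i * x) = (if i = j then g else 0)"
    using dual by (simp_all add: dual_def idem_def)
  have e'c: "e' * c ^ i = c ^ i * e'" for i using e'(2) by (metis power_commuting_commutes)
  define z where "z = g * y (m - 1) * e'"
  have zx: "z * (c ^ i * x) = (if i = m - 1 then g else 0)" if "i < m" for i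
  proof -
    have "z * (c ^ i * x) = g * (y (m - 1) * (c ^ i * (e' * x)))" unfolding z_def using e'c by (metis mult.assoc)
    then show ?thesis using yx[OF that, of "m - 1"] m x g by simp
  qed
  define F where "F = x * z * c ^ (m - 1)"
  have FF: "F * F = F"
  proof -
    have "F * F = x * (z * (c ^ (m - 1) * x)) * z * c ^ (m - 1)" by (simp add: F_def mult.assoc)
    then show ?thesis using zx[of "m - 1"] m g by (simp add: F_def)
  qed
  have eF: "e' * F = F" by (simp add: F_def x flip: mult.assoc)
  have "c ^ (m - 1) * e' = e' * c ^ (m - 1)" using e'c by simp
  moreover have "z * e' = z" by (simp add: z_def e' mult.assoc)
  ultimately have Fe: "F * e' = F" unfolding F_def by (metis mult.assoc)
  have "F * (a ^ s * F) = 0" if s: "0 < s" "s < m" for s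
  proof -
    have "F * (a ^ s * F) = x * (z * ((c ^ (m - 1) * a ^ s) * x)) * z * c ^ (m - 1)" by (simp add: F_def mult.assoc)
    also have "c ^ (m - 1) * a ^ s = c ^ (m - 1 - s)" using inverse_power_cancel[OF ca] s by simp
    also have "z * (c ^ (m - 1 - s) * x) = 0"
    proof -
      have "m - 1 - s \<noteq> m - 1" "m - 1 - s < m" using s by linarith+
      then show ?thesis using zx[of "m - 1 - s"] by simp
    qed
    finally show ?thesis by simp
  qed
  moreover have "e * F = F" "F * e = F" using eF Fe e' by (metis mult.assoc)+
  ultimately have "separating F" using FF by (simp add: separating_def idem_def)
  moreover have "F \<noteq> 0"
  proof
    assume "F = 0"
    moreover have "F * x = x" using zx[of "m - 1"] m g by (simp add: F_def mult.assoc)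
    ultimately have "x = 0" by simp
    then show False using yx[of 0 0] m g by simp
  qed
  ultimately show thesis using that eF Fe by blast
qed

text \<open>\<open>bez\<close> carries the halving tree of \<open>F\<close> into the commutant. The
  constant \<open>m * \<rho> F\<close> arises because \<open>bez f\<close> is a sum of
  \<open>m\<close> terms, each subordinate to \<open>f\<close>.\<close>

lemma bez_divisible:
  assumes na: no_atoms and \<rho>: "rankfun (\<rho> :: 'r \<Rightarrow> real)" and F: "separating F"
  shows "divisible \<rho> c (bez F)"
  unfolding divisible_def
proof (rule exI[of _ "\<lambda>n k. bez (tree F n k)"], rule exI[of _ "real m * \<rho> F"], intro conjI allI impI)
  have Fi: "idem F" and Fe: "e * F = F" "F * e = F" using F by (auto simp: separating_def)
  have FF: "F * F = F" using Fi by (simp add: idem_def)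
  note tb = tree_below[OF na Fi]
  have te: "e * tree F n k = tree F n k" "tree F n k * e = tree F n k" for n k
    using tb[of n k] Fe by (metis mult.assoc)+
  let ?Q = "\<lambda>n k. bez (tree F n k)"
  show "?Q 0 0 = bez F" by simp
  show "?Q n k * ?Q n l = (if k = l then ?Q n k else 0)" if "k < 2 ^ n" "l < 2 ^ n" for n k l
  proof -
    have "?Q n k * ?Q n l = bez (tree F n k * tree F n l)" by (rule bez_mult[OF F]) (use tb in auto)
    moreover have "bez 0 = 0" by (simp add: bez_def)
    ultimately show ?thesis using tree_orth[OF na Fi that] tree_idem[OF na Fi, of n k]
      by (cases "k = l") (simp_all add: idem_def)
  qed
  show "c * ?Q n k = ?Q n k * c" for n k by (rule bez_commute[OF te])
  show "bez F * ?Q n k = ?Q n k" "?Q n k * bez F = ?Q n k" for n k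
    using bez_mult[OF F, of F "tree F n k"] bez_mult[OF F, of "tree F n k" F] tb FF by auto
  show "?Q n k = ?Q (Suc n) (2 * k) + ?Q (Suc n) (2 * k + 1)" for n k
    using tree_split[OF na Fi, of n k] bez_add by (metis Suc_eq_plus1)
  show "\<rho> (?Q n k) \<le> real m * \<rho> F / 2 ^ n" for n k
  proof -
    have "\<rho> (?Q n k) \<le> real m * \<rho> (tree F n k)" unfolding bez_def
      by (rule rankfun_sum[OF \<rho>], rule rankfun_subord[OF \<rho>]) (rule subordI, rule refl)
    then show ?thesis using rankfun_tree[OF na \<rho> Fi] by simp
  qed
qed

end

context continuous_regular_ring
begin

section \<open>Decomposing the unit element\<close>

lemma divisible_add:
  assumes \<rho>: "rankfun (\<rho> :: 'r \<Rightarrow> real)" and "divisible \<rho> c e" "divisible \<rho> c f" and ef: "e * f = 0" "f * e = 0"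
  shows "divisible \<rho> c (e + f)"
proof -
  obtain Q :: "nat \<Rightarrow> nat \<Rightarrow> 'r" and C :: real where Q: "Q 0 0 = e" "\<And>n k l. k < 2 ^ n \<Longrightarrow> l < 2 ^ n \<Longrightarrow> Q n k * Q n l = (if k = l then Q n k else 0)"
    "\<And>n k. c * Q n k = Q n k * c" "\<And>n k. e * Q n k = Q n k" "\<And>n k. Q n k * e = Q n k"
    "\<And>n k. Q n k = Q (Suc n) (2 * k) + Q (Suc n) (2 * k + 1)" "\<And>n k. \<rho> (Q n k) \<le> C / 2 ^ n"
    using assms(2) unfolding divisible_def by metis
  obtain Q' :: "nat \<Rightarrow> nat \<Rightarrow> 'r" and C' :: real where Q': "Q' 0 0 = f" "\<And>n k l. k < 2 ^ n \<Longrightarrow> l < 2 ^ n \<Longrightarrow> Q' n k * Q' n l = (if k = l then Q' n k else 0)"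
    "\<And>n k. c * Q' n k = Q' n k * c" "\<And>n k. f * Q' n k = Q' n k" "\<And>n k. Q' n k * f = Q' n k"
    "\<And>n k. Q' n k = Q' (Suc n) (2 * k) + Q' (Suc n) (2 * k + 1)" "\<And>n k. \<rho> (Q' n k) \<le> C' / 2 ^ n"
    using assms(3) unfolding divisible_def by metis
  have QQ: "Q n k * Q' n l = 0" "Q' n k * Q n l = 0" for n k l
    using Q(4,5) Q'(4,5) ef by (metis mult.assoc mult_zero_left mult_zero_right)+
  have eQ': "e * Q' n k = 0" "Q' n k * e = 0" "f * Q n k = 0" "Q n k * f = 0" for n k
    using Q(4,5) Q'(4,5) ef by (metis mult.assoc mult_zero_left mult_zero_right)+
  show ?thesis unfolding divisible_def
  proof (rule exI[of _ "\<lambda>n k. Q n k + Q' n k"], rule exI[of _ "C + C'"], intro conjI allI impI)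
    let ?Q = "\<lambda>n k. Q n k + Q' n k"
    show "?Q 0 0 = e + f" by (simp add: Q(1) Q'(1))
    show "?Q n k * ?Q n l = (if k = l then ?Q n k else 0)" if "k < 2 ^ n" "l < 2 ^ n" for n k l
      using Q(2)[OF that] Q'(2)[OF that] by (simp add: distrib_left distrib_right QQ)
    show "c * ?Q n k = ?Q n k * c" "(e + f) * ?Q n k = ?Q n k" "?Q n k * (e + f) = ?Q n k" for n k
      by (simp_all add: distrib_left distrib_right Q(3-5) Q'(3-5) eQ')
    show "?Q n k = ?Q (Suc n) (2 * k) + ?Q (Suc n) (2 * k + 1)" for n k
      using Q(6)[of n k] Q'(6)[of n k] by (simp add: add_ac)
    show "\<rho> (?Q n k) \<le> (C + C') / 2 ^ n" for n k
      using rankfun_add[OF \<rho>, of "Q n k" "Q' n k"] Q(7)[of n k] Q'(7)[of n k] by (simp add: add_divide_distrib)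
  qed
qed

text \<open>
  A maximal separating \<open>F\<close> splits off the divisible idempotent \<open>bez F\<close>. On the complement, an
  element of order \<open>m\<close> would produce a separating idempotent orthogonal to \<open>F\<close>, so the order drops.
\<close>

lemma algebraic_divisible:
  assumes na: no_atoms and \<rho>: "rankfun (\<rho> :: 'r \<Rightarrow> real)" and ac: "a * c = 1" "c * a = (1::'r)"
  shows "idem e \<Longrightarrow> e * c = c * e \<Longrightarrow> algebraic_on c e d \<Longrightarrow>
    (\<And>m x g y. e * x = x \<Longrightarrow> dual c m x g y \<Longrightarrow> m \<le> M) \<Longrightarrow> divisible \<rho> c e"
proof (induction M arbitrary: e rule: less_induct)
  case (less M)
  show ?case
  proof (cases "e = 0")
    case True
    then show ?thesis using divisible_zero[OF \<rho>] by simp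
  next
    case False
    obtain m x g y where ord: "0 < m" "m \<le> d" "top_order c e m" "e * x = x" "dual c m x g y"
      "\<And>m' x' g' y'. e * x' = x' \<Longrightarrow> dual c m' x' g' y' \<Longrightarrow> m' \<le> m"
      using top_order_exists[OF less.prems(1) False less.prems(3)] by blast
    obtain x1 g1 y1 \<mu> where x1: "e * x1 = x1" "dual c m x1 g1 y1" "\<And>j. j < m \<Longrightarrow> central (\<mu> j)"
      "c ^ m * x1 = (\<Sum>j<m. \<mu> j * (c ^ j * x1))"
      using central_coefficients[OF na ord(3,4,5)] by blast
    have rel: "c ^ m * e = (\<Sum>j<m. \<mu> j * (c ^ j * e))"
      by (rule annihilating_polynomial[OF na \<rho> less.prems(1,3) ord(3) x1])
    interpret annihilated_idem ty a c e m \<mu>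
      by unfold_locales (use ac less.prems ord(1) x1(3) rel in auto)
    obtain F where F: "separating F" "\<And>F'. separating F' \<Longrightarrow> F * F' = F \<Longrightarrow> F' * F = F \<Longrightarrow> F' = F"
      by (rule separating_maximal) blast
    have Fe: "e * F = F" "F * e = F" and FF: "F * F = F" using F(1) by (auto simp: separating_def idem_def)
    define P where "P = bez F"
    have P: "P * P = P" "e * P = P" "P * e = P" "c * P = P * c" "P * F = F" "F * P = F"
      unfolding P_def using bez_mult[OF F(1), of F F] bez_e[OF Fe] bez_commute[OF Fe]
        bez_absorb[OF F(1), of F F] bez_fix[OF F(1)] FF by auto
    have ee: "e * e = e" using less.prems(1) by (simp add: idem_def)
    define e' where "e' = e - P"
    have e': "e' * e' = e'" "e' * c = c * e'" "e * e' = e'" "e' * e = e'" "P * e' = 0" "e' * P = 0"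
      by (simp_all add: e'_def left_diff_distrib right_diff_distrib ee P less.prems(2))
    have ca': "a ^ s * e' = e' * a ^ s" for s
      using commute_a[of e'] e'(2) by (metis power_commuting_commutes)
    have small: "m' < m" if x': "e' * x' = x'" "dual c m' x' g' y'" for m' x' g' y'
    proof (rule ccontr)
      assume "\<not> m' < m"
      \<comment> \<open>Discarding the functionals beyond the first \<open>m\<close> reduces a
        higher order to order \<open>m\<close>, and that case yields \<open>F + F'\<close> against
        the maximality of \<open>F\<close>.\<close>
      then have "dual c m x' g' y'" using x'(2) unfolding dual_def by auto
      then obtain F' where F': "separating F'" "F' \<noteq> 0" "e' * F' = F'" "F' * e' = F'"
        using separating_of_dual[OF e'(1-4) x'(1)] by blast
      have z: "F * F' = 0" "F' * F = 0" by (metis F'(3,4) P(5,6) e'(5,6) mult.assoc mult_zero_left mult_zero_right)+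
      have z2: "F * (a ^ s * F') = 0" "F' * (a ^ s * F) = 0" for s
      proof -
        have "F * (a ^ s * F') = F * P * (a ^ s * (e' * F'))" using F'(3) P(6) by simp
        also have "\<dots> = F * (P * e') * (a ^ s * F')" using ca' by (metis mult.assoc)
        finally show "F * (a ^ s * F') = 0" using e' by simp
        have "F' * (a ^ s * F) = F' * e' * (a ^ s * (P * F))" using F'(4) P(5) by simp
        also have "\<dots> = F' * a ^ s * (e' * P) * F" using ca' by (metis mult.assoc)
        finally show "F' * (a ^ s * F) = 0" using e' by simp
      qed
      have "separating (F + F')"
        using F(1) F'(1) unfolding separating_def idem_def by (auto simp: distrib_left distrib_right z z2)
      moreover have "F * (F + F') = F" "(F + F') * F = F" by (simp_all add: distrib_left distrib_right FF z)
      ultimately have "F + F' = F" using F(2) by blast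
      then show False using F'(2) by simp
    qed
    have mM: "m \<le> M" using less.prems(4) ord(4,5) by blast
    have "divisible \<rho> c e'"
    proof (rule less.IH[of "m - 1"])
      show "m - 1 < M" using mM ord(1) by simp
      show "idem e'" using e' by (simp add: idem_def)
      show "e' * c = c * e'" by (rule e')
      show "algebraic_on c e' d"
      proof -
        obtain \<nu> where \<nu>: "\<forall>j<d. central (\<nu> j)" "c ^ d * e = (\<Sum>j<d. \<nu> j * (c ^ j * e))"
          using less.prems(3) unfolding algebraic_on_def by blast
        have "c ^ d * e' = c ^ d * e * e'" by (simp add: mult.assoc e')
        also have "\<dots> = (\<Sum>j<d. \<nu> j * (c ^ j * e'))" unfolding \<nu>(2) sum_distrib_right by (simp add: mult.assoc e')
        finally show ?thesis using \<nu>(1) unfolding algebraic_on_def by blast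
      qed
      show "m' \<le> m - 1" if "e' * x' = x'" "dual c m' x' g' y'" for m' x' g' y' using small[OF that] by simp
    qed
    moreover have "divisible \<rho> c P" unfolding P_def by (rule bez_divisible[OF na \<rho> F(1)])
    ultimately have "divisible \<rho> c (e' + P)" using divisible_add[OF \<rho>] e' by blast
    then show ?thesis by (simp add: e'_def)
  qed
qed

end

section \<open>Flows through algebraic units\<close>

definition zpow :: "'r::ring_1 \<Rightarrow> 'r \<Rightarrow> int \<Rightarrow> 'r" where
  "zpow c a z = (if 0 \<le> z then c ^ nat z else a ^ nat (- z))"

lemma zpow_add:
  assumes ac: "a * c = 1" and ca: "c * a = (1::'r::ring_1)"
  shows "zpow c a (x + y) = zpow c a x * zpow c a y"
proof -
  have s: "zpow c a (x + 1) = zpow c a x * c" for x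
  proof (cases "0 \<le> x")
    case True
    then have "nat (x + 1) = Suc (nat x)" by simp
    then show ?thesis using True by (simp add: zpow_def power_commutes)
  next
    case False
    then have "nat (- x) = Suc (nat (- (x + 1)))" by simp
    then have "a ^ nat (- x) * c = a ^ nat (- (x + 1)) * (a * c)"
      by (simp only: power_Suc2 mult.assoc)
    then show ?thesis using False ac by (auto simp: zpow_def)
  qed
  have p: "zpow c a (x - 1) = zpow c a x * a" for x
    using s[of "x - 1"] ca by (simp add: mult.assoc)
  show ?thesis
  proof (induction y rule: int_induct[of _ 0])
    case base
    show ?case by (simp add: zpow_def)
  next
    case (step1 i)
    have "zpow c a (x + (i + 1)) = zpow c a (x + i) * c" using s[of "x + i"] by (simp add: add.assoc)
    then show ?case using step1 s[of i] by (simp add: mult.assoc)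
  next
    case (step2 i)
    have "zpow c a (x + (i - 1)) = zpow c a (x + i) * a" using p[of "x + i"] by (simp add: algebra_simps)
    then show ?case using step2 p[of i] by (simp add: mult.assoc)
  qed
qed

lemma zpow_0 [simp]: "zpow c a 0 = 1" and zpow_1 [simp]: "zpow c a 1 = c"
  by (simp_all add: zpow_def)

lemma zpow_commute: "q * c = c * q \<Longrightarrow> q * a = a * q \<Longrightarrow> q * zpow c a z = zpow c a z * q"
  unfolding zpow_def by (metis power_commuting_commutes)

text \<open>These are compatible homomorphisms from the groups of integer vectors of length
  \<open>2 ^ n\<close>, Lipschitz from the normalized Hamming distance to the rank distance with a
  constant independent of \<open>n\<close>.\<close>

definition rank_flow :: "('r::ring_1 \<Rightarrow> real) \<Rightarrow> 'r \<Rightarrow> (nat \<Rightarrow> (nat \<Rightarrow> int) \<Rightarrow> 'r) \<Rightarrow> real \<Rightarrow> bool" where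
  "rank_flow \<rho> c u C \<longleftrightarrow> (\<forall>n z z'. u n z * u n z' = u n (\<lambda>k. z k + z' k)) \<and>
     (\<forall>n. u n (\<lambda>_. 0) = 1) \<and> u 0 (\<lambda>_. 1) = c \<and> (\<forall>n z. u n z = u (Suc n) (\<lambda>k. z (k div 2))) \<and>
     (\<forall>n z z'. \<rho> (u n z - u n z') \<le> C / 2 ^ n * real (card {k. k < 2 ^ n \<and> z k \<noteq> z' k}))"

text \<open>Coefficients stand in descending order as in \<open>univ_poly\<close>, so that
  \<open>eval\<close> transfers by induction on the list.\<close>

primrec leval :: "'r::ring_1 list \<Rightarrow> 'r \<Rightarrow> 'r" where
  "leval [] x = 0"
| "leval (p # ps) x = p * x ^ length ps + leval ps x"

lemma leval_sum: "leval ps x = (\<Sum>i<length ps. ps ! (length ps - Suc i) * x ^ i)"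
proof (induction ps)
  case (Cons p ps)
  have "(\<Sum>i<length ps. (p # ps) ! (length (p # ps) - Suc i) * x ^ i) = (\<Sum>i<length ps. ps ! (length ps - Suc i) * x ^ i)"
    by (rule sum.cong) (auto simp: nth_Cons' Suc_diff_Suc[symmetric])
  then show ?case using Cons by (simp add: add.commute)
qed simp

context continuous_regular_ring
begin

section \<open>From an annihilating polynomial to a flow\<close>

lemma central_inverse:
  assumes "central (z::'r)" "z \<noteq> 0"
  obtains z' where "central z'" "z' * z = 1"
proof -
  obtain e b where e: "idem e" "pri e = pri z" "e = z * b" "e * z = z" by (rule pri_idem_exists)
  have ee: "e * e = e" using e by (simp add: idem_def)
  \<comment> \<open>\<open>z R\<close> is two-sided because \<open>z\<close> is central. Regularity
    upgrades this one-sided identity for its generator \<open>e\<close> to centrality, and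
    indecomposability gives \<open>e = 1\<close>.\<close>
  have xe: "e * (x * e) = x * e" for x
  proof -
    have "x * e = z * (x * b)" using assms(1) e(3) by (metis central_def mult.assoc)
    then have "x * e \<in> pri e" using e(2) by simp
    then show ?thesis using e(1) pri_idem by blast
  qed
  have "e * x = x * e" for x
  proof -
    define y where "y = e * x - e * x * e"
    obtain w where w: "y * w * y = y" using regular by blast
    have ye: "y * e = 0" by (simp add: y_def left_diff_distrib mult.assoc ee)
    have ey: "e * y = y" by (simp add: y_def right_diff_distrib ee flip: mult.assoc)
    have "y * (w * e) = y * (e * (w * e))" using xe by simp
    then have "y * (w * e) = 0" using ye by (simp flip: mult.assoc)
    then have "y * w * (e * y) = 0" by (metis mult.assoc mult_zero_left)
    then have "y = 0" using w ey by simp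
    then show ?thesis using xe[of x] by (simp add: y_def mult.assoc)
  qed
  then have "e = 0 \<or> e = 1" using indecomposable ee by blast
  moreover have "e \<noteq> 0" using e(4) assms(2) by auto
  ultimately have zb: "z * b = 1" using e(3) by simp
  then have bz: "b * z = 1" using assms(1) by (simp add: central_def)
  have "b * x = x * b" for x
  proof -
    have "b * x = b * x * (z * b)" by (simp add: zb)
    also have "\<dots> = b * (x * z) * b" by (simp add: mult.assoc)
    also have "x * z = z * x" using assms(1) by (simp add: central_def)
    also have "b * (z * x) * b = x * b" by (simp add: bz flip: mult.assoc)
    finally show ?thesis .
  qed
  then have "central b" by (simp add: central_def)
  then show thesis using bz by (rule that)
qed

lemma polynomial_algebraic:
  assumes ps: "ps \<noteq> []" "hd ps \<noteq> (0::'r)" "\<forall>p\<in>set ps. central p" "leval ps c = 0"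
  obtains d where "algebraic_on c 1 d"
proof -
  obtain p qs where pq: "ps = p # qs" using ps(1) by (cases ps) auto
  obtain p' where p': "central p'" "p' * p = 1" by (rule central_inverse[of p]) (use ps pq in auto)
  define \<mu> where "\<mu> i = - (p' * qs ! (length qs - Suc i))" for i
  have "p * c ^ length qs = - leval qs c" using ps(4) pq by (simp add: eq_neg_iff_add_eq_0)
  then have "p' * (p * c ^ length qs) = - (p' * leval qs c)" by simp
  then have "c ^ length qs = - (p' * leval qs c)" using p'(2) by (simp flip: mult.assoc)
  also have "\<dots> = (\<Sum>i<length qs. \<mu> i * c ^ i)"
    by (simp add: leval_sum \<mu>_def sum_distrib_left sum_negf mult.assoc)
  finally have "c ^ length qs * 1 = (\<Sum>i<length qs. \<mu> i * (c ^ i * 1))" by simp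
  moreover have "central (\<mu> i)" if "i < length qs" for i
  proof -
    have "central (qs ! (length qs - Suc i))" using ps(3) pq that by simp
    then show ?thesis using p'(1) unfolding \<mu>_def central_def by (metis minus_mult_left minus_mult_right mult.assoc)
  qed
  ultimately have "algebraic_on c 1 (length qs)" unfolding algebraic_on_def by blast
  then show thesis by (rule that)
qed

lemma rankfun_sum_set:
  assumes "rankfun \<rho>" "finite I" "\<And>i. i \<in> I \<Longrightarrow> \<rho> (f i :: 'r) \<le> B"
  shows "\<rho> (sum f I) \<le> B * real (card I)"
  using assms(2,3)
proof (induction I rule: finite_induct)
  case empty
  then show ?case using rankfun_zero[OF assms(1)] by simp
next
  case (insert i I)
  have "\<rho> (f i + sum f I) \<le> \<rho> (f i) + \<rho> (sum f I)" by (rule rankfun_add[OF assms(1)])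
  moreover have "\<rho> (f i) \<le> B" "\<rho> (sum f I) \<le> B * real (card I)" using insert by auto
  moreover have "B * real (card (insert i I)) = B + B * real (card I)" using insert by (simp add: algebra_simps)
  ultimately show ?case using insert(1,2) by simp
qed

lemma rank_flow_exists:
  assumes na: no_atoms and \<rho>: "rankfun (\<rho> :: 'r \<Rightarrow> real)" and ac: "a * c = 1" "c * a = (1::'r)"
    and alg: "algebraic_on c 1 d"
  obtains u C where "rank_flow \<rho> c u C"
proof -
  have "divisible \<rho> c 1"
  proof (rule algebraic_divisible[OF na \<rho> ac _ _ alg])
    show "m \<le> d" if "1 * x = x" "dual c m x g y" for m x g y by (rule dual_order_bound[OF alg that])
  qed simp_all
  then obtain Q :: "nat \<Rightarrow> nat \<Rightarrow> 'r" and C :: real where Q: "Q 0 0 = 1"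
    "\<And>n k l. k < 2 ^ n \<Longrightarrow> l < 2 ^ n \<Longrightarrow> Q n k * Q n l = (if k = l then Q n k else 0)"
    "\<And>n k. c * Q n k = Q n k * c"
    "\<And>n k. Q n k = Q (Suc n) (2 * k) + Q (Suc n) (2 * k + 1)" "\<And>n k. \<rho> (Q n k) \<le> C / 2 ^ n"
    unfolding divisible_def by metis
  have Qa: "Q n k * a = a * Q n k" for n k
    by (metis Q(3) ac mult.assoc mult_1_left mult_1_right)
  let ?z = "zpow c a"
  have Qz: "Q n k * ?z i = ?z i * Q n k" for n k i by (rule zpow_commute) (simp_all add: Q(3) Qa)
  define u where "u n z = (\<Sum>k<2 ^ n. Q n k * ?z (z k))" for n and z :: "nat \<Rightarrow> int"
  have refine: "u n z = u (Suc n) (\<lambda>k. z (k div 2))" for n z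
  proof -
    have "u n z = (\<Sum>k<2 ^ n. \<Sum>j = k * 2..<k * 2 + 2. Q (Suc n) j * ?z (z (j div 2)))"
      unfolding u_def
    proof (rule sum.cong[OF refl])
      fix k :: nat
      have "{k * 2..<k * 2 + 2} = {2 * k, 2 * k + 1}" by auto
      then show "Q n k * ?z (z k) = (\<Sum>j = k * 2..<k * 2 + 2. Q (Suc n) j * ?z (z (j div 2)))"
        using Q(4)[of n k] by (simp add: distrib_right)
    qed
    also have "\<dots> = (\<Sum>k<2 ^ n * 2. Q (Suc n) k * ?z (z (k div 2)))" by (rule sum.nat_group)
    finally show ?thesis by (simp add: u_def mult.commute)
  qed
  have "u n z * u n z' = u n (\<lambda>k. z k + z' k)" for n z z'
  proof -
    have "u n z * u n z' = (\<Sum>k<2 ^ n. \<Sum>l<2 ^ n. (Q n k * ?z (z k)) * (Q n l * ?z (z' l)))"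
      unfolding u_def by (rule sum_product)
    also have "\<dots> = (\<Sum>k<2 ^ n. \<Sum>l<2 ^ n. if l = k then Q n k * ?z (z k + z' k) else 0)"
    proof (intro sum.cong refl)
      fix k l :: nat assume "k \<in> {..<2 ^ n}" "l \<in> {..<2 ^ n}"
      then have "Q n k * Q n l = (if k = l then Q n k else 0)" using Q(2) by simp
      moreover have "Q n k * ?z (z k) * (Q n l * ?z (z' l)) = (Q n k * Q n l) * (?z (z k) * ?z (z' l))"
        using Qz by (metis mult.assoc)
      ultimately show "Q n k * ?z (z k) * (Q n l * ?z (z' l)) = (if l = k then Q n k * ?z (z k + z' k) else 0)"
        by (auto simp: zpow_add[OF ac])
    qed
    finally show ?thesis by (simp add: u_def sum.delta)
  qed
  moreover have "u n (\<lambda>_. 0) = 1" for n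
  proof (induction n)
    case (Suc n)
    then show ?case using refine[of n "\<lambda>_. 0"] by simp
  qed (simp add: u_def Q(1) lessThan_Suc)
  moreover have "u 0 (\<lambda>_. 1) = c" by (simp add: u_def Q(1) lessThan_Suc)
  moreover have "\<rho> (u n z - u n z') \<le> C / 2 ^ n * real (card {k. k < 2 ^ n \<and> z k \<noteq> z' k})" for n z z'
  proof -
    have "u n z - u n z' = (\<Sum>k<2 ^ n. Q n k * (?z (z k) - ?z (z' k)))"
      by (simp add: u_def sum_subtractf right_diff_distrib)
    also have "\<dots> = (\<Sum>k\<in>{k. k < 2 ^ n \<and> z k \<noteq> z' k}. Q n k * (?z (z k) - ?z (z' k)))"
      by (rule sum.mono_neutral_right) auto
    finally show ?thesis
      by (simp only:) (rule rankfun_sum_set[OF \<rho>], simp,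
          meson Q(5) order_trans rankfun_subord[OF \<rho> subord_mult_right])
  qed
  ultimately have "rank_flow \<rho> c u C" unfolding rank_flow_def using refine by blast
  then show thesis by (rule that)
qed

theorem rank_function_and_flows:
  obtains \<rho> where "rankfun (\<rho> :: 'r \<Rightarrow> real)" "\<And>\<rho>'. rankfun \<rho>' \<Longrightarrow> \<rho>' = \<rho>"
    "\<And>a b. \<rho> (a + b) \<le> \<rho> a + \<rho> b"
    "(\<exists>\<epsilon>>0. \<forall>a. a \<noteq> 0 \<longrightarrow> \<epsilon> \<le> \<rho> a) \<or>
     (\<forall>a c ps. a * c = 1 \<longrightarrow> c * a = 1 \<longrightarrow> ps \<noteq> [] \<longrightarrow> hd ps \<noteq> 0 \<longrightarrow> (\<forall>p\<in>set ps. central p) \<longrightarrow>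
       leval ps c = 0 \<longrightarrow> (\<exists>u C. rank_flow \<rho> c u C))"
proof -
  obtain \<rho> where \<rho>: "rankfun (\<rho> :: 'r \<Rightarrow> real)" "\<And>\<rho>'. rankfun \<rho>' \<Longrightarrow> \<rho>' = \<rho>"
    "no_atoms \<or> (\<exists>\<epsilon>>0. \<forall>a. a \<noteq> 0 \<longrightarrow> \<epsilon> \<le> \<rho> a)" by (rule rank_function_dichotomy) blast
  show thesis
  proof (rule that[OF \<rho>(1,2) rankfun_add[OF \<rho>(1)]])
    show "(\<exists>\<epsilon>>0. \<forall>a. a \<noteq> 0 \<longrightarrow> \<epsilon> \<le> \<rho> a) \<or>
     (\<forall>a c ps. a * c = 1 \<longrightarrow> c * a = 1 \<longrightarrow> ps \<noteq> [] \<longrightarrow> hd ps \<noteq> 0 \<longrightarrow> (\<forall>p\<in>set ps. central p) \<longrightarrow>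
       leval ps c = 0 \<longrightarrow> (\<exists>u C. rank_flow \<rho> c u C))"
    proof (cases no_atoms)
      case True
      show ?thesis
      proof (intro disjI2 allI impI)
        fix a c ps assume ac: "a * c = 1" "c * a = 1" and ps: "ps \<noteq> []" "hd ps \<noteq> 0" "\<forall>p\<in>set ps. central p" "leval ps c = (0::'r)"
        obtain d where "algebraic_on c 1 d" by (rule polynomial_algebraic[OF ps])
        from rank_flow_exists[OF True \<rho>(1) ac this] show "\<exists>u C. rank_flow \<rho> c u C" by metis
      qed
    qed (use \<rho>(3) in blast)
  qed auto
qed

end

section \<open>Transfer to rings with a carrier set\<close>

definition unit_flow ::
    "('a, 'm) ring_scheme \<Rightarrow> ('a \<Rightarrow> real) \<Rightarrow> 'a \<Rightarrow> (nat \<Rightarrow> (nat \<Rightarrow> int) \<Rightarrow> 'a) \<Rightarrow> real \<Rightarrow> bool" where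
  "unit_flow R \<rho> a u C \<longleftrightarrow> (\<forall>n z. u n z \<in> carrier R) \<and>
     (\<forall>n z z'. u n z \<otimes>\<^bsub>R\<^esub> u n z' = u n (\<lambda>k. z k + z' k)) \<and>
     (\<forall>n. u n (\<lambda>_. 0) = \<one>\<^bsub>R\<^esub>) \<and> u 0 (\<lambda>_. 1) = a \<and> (\<forall>n z. u n z = u (Suc n) (\<lambda>k. z (k div 2))) \<and>
     (\<forall>n z z'. \<rho> (u n z \<ominus>\<^bsub>R\<^esub> u n z') \<le> C / 2 ^ n * real (card {k. k < 2 ^ n \<and> z k \<noteq> z' k}))"

text \<open>The conclusion to be transferred is a single predicate so that
  \<open>exceptional\<close> can negate it.\<close>

definition flow_ring :: "('a, 'm) ring_scheme \<Rightarrow> bool" where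
  "flow_ring R \<longleftrightarrow> (\<exists>\<rho>. rank_function R \<rho> \<and> (\<forall>\<rho>'. rank_function R \<rho>' \<longrightarrow> \<rho>' = \<rho>) \<and>
     (\<forall>a\<in>carrier R. \<forall>b\<in>carrier R. \<rho> (a \<oplus>\<^bsub>R\<^esub> b) \<le> \<rho> a + \<rho> b) \<and>
     ((\<exists>\<epsilon>>0. \<forall>a\<in>carrier R. a \<noteq> \<zero>\<^bsub>R\<^esub> \<longrightarrow> \<epsilon> \<le> \<rho> a) \<or>
      (\<forall>a. a \<in> Units R \<and> algebraic_over_center R a \<longrightarrow> (\<exists>u C. unit_flow R \<rho> a u C))))"

lemma image_ring_mult:
  "x \<otimes>\<^bsub>image_ring f R\<^esub> y = f (inv_into (carrier R) f x \<otimes>\<^bsub>R\<^esub> inv_into (carrier R) f y)"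
  by (simp add: image_ring_def image_group_def monoid.defs)

lemma image_ring_add:
  "x \<oplus>\<^bsub>image_ring f R\<^esub> y = f (inv_into (carrier R) f x \<oplus>\<^bsub>R\<^esub> inv_into (carrier R) f y)"
  by (simp add: image_ring_def image_group_def monoid.defs)

locale ring_model = ring R for R :: "('a, 'm) ring_scheme" (structure) +
  fixes h :: "'r::ring_1 \<Rightarrow> 'a"
  assumes h_bij: "bij_betw h UNIV (carrier R)"
    and h_mult: "h (x * y) = h x \<otimes> h y" and h_add: "h (x + y) = h x \<oplus> h y"
begin

lemma h_closed [simp]: "h x \<in> carrier R"
  using h_bij by (auto simp: bij_betw_def)

lemma h_inj: "h x = h y \<longleftrightarrow> x = y"
  using h_bij by (auto simp: bij_betw_def inj_on_def)

lemma h_surj: "a \<in> carrier R \<Longrightarrow> \<exists>x. a = h x"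
  using h_bij by (auto simp: bij_betw_def)

lemma h_zero: "h 0 = \<zero>"
proof -
  have "h 0 \<oplus> h 0 = h 0 \<oplus> \<zero>" by (simp flip: h_add)
  then show ?thesis by (simp only: add.l_cancel h_closed zero_closed)
qed

lemma h_one: "h 1 = \<one>"
proof -
  obtain x where x: "\<one> = h x" using h_surj by blast
  have "h (1 * x) = h 1" unfolding h_mult x[symmetric] by simp
  then show ?thesis using x by simp
qed

lemma h_minus: "h (- x) = \<ominus> h x"
proof -
  have "h (- x) \<oplus> h x = \<zero>" by (simp add: h_zero flip: h_add)
  then show ?thesis by (intro minus_equality[symmetric]) auto
qed

lemma h_diff: "h (x - y) = h x \<ominus> h y"
  by (simp add: a_minus_def flip: h_minus h_add)

section \<open>Transfer of the lattice, the rank function and polynomials\<close>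

abbreviation L where "L \<equiv> principal_right_ideals R"

lemma h_pri: "h ` pri x = h x <#\<^bsub>R\<^esub> carrier R"
proof -
  have "h ` pri x = {h x \<otimes> h y | y. True}" by (auto simp: pri_def simp flip: h_mult)
  also have "\<dots> = {h x \<otimes> b | b. b \<in> carrier R}" using h_surj h_closed by metis
  finally show ?thesis by (auto simp: l_coset_def)
qed

lemma L_carrier: "carrier L = range (\<lambda>x. h ` pri x)"
proof -
  have "carrier L = {a <#\<^bsub>R\<^esub> carrier R | a. a \<in> carrier R}" by (simp add: principal_right_ideals_def)
  also have "\<dots> = {h x <#\<^bsub>R\<^esub> carrier R | x. True}" using h_surj h_closed by metis
  finally show ?thesis by (auto simp: h_pri)
qed

lemma L_le: "A \<sqsubseteq>\<^bsub>L\<^esub> B \<longleftrightarrow> A \<subseteq> B"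
  by (simp add: principal_right_ideals_def)

lemma inj_h: "inj h"
  using h_inj by (simp add: inj_def)

lemma h_image_subset: "h ` A \<subseteq> h ` B \<longleftrightarrow> A \<subseteq> B"
  by (rule inj_image_subset_iff[OF inj_h])

lemma L_mem: "h ` pri x \<in> carrier L"
  unfolding L_carrier by blast

lemma L_image: "\<A> \<subseteq> range pri \<Longrightarrow> (`) h ` \<A> \<subseteq> carrier L"
  unfolding L_carrier by auto

text \<open>Under the bijection \<open>h\<close>, joins and meets of \<open>L\<close> are described
  by inclusions, which gives the continuity axioms. Indecomposability comes from irreducibility: a
  nontrivial central idempotent would split \<open>R\<close> into two corners.\<close>

lemma continuous_model:
  assumes cont: "continuous_ring R" and irr: "irreducible_ring R"
  shows "continuous_regular_ring TYPE('r)"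
proof -
  have cg: "continuous_geometry L" and reg: "regular_ring R"
    using cont by (auto simp: continuous_ring_def)
  interpret L: complete_lattice L using cg by (simp add: continuous_geometry_def)
  have up: "Z \<sqinter>\<^bsub>L\<^esub> (\<Squnion>\<^bsub>L\<^esub>\<C>) = \<Squnion>\<^bsub>L\<^esub>{Z \<sqinter>\<^bsub>L\<^esub> y | y. y \<in> \<C>}"
    and low: "Z \<squnion>\<^bsub>L\<^esub> (\<Sqinter>\<^bsub>L\<^esub>\<C>) = \<Sqinter>\<^bsub>L\<^esub>{Z \<squnion>\<^bsub>L\<^esub> y | y. y \<in> \<C>}"
    if "\<C> \<subseteq> carrier L" "\<forall>A\<in>\<C>. \<forall>B\<in>\<C>. A \<subseteq> B \<or> B \<subseteq> A" "Z \<in> carrier L" for \<C> Z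
    using cg that unfolding continuous_geometry_def L_le by blast+
  have chain: "\<forall>A\<in>(`) h ` \<C>. \<forall>B\<in>(`) h ` \<C>. A \<subseteq> B \<or> B \<subseteq> A"
    if "\<forall>A\<in>\<C>. \<forall>B\<in>\<C>. A \<subseteq> B \<or> B \<subseteq> A" for \<C>
    using that by (auto simp: h_image_subset simp del: image_subset_iff)
  have join: "\<exists>t. \<Squnion>\<^bsub>L\<^esub>((`) h ` \<A>) = h ` pri t \<and> is_join \<A> (pri t)" if A: "\<A> \<subseteq> range pri" for \<A>
  proof -
    have "\<Squnion>\<^bsub>L\<^esub>((`) h ` \<A>) \<in> carrier L" using L_image[OF A] by simp
    then obtain t where t: "\<Squnion>\<^bsub>L\<^esub>((`) h ` \<A>) = h ` pri t" unfolding L_carrier by blast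
    have "is_join \<A> (pri t)" unfolding is_join_def
    proof (intro conjI ballI impI)
      fix B assume "B \<in> \<A>"
      then have "h ` B \<subseteq> h ` pri t" using L.sup_upper[OF L_image[OF A], of "h ` B"] t L_le by auto
      then show "B \<subseteq> pri t" by (simp only: h_image_subset)
    next
      fix T assume T: "T \<in> range pri" "\<forall>B\<in>\<A>. B \<subseteq> T"
      have "\<Squnion>\<^bsub>L\<^esub>((`) h ` \<A>) \<sqsubseteq>\<^bsub>L\<^esub> h ` T"
        by (rule L.sup_least[OF L_image[OF A]]) (use T L_mem L_le in auto)
      then show "pri t \<subseteq> T" unfolding t L_le h_image_subset .
    qed simp
    then show ?thesis using t by blast
  qed
  show ?thesis
  proof
    show "\<exists>b. a * b * a = a" for a :: 'r
    proof -
      obtain b where "b \<in> carrier R" "h a \<otimes> b \<otimes> h a = h a"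
        using reg unfolding regular_ring_def by (metis h_closed)
      then obtain y where "h (a * y * a) = h a" using h_surj h_mult by metis
      then show ?thesis using h_inj by blast
    qed
    show "\<exists>S. is_join \<A> S" if "\<A> \<subseteq> range pri" for \<A> :: "'r set set" using join[OF that] by blast
  next
    fix \<C> :: "'r set set" and Z S :: "'r set"
    assume C: "\<C> \<subseteq> range pri" "\<forall>A\<in>\<C>. \<forall>B\<in>\<C>. A \<subseteq> B \<or> B \<subseteq> A" and Z: "Z \<in> range pri"
      and S: "is_join \<C> S" and disj: "\<forall>C\<in>\<C>. Z \<inter> C = {0}"
    let ?C = "(`) h ` \<C>"
    obtain t where t: "\<Squnion>\<^bsub>L\<^esub>?C = h ` pri t" "is_join \<C> (pri t)" using join[OF C(1)] by blast
    obtain s where s: "S = pri s" using S by (auto simp: is_join_def)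
    then have St: "S = pri t" using S t(2) by (intro subset_antisym) (simp_all add: is_join_def)
    have ZL: "h ` Z \<in> carrier L" using Z L_mem by blast
    note CL = L_image[OF C(1)]
    have meet0: "h ` Z \<sqinter>\<^bsub>L\<^esub> h ` C \<subseteq> h ` pri 0" if "C \<in> \<C>" for C
    proof -
      have CL': "h ` C \<in> carrier L" using that CL by blast
      have "h ` Z \<sqinter>\<^bsub>L\<^esub> h ` C \<subseteq> h ` Z" "h ` Z \<sqinter>\<^bsub>L\<^esub> h ` C \<subseteq> h ` C"
        using L.meet_left[OF ZL CL'] L.meet_right[OF ZL CL'] by (simp_all add: L_le)
      then have "h ` Z \<sqinter>\<^bsub>L\<^esub> h ` C \<subseteq> h ` (Z \<inter> C)" unfolding image_Int[OF inj_h] by simp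
      then show ?thesis using disj that by simp
    qed
    have "\<Squnion>\<^bsub>L\<^esub>{h ` Z \<sqinter>\<^bsub>L\<^esub> y | y. y \<in> ?C} \<sqsubseteq>\<^bsub>L\<^esub> h ` pri 0"
    proof (rule L.sup_least)
      show "{h ` Z \<sqinter>\<^bsub>L\<^esub> y | y. y \<in> ?C} \<subseteq> carrier L" using ZL CL by auto
      show "h ` pri 0 \<in> carrier L" by (rule L_mem)
      show "A \<sqsubseteq>\<^bsub>L\<^esub> h ` pri 0" if "A \<in> {h ` Z \<sqinter>\<^bsub>L\<^esub> y | y. y \<in> ?C}" for A
        using that meet0 unfolding L_le by blast
    qed
    then have Zt: "h ` Z \<sqinter>\<^bsub>L\<^esub> h ` pri t \<subseteq> h ` pri 0"
      using up[OF CL chain[OF C(2)] ZL] t(1) unfolding L_le by simp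
    have "z = 0" if z: "z \<in> Z" "z \<in> S" for z
    proof -
      have "pri z \<subseteq> Z" "pri z \<subseteq> pri t" using z Z St pri_subset_iff by blast+
      then have "h ` pri z \<sqsubseteq>\<^bsub>L\<^esub> h ` Z \<sqinter>\<^bsub>L\<^esub> h ` pri t"
        by (intro L.meet_le) (use ZL L_mem in \<open>auto simp: L_le\<close>)
      then have "h ` pri z \<subseteq> h ` pri 0" using Zt unfolding L_le by (rule subset_trans)
      then show ?thesis by (simp only: h_image_subset pri_subset_iff) simp
    qed
    then show "Z \<inter> S = {0}" using Z St by auto
  next
    fix \<C> :: "'r set set" and Z :: "'r set" and y :: 'r
    assume C: "\<C> \<subseteq> range pri" "\<forall>A\<in>\<C>. \<forall>B\<in>\<C>. A \<subseteq> B \<or> B \<subseteq> A" and ne: "\<C> \<noteq> {}" and Z: "Z \<in> range pri"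
      and y: "\<forall>C\<in>\<C>. \<forall>T\<in>range pri. Z \<subseteq> T \<and> C \<subseteq> T \<longrightarrow> y \<in> T"
    let ?C = "(`) h ` \<C>"
    have ZL: "h ` Z \<in> carrier L" using Z L_mem by blast
    note CL = L_image[OF C(1)]
    have "\<Sqinter>\<^bsub>L\<^esub>?C \<in> carrier L" using CL by simp
    then obtain i where i: "\<Sqinter>\<^bsub>L\<^esub>?C = h ` pri i" unfolding L_carrier by blast
    have iC: "pri i \<subseteq> C" if "C \<in> \<C>" for C
    proof -
      have "h ` pri i \<sqsubseteq>\<^bsub>L\<^esub> h ` C" unfolding i[symmetric] by (rule L.inf_lower[OF CL]) (use that in blast)
      then show ?thesis unfolding L_le h_image_subset .
    qed
    have "h ` pri y \<sqsubseteq>\<^bsub>L\<^esub> \<Sqinter>\<^bsub>L\<^esub>{h ` Z \<squnion>\<^bsub>L\<^esub> c | c. c \<in> ?C}"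
    proof (rule L.inf_greatest)
      show "{h ` Z \<squnion>\<^bsub>L\<^esub> c | c. c \<in> ?C} \<subseteq> carrier L" using ZL CL by auto
      show "h ` pri y \<in> carrier L" by (rule L_mem)
      fix A assume "A \<in> {h ` Z \<squnion>\<^bsub>L\<^esub> c | c. c \<in> ?C}"
      then obtain C where A: "C \<in> \<C>" "A = h ` Z \<squnion>\<^bsub>L\<^esub> h ` C" by blast
      have CL': "h ` C \<in> carrier L" using A CL by blast
      have "A \<in> carrier L" using A(2) ZL CL' by simp
      then obtain t where t: "A = h ` pri t" unfolding L_carrier by blast
      have "h ` Z \<sqsubseteq>\<^bsub>L\<^esub> A" "h ` C \<sqsubseteq>\<^bsub>L\<^esub> A"
        unfolding A(2) by (rule L.join_left[OF ZL CL'], rule L.join_right[OF ZL CL'])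
      then have "Z \<subseteq> pri t" "C \<subseteq> pri t" unfolding t L_le h_image_subset by blast+
      then have "pri y \<subseteq> pri t" using y A(1) pri_subset_iff by blast
      then show "h ` pri y \<sqsubseteq>\<^bsub>L\<^esub> A" unfolding t L_le h_image_subset .
    qed
    then have le: "h ` pri y \<sqsubseteq>\<^bsub>L\<^esub> h ` Z \<squnion>\<^bsub>L\<^esub> h ` pri i"
      using low[OF CL chain[OF C(2)] ZL] i by simp
    have "y \<in> T" if T: "T \<in> range pri" "Z \<subseteq> T" "pri i \<subseteq> T" for T
    proof -
      have TL: "h ` T \<in> carrier L" using T L_mem by blast
      have "h ` Z \<squnion>\<^bsub>L\<^esub> h ` pri i \<sqsubseteq>\<^bsub>L\<^esub> h ` T"
        by (rule L.join_le[OF _ _ ZL L_mem TL]) (use T in \<open>auto simp: L_le\<close>)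
      then have "h ` pri y \<subseteq> h ` T" using le unfolding L_le by blast
      then show ?thesis unfolding h_image_subset using pri_self by blast
    qed
    then show "\<exists>I\<in>range pri. (\<forall>C\<in>\<C>. I \<subseteq> C) \<and> (\<forall>T\<in>range pri. Z \<subseteq> T \<and> I \<subseteq> T \<longrightarrow> y \<in> T)"
      using iC by (intro bexI[of _ "pri i"]) auto
  next
    fix e :: 'r assume ee: "e * e = e" and comm: "\<forall>x. e * x = x * e"
    show "e = 0 \<or> e = 1"
    proof (rule ccontr)
      assume neg: "\<not> ?thesis"
      define corner :: "'r \<Rightarrow> 'r ring" where
        "corner f = \<lparr>carrier = {x. f * x = x}, monoid.mult = (*), one = f, ring.zero = 0, ring.add = (+)\<rparr>" for f
      have ring: "ring (corner f)" if f: "f * f = f" "\<And>x. f * x = x * f" for f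
      proof (rule ringI)
        have 1: "f * (x * y) = x * y" if "f * x = x" for x y using that by (metis mult.assoc)
        have neg: "\<exists>y. f * y = y \<and> x + y = 0" if "f * x = x" for x
          using that by (intro exI[of _ "- x"]) simp
        show "abelian_group (corner f)"
          by (rule abelian_groupI) (auto simp: corner_def algebra_simps neg)
        show "Group.monoid (corner f)"
          by (rule monoidI) (auto simp: corner_def mult.assoc 1 f(1), use f(2) in metis)
      qed (auto simp: corner_def algebra_simps)
      define k where "k = inv_into UNIV h"
      have kh: "k (h x) = x" for x unfolding k_def using h_inj by (simp add: inj_def)
      have hk: "h (k a) = a" if "a \<in> carrier R" for a using h_surj[OF that] kh by auto
      have f1: "(1 - e) * (1 - e) = 1 - e" by (simp add: algebra_simps ee)
      have f2: "(1 - e) * x = x * (1 - e)" for x using spec[OF comm, of x] by (simp add: algebra_simps)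
      have e2: "e * x = x * e" for x using comm by blast
      note f = f1 f2 and e = ee e2
      let ?S = "corner e" and ?T = "corner (1 - e)"
      have "(\<lambda>a. (e * k a, (1 - e) * k a)) \<in> ring_iso R (RDirProd ?S ?T)"
      proof -
        have kmult: "k (a \<otimes> b) = k a * k b" if "a \<in> carrier R" "b \<in> carrier R" for a b
          using that h_surj kh h_mult by metis
        have kadd: "k (a \<oplus> b) = k a + k b" if "a \<in> carrier R" "b \<in> carrier R" for a b
          using that h_surj kh h_add by metis
        have k1: "k \<one> = 1" using kh[of 1] h_one by simp
        have hom: "f * (x * y) = (f * x) * (f * y)" if "f * f = f" "\<And>x. f * x = x * f" for f x y :: 'r
          using that by (metis mult.assoc)
        have 1: "(\<lambda>a. (e * k a, (1 - e) * k a)) \<in> ring_hom R (RDirProd ?S ?T)"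
        proof (rule ring_hom_memI)
          fix a assume a: "a \<in> carrier R"
          have "e * (e * k a) = e * k a" "(1 - e) * ((1 - e) * k a) = (1 - e) * k a"
            using ee f(1) by (metis mult.assoc)+
          then show "(e * k a, (1 - e) * k a) \<in> carrier (RDirProd ?S ?T)"
            by (simp add: RDirProd_carrier corner_def)
          fix b assume b: "b \<in> carrier R"
          show "(e * k (a \<otimes> b), (1 - e) * k (a \<otimes> b)) =
              (e * k a, (1 - e) * k a) \<otimes>\<^bsub>RDirProd ?S ?T\<^esub> (e * k b, (1 - e) * k b)"
            using hom[OF e] hom[OF f] by (simp add: kmult[OF a b] RDirProd_def DirProd_def monoid.defs corner_def)
          show "(e * k (a \<oplus> b), (1 - e) * k (a \<oplus> b)) =
              (e * k a, (1 - e) * k a) \<oplus>\<^bsub>RDirProd ?S ?T\<^esub> (e * k b, (1 - e) * k b)"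
            by (simp add: kadd[OF a b] RDirProd_def DirProd_def monoid.defs corner_def distrib_left)
        next
          show "(e * k \<one>, (1 - e) * k \<one>) = \<one>\<^bsub>RDirProd ?S ?T\<^esub>"
            by (simp add: k1 RDirProd_def DirProd_def monoid.defs corner_def)
        qed
        moreover have "bij_betw (\<lambda>a. (e * k a, (1 - e) * k a)) (carrier R) (carrier (RDirProd ?S ?T))"
        proof (rule bij_betwI[where g = "\<lambda>(x, y). h (x + y)"])
          show "(\<lambda>a. (e * k a, (1 - e) * k a)) \<in> carrier R \<rightarrow> carrier (RDirProd ?S ?T)"
            using 1 by (auto simp: ring_hom_def)
          show "(\<lambda>(x, y). h (x + y)) \<in> carrier (RDirProd ?S ?T) \<rightarrow> carrier R" by auto
          show "(\<lambda>(x, y). h (x + y)) (e * k a, (1 - e) * k a) = a" if "a \<in> carrier R" for a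
            using hk[OF that] by (simp add: algebra_simps)
          show "(e * k ((\<lambda>(x, y). h (x + y)) q), (1 - e) * k ((\<lambda>(x, y). h (x + y)) q)) = q"
            if q: "q \<in> carrier (RDirProd ?S ?T)" for q
          proof -
            obtain x y where xy: "q = (x, y)" "e * x = x" "(1 - e) * y = y"
              using q by (auto simp: RDirProd_carrier corner_def)
            have "e * y = 0" using xy(3) by (simp add: algebra_simps)
            then show ?thesis using xy by (simp add: kh algebra_simps)
          qed
        qed
        ultimately show ?thesis by (simp add: ring_iso_def)
      qed
      then have "R \<simeq> RDirProd ?S ?T" by (auto simp: is_ring_iso_def)
      moreover have "carrier ?S \<noteq> {\<zero>\<^bsub>?S\<^esub>}" "carrier ?T \<noteq> {\<zero>\<^bsub>?T\<^esub>}"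
      proof -
        have "e \<in> carrier ?S" "1 - e \<in> carrier ?T" by (simp_all add: corner_def ee f1)
        moreover have "e \<noteq> \<zero>\<^bsub>?S\<^esub>" "1 - e \<noteq> \<zero>\<^bsub>?T\<^esub>" using neg by (auto simp: corner_def)
        ultimately show "carrier ?S \<noteq> {\<zero>\<^bsub>?S\<^esub>}" "carrier ?T \<noteq> {\<zero>\<^bsub>?T\<^esub>}" by auto
      qed
      ultimately show False using irreducible_ringD[OF irr ring[OF e] _ ring[OF f]] by blast
    qed
  qed
qed

lemma rank_function_model: "rank_function R rk \<Longrightarrow> rankfun (\<lambda>x. rk (h x))"
  unfolding rankfun_def
proof (intro conjI allI impI)
  assume rk: "rank_function R rk"
  show "0 \<le> rk (h a)" "rk (h a) \<le> 1" for a
    using rk h_closed[of a] unfolding rank_function_def by (auto simp: PiE_def Pi_def)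
  show "rk (h 1) = 1" using rk by (simp add: h_one rank_function_def)
  show "rk (h (a * b)) \<le> rk (h a)" "rk (h (a * b)) \<le> rk (h b)" for a b
    using rk unfolding h_mult rank_function_def by (metis h_closed min.boundedE)+
  show "rk (h (e + f)) = rk (h e) + rk (h f)" if "idem e \<and> idem f \<and> e * f = 0 \<and> f * e = 0" for e f
  proof -
    have "h e \<otimes> h e = h e" "h f \<otimes> h f = h f" "h e \<otimes> h f = \<zero>" "h f \<otimes> h e = \<zero>"
      using that by (simp_all add: idem_def h_zero flip: h_mult)
    then show ?thesis using rk unfolding h_add rank_function_def by simp
  qed
  show "0 < rk (h a)" if "a \<noteq> 0" for a
  proof -
    have "h a \<noteq> \<zero>" using that h_inj h_zero by metis
    then show ?thesis using rk by (simp add: rank_function_def)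
  qed
qed

lemma rankfun_model:
  assumes \<rho>: "rankfun \<rho>"
  shows "rank_function R (\<lambda>a\<in>carrier R. \<rho> (inv_into UNIV h a))"
proof -
  define k where "k = inv_into UNIV h"
  have kh: "k (h x) = x" for x unfolding k_def using h_inj by (simp add: inj_def)
  note \<rho>' = \<rho>[unfolded rankfun_def]
  have "rank_function R (\<lambda>a\<in>carrier R. \<rho> (k a))"
    unfolding rank_function_def
  proof (intro conjI ballI impI)
    show "(\<lambda>a\<in>carrier R. \<rho> (k a)) \<in> carrier R \<rightarrow>\<^sub>E {0..1}" using \<rho>' by auto
    show "(\<lambda>a\<in>carrier R. \<rho> (k a)) \<one> = 1" using \<rho>' kh[of 1] by (simp add: h_one)
    fix a b assume ab: "a \<in> carrier R" "b \<in> carrier R"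
    then obtain x y where xy: "a = h x" "b = h y" using h_surj by blast
    show "(\<lambda>a\<in>carrier R. \<rho> (k a)) (a \<otimes> b) \<le> min ((\<lambda>a\<in>carrier R. \<rho> (k a)) a) ((\<lambda>a\<in>carrier R. \<rho> (k a)) b)"
      using \<rho>' by (simp add: xy kh flip: h_mult)
    assume orth: "a \<otimes> a = a \<and> b \<otimes> b = b \<and> a \<otimes> b = \<zero> \<and> b \<otimes> a = \<zero>"
    then have "idem x" "idem y" "x * y = 0" "y * x = 0"
      by (simp_all add: xy idem_def h_inj flip: h_mult h_zero)
    then show "(\<lambda>a\<in>carrier R. \<rho> (k a)) (a \<oplus> b) = (\<lambda>a\<in>carrier R. \<rho> (k a)) a + (\<lambda>a\<in>carrier R. \<rho> (k a)) b"
      using \<rho>' by (simp add: xy kh flip: h_add)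
  next
    fix a assume a: "a \<in> carrier R" "a \<noteq> \<zero>"
    then obtain x where x: "a = h x" using h_surj by blast
    then have "x \<noteq> 0" using a h_zero by auto
    then show "0 < (\<lambda>a\<in>carrier R. \<rho> (k a)) a" using \<rho>' by (simp add: x kh)
  qed
  then show ?thesis by (simp only: k_def)
qed

lemma h_power: "h (x ^ n) = h x [^] n"
  by (induction n) (simp_all add: h_one h_mult power_Suc2 del: power_Suc)

lemma eval_model: "eval (map h ps) (h x) = h (leval ps x)"
  by (induction ps) (simp_all add: h_zero h_add h_mult h_power)

lemma flow_model:
  assumes cont: "continuous_ring R" and irr: "irreducible_ring R"
  shows "flow_ring R"
proof -
  interpret C: continuous_regular_ring "TYPE('r)" by (rule continuous_model[OF cont irr])
  obtain \<rho> where \<rho>: "rankfun (\<rho> :: 'r \<Rightarrow> real)" "\<And>\<rho>'. rankfun \<rho>' \<Longrightarrow> \<rho>' = \<rho>"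
    "\<And>a b. \<rho> (a + b) \<le> \<rho> a + \<rho> b"
    "(\<exists>\<epsilon>>0. \<forall>a. a \<noteq> 0 \<longrightarrow> \<epsilon> \<le> \<rho> a) \<or>
     (\<forall>a c ps. a * c = 1 \<longrightarrow> c * a = 1 \<longrightarrow> ps \<noteq> [] \<longrightarrow> hd ps \<noteq> 0 \<longrightarrow> (\<forall>p\<in>set ps. central p) \<longrightarrow>
       leval ps c = 0 \<longrightarrow> (\<exists>u C. rank_flow \<rho> c u C))"
    by (rule C.rank_function_and_flows) (rule that; assumption)
  define rk where "rk = (\<lambda>a\<in>carrier R. \<rho> (inv_into UNIV h a))"
  have rk_h: "rk (h x) = \<rho> x" for x unfolding rk_def using h_inj by (simp add: inj_def)
  have rk: "rank_function R rk" unfolding rk_def by (rule rankfun_model[OF \<rho>(1)])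
  have uniq: "rk' = rk" if s: "rank_function R rk'" for rk'
  proof
    fix a
    show "rk' a = rk a"
    proof (cases "a \<in> carrier R")
      case True
      then obtain x where "a = h x" using h_surj by blast
      moreover have "(\<lambda>x. rk' (h x)) = \<rho>" by (rule \<rho>(2)[OF rank_function_model[OF s]])
      ultimately show ?thesis using rk_h by metis
    next
      case False
      then show ?thesis using s rk unfolding rank_function_def by (auto simp: PiE_def extensional_def)
    qed
  qed
  have add: "rk (a \<oplus> b) \<le> rk a + rk b" if "a \<in> carrier R" "b \<in> carrier R" for a b
    using that h_surj \<rho>(3) rk_h h_add by metis
  have "(\<exists>\<epsilon>>0. \<forall>a\<in>carrier R. a \<noteq> \<zero> \<longrightarrow> \<epsilon> \<le> rk a) \<or>
      (\<forall>a. a \<in> Units R \<and> algebraic_over_center R a \<longrightarrow> (\<exists>u C. unit_flow R rk a u C))"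
  proof (cases "\<exists>\<epsilon>>0. \<forall>a. a \<noteq> 0 \<longrightarrow> \<epsilon> \<le> \<rho> a")
    case True
    then show ?thesis using h_surj rk_h h_zero by metis
  next
    case False
    then have flow: "\<And>a c ps. a * c = 1 \<Longrightarrow> c * a = 1 \<Longrightarrow> ps \<noteq> [] \<Longrightarrow> hd ps \<noteq> 0 \<Longrightarrow> (\<forall>p\<in>set ps. central p) \<Longrightarrow>
       leval ps c = 0 \<Longrightarrow> (\<exists>u C. rank_flow \<rho> c u C)" using \<rho>(4) by blast
    show ?thesis
    proof (intro disjI2 allI impI, elim conjE)
      fix a assume a: "a \<in> Units R" "algebraic_over_center R a"
      then obtain b where b: "a \<in> carrier R" "b \<in> carrier R" "b \<otimes> a = \<one>" "a \<otimes> b = \<one>"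
        unfolding Units_def by blast
      obtain c c' where c: "a = h c" "b = h c'" using b h_surj by metis
      have inv: "c' * c = 1" "c * c' = 1" using b(3,4) unfolding c by (simp_all add: h_inj flip: h_mult h_one)
      obtain q where q: "q \<in> carrier (univ_poly R (ring_center R))" "q \<noteq> []" "eval q a = \<zero>"
        using a(2) unfolding algebraic_over_center_def by (auto simp: univ_poly_def)
      have q': "set q \<subseteq> ring_center R" "hd q \<noteq> \<zero>"
        using q(1,2) unfolding univ_poly_carrier[symmetric] polynomial_def by auto
      define ps where "ps = map (inv_into UNIV h) q"
      have qps: "q = map h ps"
      proof -
        have "h (inv_into UNIV h x) = x" if "x \<in> set q" for x
        proof -
          have "x \<in> carrier R" using that q'(1) by (auto simp: ring_center_def)
          then show ?thesis using h_bij by (simp add: bij_betw_def f_inv_into_f)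
        qed
        then show ?thesis by (simp add: ps_def map_idI)
      qed
      have "central p" if "p \<in> set ps" for p
      proof -
        have "h p \<in> ring_center R" using that q'(1) qps by auto
        then have "h p \<otimes> h x = h x \<otimes> h p" for x by (simp add: ring_center_def)
        then show ?thesis unfolding central_def by (metis h_mult h_inj)
      qed
      moreover have "ps \<noteq> []" using q(2) qps by simp
      moreover have "hd ps \<noteq> 0" using q'(2) qps \<open>ps \<noteq> []\<close> by (auto simp: hd_map h_zero)
      moreover have "leval ps c = 0"
      proof -
        have "h (leval ps c) = h 0" using q(3) unfolding qps c eval_model h_zero .
        then show ?thesis by (simp only: h_inj)
      qed
      ultimately obtain u C where u: "rank_flow \<rho> c u C" using flow[OF inv] by blast
      have "unit_flow R rk a (\<lambda>n z. h (u n z)) C"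
        using u unfolding unit_flow_def rank_flow_def
        by (simp add: c rk_h flip: h_mult h_one h_diff)
      then show "\<exists>u C. unit_flow R rk a u C" by blast
    qed
  qed
  then show ?thesis unfolding flow_ring_def using rk uniq add by blast
qed

end

text \<open>
  Type classes are not available for a ring given by a carrier set.  The carrier of a hypothetical
  counterexample is therefore turned into a type; without counterexamples, the integers serve as a
  placeholder.
\<close>

definition exceptional :: "('a, 'm) ring_scheme \<Rightarrow> bool" where
  "exceptional R \<longleftrightarrow> continuous_ring R \<and> irreducible_ring R \<and> \<not> flow_ring R"

definition model_ring :: "('a, 'm) ring_scheme itself \<Rightarrow> ('a + int) ring" where
  "model_ring _ = (if \<exists>R :: ('a, 'm) ring_scheme. exceptional R
     then image_ring Inl (SOME R :: ('a, 'm) ring_scheme. exceptional R) else image_ring Inr \<Z>)"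

text \<open>The class \<open>ring_1\<close> requires \<open>0 \<noteq> 1\<close>; irreducible rings
  are nonzero and the placeholder is nontrivial.\<close>

lemma model_ring:
  "ring (model_ring TYPE(('a, 'm) ring_scheme))" (is "ring ?W")
  "\<one>\<^bsub>model_ring TYPE(('a, 'm) ring_scheme)\<^esub> \<noteq> \<zero>\<^bsub>model_ring TYPE(('a, 'm) ring_scheme)\<^esub>"
proof -
  have "ring ?W \<and> \<one>\<^bsub>?W\<^esub> \<noteq> \<zero>\<^bsub>?W\<^esub>"
  proof (cases "\<exists>R :: ('a, 'm) ring_scheme. exceptional R")
    case True
    define R where "R = (SOME R :: ('a, 'm) ring_scheme. exceptional R)"
    have W: "?W = image_ring Inl R" using True by (simp add: model_ring_def R_def)
    have "exceptional R" unfolding R_def by (rule someI_ex[OF True])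
    then have irr: "irreducible_ring R" by (simp add: exceptional_def)
    then interpret R: ring R by (simp add: irreducible_ring_def)
    have "\<one>\<^bsub>R\<^esub> \<noteq> \<zero>\<^bsub>R\<^esub>" using irr R.one_zeroD by (auto simp: irreducible_ring_def)
    then show ?thesis unfolding W using R.inj_imp_image_ring_is_ring[of Inl]
      by (simp add: image_ring_one image_ring_zero)
  next
    case False
    have W: "?W = image_ring Inr \<Z>" using False by (simp add: model_ring_def)
    have "ring \<Z>" using int_is_cring by (simp add: cring_def)
    then show ?thesis unfolding W using ring.inj_imp_image_ring_is_ring[of \<Z> Inr]
      by (simp add: image_ring_one image_ring_zero)
  qed
  then show "ring ?W" "\<one>\<^bsub>?W\<^esub> \<noteq> \<zero>\<^bsub>?W\<^esub>" by auto
qed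

typedef (overloaded) ('a, 'm) model = "carrier (model_ring TYPE(('a, 'm) ring_scheme))"
  using ring.ring_simprules(6)[OF model_ring(1)] by blast

instantiation model :: (type, type) ring_1
begin

definition zero_model :: "('a, 'b) model" where
  "0 = Abs_model \<zero>\<^bsub>model_ring TYPE(('a, 'b) ring_scheme)\<^esub>"
definition one_model :: "('a, 'b) model" where
  "1 = Abs_model \<one>\<^bsub>model_ring TYPE(('a, 'b) ring_scheme)\<^esub>"
definition plus_model :: "('a, 'b) model \<Rightarrow> ('a, 'b) model \<Rightarrow> ('a, 'b) model" where
  "x + y = Abs_model (Rep_model x \<oplus>\<^bsub>model_ring TYPE(('a, 'b) ring_scheme)\<^esub> Rep_model y)"
definition times_model :: "('a, 'b) model \<Rightarrow> ('a, 'b) model \<Rightarrow> ('a, 'b) model" where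
  "x * y = Abs_model (Rep_model x \<otimes>\<^bsub>model_ring TYPE(('a, 'b) ring_scheme)\<^esub> Rep_model y)"
definition uminus_model :: "('a, 'b) model \<Rightarrow> ('a, 'b) model" where
  "- x = Abs_model (\<ominus>\<^bsub>model_ring TYPE(('a, 'b) ring_scheme)\<^esub> Rep_model x)"
definition minus_model :: "('a, 'b) model \<Rightarrow> ('a, 'b) model \<Rightarrow> ('a, 'b) model" where
  "x - y = x + - (y :: ('a, 'b) model)"

instance
proof
  interpret W: ring "model_ring TYPE(('a, 'b) ring_scheme)" by (rule model_ring)
  fix x y z :: "('a, 'b) model"
  note defs = plus_model_def times_model_def zero_model_def one_model_def uminus_model_def
  note [simp] = Rep_model Abs_model_inverse Rep_model_inverse
  show "x + y + z = x + (y + z)" by (simp add: defs W.a_assoc)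
  show "x + y = y + x" by (simp add: defs W.a_comm)
  show "0 + x = x" by (simp add: defs)
  show "- x + x = 0" by (simp add: defs W.l_neg)
  show "x - y = x + - y" by (rule minus_model_def)
  show "x * y * z = x * (y * z)" by (simp add: defs W.m_assoc)
  show "1 * x = x" "x * 1 = x" by (simp_all add: defs)
  show "(x + y) * z = x * z + y * z" by (simp add: defs W.l_distr)
  show "x * (y + z) = x * y + x * z" by (simp add: defs W.r_distr)
  show "(0::('a, 'b) model) \<noteq> 1"
    using model_ring(2)[where 'a = 'a and 'm = 'b] by (auto simp: defs Abs_model_inject)
qed

end

text \<open>The type \<open>model\<close> copies one chosen counterexample \<open>R0\<close>, which
  may differ from the given \<open>R\<close>. Any counterexample suffices, because
  \<open>flow_model\<close> refutes \<open>R0\<close>.\<close>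

theorem continuous_irreducible_flow_ring:
  fixes R :: "('a, 'm) ring_scheme"
  assumes "continuous_ring R" "irreducible_ring R"
  shows "flow_ring R"
proof (rule ccontr)
  assume "\<not> flow_ring R"
  then have ex: "\<exists>R :: ('a, 'm) ring_scheme. exceptional R" using assms by (auto simp: exceptional_def)
  define R0 where "R0 = (SOME R :: ('a, 'm) ring_scheme. exceptional R)"
  have R0: "continuous_ring R0" "irreducible_ring R0" "\<not> flow_ring R0"
    using someI_ex[OF ex] by (auto simp: R0_def exceptional_def)
  interpret R: ring R0 using R0 by (simp add: irreducible_ring_def)
  have W: "model_ring TYPE(('a, 'm) ring_scheme) = image_ring Inl R0"
    using ex by (simp add: model_ring_def R0_def)
  define k :: "'a \<Rightarrow> ('a, 'm) model" where "k a = Abs_model (Inl a)" for a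
  define h :: "('a, 'm) model \<Rightarrow> 'a" where "h x = projl (Rep_model x)" for x
  have cW: "carrier (image_ring Inl R0) = Inl ` carrier R0" by (rule image_ring_carrier)
  have rep: "\<exists>a\<in>carrier R0. Rep_model x = Inl a" for x :: "('a, 'm) model"
    using Rep_model[of x] unfolding W cW by blast
  have inv: "inv_into (carrier R0) Inl (Inl a) = a" if "a \<in> carrier R0" for a
    using that by (simp add: inv_into_f_f)
  have "ring_model R0 h"
  proof
    show "bij_betw h UNIV (carrier R0)"
    proof (rule bij_betwI[where g = k])
      show "h \<in> UNIV \<rightarrow> carrier R0"
      proof (rule funcsetI)
        fix x :: "('a, 'm) model"
        obtain a where "a \<in> carrier R0" "Rep_model x = Inl a" using rep by blast
        then show "h x \<in> carrier R0" by (simp add: h_def)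
      qed
      show "k (h x) = x" for x
      proof -
        obtain a where "Rep_model x = Inl a" using rep by blast
        then show ?thesis by (metis Rep_model_inverse h_def k_def sum.sel(1))
      qed
      show "h (k a) = a" if "a \<in> carrier R0" for a
        using that by (simp add: h_def k_def Abs_model_inverse W cW)
    qed simp
    fix x y :: "('a, 'm) model"
    obtain a b where ab: "a \<in> carrier R0" "b \<in> carrier R0" "Rep_model x = Inl a" "Rep_model y = Inl b"
      using rep by blast
    show "h (x * y) = h x \<otimes>\<^bsub>R0\<^esub> h y"
      using ab by (simp add: h_def times_model_def W Abs_model_inverse cW image_ring_mult inv)
    show "h (x + y) = h x \<oplus>\<^bsub>R0\<^esub> h y"
      using ab by (simp add: h_def plus_model_def W Abs_model_inverse cW image_ring_add inv)
  qed
  then have "flow_ring R0" by (rule ring_model.flow_model) (rule R0)+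
  then show False using R0 by blast
qed

section \<open>Concentration of measure\<close>

definition words :: "'b set \<Rightarrow> nat \<Rightarrow> 'b list set" where
  "words S K = {xs. set xs \<subseteq> S \<and> length xs = K}"

definition ham :: "'b list \<Rightarrow> 'b list \<Rightarrow> nat" where
  "ham xs ys = card {i. i < length xs \<and> xs ! i \<noteq> ys ! i}"

lemma finite_words: "finite S \<Longrightarrow> finite (words S K)"
  unfolding words_def by (rule finite_lists_length_eq)

lemma card_words: "finite S \<Longrightarrow> card (words S K) = card S ^ K"
  unfolding words_def by (rule card_lists_length_eq)

lemma sum_words_Suc:
  assumes "finite S"
  shows "(\<Sum>xs\<in>words S (Suc K). f xs) = (\<Sum>x\<in>S. \<Sum>ys\<in>words S K. (f (x # ys) :: real))"
proof -
  have "bij_betw (\<lambda>(x, ys). x # ys) (S \<times> words S K) (words S (Suc K))"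
  proof (rule bij_betw_imageI)
    show "inj_on (\<lambda>(x, ys). x # ys) (S \<times> words S K)" by (auto simp: inj_on_def)
    show "(\<lambda>(x, ys). x # ys) ` (S \<times> words S K) = words S (Suc K)"
    proof
      show "words S (Suc K) \<subseteq> (\<lambda>(x, ys). x # ys) ` (S \<times> words S K)"
      proof
        fix xs assume "xs \<in> words S (Suc K)"
        then obtain x ys where "xs = x # ys" "x \<in> S" "ys \<in> words S K"
          by (cases xs) (auto simp: words_def)
        then show "xs \<in> (\<lambda>(x, ys). x # ys) ` (S \<times> words S K)" by auto
      qed
    qed (auto simp: words_def)
  qed
  then have "(\<Sum>p\<in>S \<times> words S K. f ((\<lambda>(x, ys). x # ys) p)) = (\<Sum>xs\<in>words S (Suc K). f xs)"
    by (rule sum.reindex_bij_betw)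
  moreover have "(\<Sum>p\<in>S \<times> words S K. f ((\<lambda>(x, ys). x # ys) p)) = (\<Sum>x\<in>S. \<Sum>ys\<in>words S K. f (x # ys))"
    by (simp add: sum.cartesian_product case_prod_beta)
  ultimately show ?thesis by simp
qed

text \<open>The cross term vanishes because deviations from the mean add up to zero.\<close>

lemma sum_square_shift:
  fixes f :: "'b \<Rightarrow> real"
  assumes "finite A" "A \<noteq> {}"
  shows "(\<Sum>x\<in>A. (f x - \<mu>)\<^sup>2) = (\<Sum>x\<in>A. (f x - sum f A / card A)\<^sup>2) + card A * (sum f A / card A - \<mu>)\<^sup>2"
proof -
  define m where "m = sum f A / card A"
  have m: "sum f A = m * card A" using assms by (simp add: m_def)
  have "(f x - \<mu>)\<^sup>2 = (f x - m)\<^sup>2 + (2 * (m - \<mu>) * (f x - m) + (m - \<mu>)\<^sup>2)" for x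
    by (simp add: power2_eq_square algebra_simps)
  then have "(\<Sum>x\<in>A. (f x - \<mu>)\<^sup>2) = (\<Sum>x\<in>A. (f x - m)\<^sup>2) + (2 * (m - \<mu>) * (\<Sum>x\<in>A. f x - m) + card A * (m - \<mu>)\<^sup>2)"
    by (simp add: sum.distrib sum_distrib_left)
  moreover have "(\<Sum>x\<in>A. f x - m) = 0" by (simp add: sum_subtractf m)
  ultimately show ?thesis by (simp add: m_def)
qed

text \<open>Conditioning on the first letter splits the variance into the conditional variances,
  bounded by induction, and the variance of the conditional means, which differ by at most
  \<open>c\<close>.\<close>

lemma efron_stein_bounded_differences:
  fixes f :: "'b list \<Rightarrow> real" and c :: real
  assumes S: "finite S" "S \<noteq> {}"
    and lip: "\<And>xs i s. xs \<in> words S K \<Longrightarrow> i < K \<Longrightarrow> s \<in> S \<Longrightarrow> \<bar>f (xs[i := s]) - f xs\<bar> \<le> c"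
  shows "(\<Sum>xs\<in>words S K. (f xs - (\<Sum>xs\<in>words S K. f xs) / card S ^ K)\<^sup>2) \<le> K * c\<^sup>2 * card S ^ K"
  using lip
proof (induction K arbitrary: f)
  case 0
  have "words S 0 = {[]}" by (auto simp: words_def)
  then show ?case by simp
next
  case (Suc K)
  define M where "M = real (card S ^ K)"
  have cS: "0 < card S" using S by (simp add: card_gt_0_iff)
  then have M: "0 < M" by (simp add: M_def)
  have fin: "finite (words S K)" and cW: "card (words S K) = card S ^ K"
    using S(1) by (simp_all add: finite_words card_words)
  have ne: "words S K \<noteq> {}" using cW cS by auto
  define m where "m x = (\<Sum>ys\<in>words S K. f (x # ys)) / M" for x
  define \<mu> where "\<mu> = (\<Sum>x\<in>S. m x) / card S"
  have \<mu>: "(\<Sum>xs\<in>words S (Suc K). f xs) / card S ^ Suc K = \<mu>"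
    using cS M by (simp add: sum_words_Suc[OF S(1)] \<mu>_def m_def M_def sum_divide_distrib[symmetric])
  have inner: "(\<Sum>ys\<in>words S K. (f (x # ys) - \<mu>)\<^sup>2) \<le> K * c\<^sup>2 * M + M * c\<^sup>2" if x: "x \<in> S" for x
  proof -
    have "(\<Sum>ys\<in>words S K. (f (x # ys) - m x)\<^sup>2) \<le> K * c\<^sup>2 * M"
    proof -
      have "(\<Sum>ys\<in>words S K. (f (x # ys) - (\<Sum>ys\<in>words S K. f (x # ys)) / card S ^ K)\<^sup>2) \<le> K * c\<^sup>2 * card S ^ K"
      proof (rule Suc.IH)
        fix xs i s assume a: "xs \<in> words S K" "i < K" "s \<in> S"
        have "\<bar>f ((x # xs)[Suc i := s]) - f (x # xs)\<bar> \<le> c"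
          by (rule Suc.prems) (use a x in \<open>auto simp: words_def\<close>)
        then show "\<bar>f (x # xs[i := s]) - f (x # xs)\<bar> \<le> c" by simp
      qed
      then show ?thesis by (simp add: m_def M_def)
    qed
    moreover have "(m x - \<mu>)\<^sup>2 \<le> c\<^sup>2"
    proof -
      have d: "\<bar>m x - m y\<bar> \<le> c" if y: "y \<in> S" for y
      proof -
        have "\<bar>\<Sum>ys\<in>words S K. f (x # ys) - f (y # ys)\<bar> \<le> (\<Sum>ys\<in>words S K. c)"
        proof (rule order_trans[OF sum_abs sum_mono])
          fix ys assume "ys \<in> words S K"
          then have "\<bar>f ((y # ys)[0 := x]) - f (y # ys)\<bar> \<le> c"
            by (intro Suc.prems) (use x y in \<open>auto simp: words_def\<close>)
          then show "\<bar>f (x # ys) - f (y # ys)\<bar> \<le> c" by simp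
        qed
        also have "\<dots> = M * c" by (simp add: cW M_def)
        finally have "\<bar>(m x - m y) * M\<bar> \<le> M * c"
          using M by (simp add: m_def left_diff_distrib sum_subtractf)
        then show ?thesis using M by (simp add: abs_mult mult.commute)
      qed
      have "\<bar>\<Sum>y\<in>S. m x - m y\<bar> \<le> (\<Sum>y\<in>S. c)" by (rule order_trans[OF sum_abs sum_mono]) (rule d)
      moreover have "(\<Sum>y\<in>S. m x - m y) = (m x - \<mu>) * card S" using cS by (simp add: \<mu>_def sum_subtractf algebra_simps)
      ultimately have "\<bar>m x - \<mu>\<bar> \<le> c" using cS by (simp add: abs_mult mult.commute)
      then show ?thesis by (metis abs_ge_zero order_trans power2_abs power_mono)
    qed
    then have "M * (m x - \<mu>)\<^sup>2 \<le> M * c\<^sup>2" using M by simp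
    ultimately show ?thesis
      using sum_square_shift[OF fin ne, of "\<lambda>ys. f (x # ys)" \<mu>] by (simp add: m_def M_def cW)
  qed
  have "(\<Sum>xs\<in>words S (Suc K). (f xs - \<mu>)\<^sup>2) = (\<Sum>x\<in>S. \<Sum>ys\<in>words S K. (f (x # ys) - \<mu>)\<^sup>2)"
    by (rule sum_words_Suc[OF S(1)])
  also have "\<dots> \<le> (\<Sum>x\<in>S. K * c\<^sup>2 * M + M * c\<^sup>2)" by (rule sum_mono) (rule inner)
  also have "\<dots> = Suc K * c\<^sup>2 * card S ^ Suc K" by (simp add: M_def algebra_simps)
  finally show ?case unfolding \<mu> .
qed

text \<open>
  A function that is merely uniformly continuous is replaced by the Lipschitz function
  \<open>xs \<mapsto> min\<^sub>y (F y + ham xs y / (\<delta> K))\<close>, to which Chebyshev's inequality applies.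
\<close>

lemma concentration:
  fixes F :: "'b list \<Rightarrow> real"
  assumes S: "finite S" "S \<noteq> {}" and K: "0 < K" and \<delta>: "0 < \<delta>" and \<eta>: "0 < \<eta>"
    and F01: "\<And>xs. xs \<in> words S K \<Longrightarrow> 0 \<le> F xs \<and> F xs \<le> 1"
    and Funif: "\<And>xs ys. xs \<in> words S K \<Longrightarrow> ys \<in> words S K \<Longrightarrow> real (ham xs ys) \<le> \<delta> * K \<Longrightarrow> \<bar>F xs - F ys\<bar> \<le> \<eta>"
  obtains \<mu> where "real (card {xs \<in> words S K. 2 * \<eta> \<le> \<bar>F xs - \<mu>\<bar>}) \<le> real (card (words S K)) / (\<delta>\<^sup>2 * \<eta>\<^sup>2 * K)"
proof -
  let ?W = "words S K"
  have fin: "finite ?W" and cW: "card ?W = card S ^ K"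
    using S(1) by (simp_all add: finite_words card_words)
  have cS: "0 < card S" using S by (simp add: card_gt_0_iff)
  have ne: "?W \<noteq> {}" using cW cS by auto
  \<comment> \<open>With this slope, words further apart than \<open>\<delta> * K\<close> cost at
    least \<open>1\<close>, the range of \<open>F\<close>, so only nearby words matter for the
    minimum.\<close>
  define c where "c = 1 / (\<delta> * K)"
  have c: "0 < c" using \<delta> K by (simp add: c_def)
  define f where "f xs = Min ((\<lambda>ys. F ys + c * ham xs ys) ` ?W)" for xs
  have f_le: "f xs \<le> F ys + c * ham xs ys" if "ys \<in> ?W" for xs ys
    unfolding f_def using fin that by (intro Min_le) auto
  have f_ge: "b \<le> f xs" if "\<And>ys. ys \<in> ?W \<Longrightarrow> b \<le> F ys + c * ham xs ys" for xs b
    unfolding f_def using fin ne that by (intro Min.boundedI) auto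
  have close: "\<bar>F xs - f xs\<bar> \<le> \<eta>" if xs: "xs \<in> ?W" for xs
  proof -
    have "f xs \<le> F xs" using f_le[OF xs, of xs] by (simp add: ham_def)
    moreover have "F xs - \<eta> \<le> f xs"
    proof (rule f_ge)
      fix ys assume ys: "ys \<in> ?W"
      show "F xs - \<eta> \<le> F ys + c * ham xs ys"
      proof (cases "real (ham xs ys) \<le> \<delta> * K")
        case True
        have "0 \<le> c * ham xs ys" using c by simp
        then show ?thesis using Funif[OF xs ys True] by linarith
      next
        case False
        then have "1 \<le> c * ham xs ys" using \<delta> K by (simp add: c_def field_simps)
        then show ?thesis using F01[OF xs] F01[OF ys] \<eta> by linarith
      qed
    qed
    ultimately show ?thesis using \<eta> by linarith
  qed
  have ham_upd: "real (ham xs ys) \<le> real (ham (xs[i := s]) ys) + 1" "real (ham (xs[i := s]) ys) \<le> real (ham xs ys) + 1"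
    for xs ys :: "'b list" and i s
  proof -
    let ?A = "{j. j < length xs \<and> xs ! j \<noteq> ys ! j}" and ?B = "{j. j < length (xs[i := s]) \<and> xs[i := s] ! j \<noteq> ys ! j}"
    have "?A \<subseteq> insert i ?B" "?B \<subseteq> insert i ?A" by (auto simp: nth_list_update)
    then have "card ?A \<le> card (insert i ?B)" "card ?B \<le> card (insert i ?A)" by (auto intro!: card_mono)
    moreover have "card (insert i ?B) \<le> Suc (card ?B)" "card (insert i ?A) \<le> Suc (card ?A)" by (auto intro: card_insert_le_m1 simp: card_insert_if)
    ultimately show "real (ham xs ys) \<le> real (ham (xs[i := s]) ys) + 1" "real (ham (xs[i := s]) ys) \<le> real (ham xs ys) + 1"
      unfolding ham_def by linarith+
  qed
  have lip: "\<bar>f (xs[i := s]) - f xs\<bar> \<le> c" for xs i s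
  proof -
    have "f xs - c \<le> f (xs[i := s])"
    proof (rule f_ge)
      fix ys assume "ys \<in> ?W"
      then have "f xs \<le> F ys + c * ham xs ys" by (rule f_le)
      moreover have "c * ham xs ys \<le> c * (real (ham (xs[i := s]) ys) + 1)"
        by (rule mult_left_mono[OF ham_upd(1) less_imp_le[OF c]])
      ultimately show "f xs - c \<le> F ys + c * ham (xs[i := s]) ys" by (simp add: distrib_left)
    qed
    moreover have "f (xs[i := s]) - c \<le> f xs"
    proof (rule f_ge)
      fix ys assume "ys \<in> ?W"
      then have "f (xs[i := s]) \<le> F ys + c * ham (xs[i := s]) ys" by (rule f_le)
      moreover have "c * ham (xs[i := s]) ys \<le> c * (real (ham xs ys) + 1)"
        by (rule mult_left_mono[OF ham_upd(2) less_imp_le[OF c]])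
      ultimately show "f (xs[i := s]) - c \<le> F ys + c * ham xs ys" by (simp add: distrib_left)
    qed
    ultimately show ?thesis by linarith
  qed
  define \<mu> where "\<mu> = (\<Sum>xs\<in>?W. f xs) / card S ^ K"
  let ?B = "{xs \<in> ?W. 2 * \<eta> \<le> \<bar>F xs - \<mu>\<bar>}"
  have "real (card ?B) * \<eta>\<^sup>2 = (\<Sum>xs\<in>?B. \<eta>\<^sup>2)" by simp
  also have "\<dots> \<le> (\<Sum>xs\<in>?B. (f xs - \<mu>)\<^sup>2)"
  proof (rule sum_mono)
    fix xs assume "xs \<in> ?B"
    then have "\<eta> \<le> \<bar>f xs - \<mu>\<bar>" using close[of xs] by auto
    then show "\<eta>\<^sup>2 \<le> (f xs - \<mu>)\<^sup>2" using \<eta> by (metis less_imp_le power2_abs power_mono)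
  qed
  also have "\<dots> \<le> (\<Sum>xs\<in>?W. (f xs - \<mu>)\<^sup>2)" by (rule sum_mono2[OF fin]) auto
  also have "\<dots> \<le> K * c\<^sup>2 * card S ^ K" unfolding \<mu>_def by (rule efron_stein_bounded_differences[OF S]) (rule lip)
  also have "\<dots> = real (card ?W) / (\<delta>\<^sup>2 * K)" using K \<delta> by (simp add: c_def cW power2_eq_square field_simps)
  finally have "real (card ?B) * \<eta>\<^sup>2 \<le> real (card ?W) / (\<delta>\<^sup>2 * K)" .
  then have "real (card ?B) \<le> real (card ?W) / (\<delta>\<^sup>2 * K) / \<eta>\<^sup>2" by (subst pos_le_divide_eq) (use \<eta> in auto)
  then show thesis using that[of \<mu>] by (simp add: mult.commute mult.left_commute)
qed

section \<open>Almost invariance of boxes\<close>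

definition shift :: "(nat \<Rightarrow> int) \<Rightarrow> int list \<Rightarrow> int list" where
  "shift w xs = map (\<lambda>k. w k + xs ! k) [0..<length xs]"

lemma length_shift [simp]: "length (shift w xs) = length xs"
  by (simp add: shift_def)

lemma nth_shift [simp]: "k < length xs \<Longrightarrow> shift w xs ! k = w k + xs ! k"
  by (simp add: shift_def)

lemma inj_shift: "inj_on (shift w) (words S K)"
proof (rule inj_onI)
  fix xs ys assume xy: "xs \<in> words S K" "ys \<in> words S K" "shift w xs = shift w ys"
  show "xs = ys"
  proof (rule nth_equalityI)
    show "length xs = length ys" using xy by (simp add: words_def)
    fix i assume i: "i < length xs"
    have "shift w xs ! i = shift w ys ! i" using xy by simp
    moreover have "i < length ys" using i xy by (simp add: words_def)
    ultimately show "xs ! i = ys ! i" using i by simp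
  qed
qed

text \<open>Words whose letters keep distance \<open>B\<close> from both ends remain in the box. By
  Bernoulli's inequality their proportion \<open>(1 - 2 * B / N) ^ K\<close> is at least
  \<open>1 - 2 * B * K / N\<close>.\<close>

lemma almost_shift_invariant:
  assumes w: "\<And>k. k < K \<Longrightarrow> \<bar>w k\<bar> \<le> int B" and N: "0 < N"
  shows "real (card {xs \<in> words {0..<int N} K. shift w xs \<notin> words {0..<int N} K})
    \<le> real (card (words {0..<int N} K)) * (2 * real B * real K / real N)"
proof (cases "2 * B \<le> N")
  \<comment> \<open>Here the bound is trivial: its factor is at least \<open>1\<close> unless
    \<open>K = 0\<close>, when no word leaves the box.\<close>
  case False
  have "real (card {xs \<in> words {0..<int N} K. shift w xs \<notin> words {0..<int N} K}) \<le> real (card (words {0..<int N} K))"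
    by (intro of_nat_mono card_mono finite_words) auto
  moreover have "real (card (words {0..<int N} K)) * 1 \<le> real (card (words {0..<int N} K)) * (2 * real B * real K / real N)" if "K \<noteq> 0"
  proof (rule mult_left_mono)
    have "N \<le> 2 * B * K" using False that by (metis le_trans mult.right_neutral mult_le_mono2 nat_le_linear not_less_eq_eq One_nat_def not_gr_zero Suc_leI)
    then have "real N \<le> real (2 * B * K)" by (rule of_nat_mono)
    then show "1 \<le> 2 * real B * real K / real N" using N by simp
  qed simp
  ultimately have "K \<noteq> 0 \<Longrightarrow> ?thesis" by linarith
  moreover have "?thesis" if "K = 0"
  proof -
    have "{xs \<in> words {0..<int N} K. shift w xs \<notin> words {0..<int N} K} = {}"
      using that by (auto simp: words_def shift_def)
    then show ?thesis by (simp only: card.empty) simp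
  qed
  ultimately show ?thesis by blast
next
  case True
  let ?W = "words {0..<int N} K" and ?G = "words {int B..<int N - int B} K"
  have G: "?G \<subseteq> {xs \<in> ?W. shift w xs \<in> ?W}"
  proof
    fix xs assume "xs \<in> ?G"
    then have l: "length xs = K" and s: "set xs \<subseteq> {int B..<int N - int B}" by (auto simp: words_def)
    have "xs ! i \<in> {int B..<int N - int B}" if "i < K" for i
      using s nth_mem[of i xs] l that by (intro subsetD[OF s]) simp
    then have xs: "length xs = K" "\<And>i. i < K \<Longrightarrow> int B \<le> xs ! i \<and> xs ! i < int N - int B"
      using l by auto
    have mem: "xs ! i \<in> {0..<int N}" "w i + xs ! i \<in> {0..<int N}" if "i < K" for i
      using xs(2)[OF that] w[OF that] by (simp_all add: abs_le_iff)
    have "set xs \<subseteq> {0..<int N}" using mem(1) xs(1) by (metis in_set_conv_nth subsetI)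
    moreover have "set (shift w xs) \<subseteq> {0..<int N}"
    proof
      fix y assume "y \<in> set (shift w xs)"
      then obtain i where "i < length (shift w xs)" "y = shift w xs ! i" by (metis in_set_conv_nth)
      then show "y \<in> {0..<int N}" using mem(2)[of i] xs(1) by simp
    qed
    ultimately show "xs \<in> {xs \<in> ?W. shift w xs \<in> ?W}" using xs(1) by (simp add: words_def)
  qed
  have fin: "finite ?W" by (simp add: finite_words)
  have "{xs \<in> ?W. shift w xs \<notin> ?W} = ?W - {xs \<in> ?W. shift w xs \<in> ?W}" by auto
  then have "card {xs \<in> ?W. shift w xs \<notin> ?W} \<le> card (?W - ?G)" using G fin by (intro card_mono) auto
  also have "card (?W - ?G) = card ?W - card ?G" using G fin by (intro card_Diff_subset finite_subset[OF _ fin]) auto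
  finally have "real (card {xs \<in> ?W. shift w xs \<notin> ?W}) \<le> real (card ?W - card ?G)" by (rule of_nat_mono)
  also have "\<dots> = real (card ?W) - real (card ?G)" using G fin by (intro of_nat_diff card_mono) auto
  also have "real (card ?W) = real N ^ K" by (simp add: card_words)
  also have "real (card ?G) = (real N - 2 * real B) ^ K"
  proof -
    have "nat (int N - int B - int B) = N - 2 * B" by simp
    then show ?thesis using True by (simp add: card_words)
  qed
  also have "(real N - 2 * real B) ^ K = real N ^ K * (1 + - (2 * real B / N)) ^ K"
    using N by (simp add: field_simps flip: power_mult_distrib)
  also have "real N ^ K - real N ^ K * (1 + - (2 * real B / N)) ^ K \<le> real N ^ K * (2 * real B * real K / real N)"
  proof -
    have "1 + real K * - (2 * real B / N) \<le> (1 + - (2 * real B / N)) ^ K"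
      by (rule Bernoulli_inequality) (use True N in \<open>simp add: field_simps\<close>)
    then have "1 - (1 + - (2 * real B / N)) ^ K \<le> 2 * real B * real K / real N" by (simp add: field_simps)
    then have "real N ^ K * (1 - (1 + - (2 * real B / N)) ^ K) \<le> real N ^ K * (2 * real B * real K / real N)"
      by (intro mult_left_mono) auto
    then show ?thesis by (simp add: right_diff_distrib)
  qed
  finally show ?thesis by (simp add: card_words)
qed

section \<open>Fixed points from concentration\<close>

locale levy_group =
  fixes G :: "('g, 'n) monoid_scheme" (structure) and T :: "'g topology" and u :: "nat \<Rightarrow> (nat \<Rightarrow> int) \<Rightarrow> 'g"
  assumes top_group: "topological_group G T"
    and u_carrier: "carrier G = {u n z | n z. True}"
    and u_mult: "u n z \<otimes> u n z' = u n (\<lambda>k. z k + z' k)"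
    and u_zero: "u n (\<lambda>_. 0) = \<one>"
    and u_refine: "u n z = u (Suc n) (\<lambda>k. z (k div 2))"
    and u_cong: "(\<And>k. k < 2 ^ n \<Longrightarrow> z k = z' k) \<Longrightarrow> u n z = u n z'"
    and u_small: "openin T V \<Longrightarrow> \<one> \<in> V \<Longrightarrow>
      \<exists>\<delta>>0. \<forall>n z. real (card {k. k < 2 ^ n \<and> z k \<noteq> 0}) \<le> \<delta> * 2 ^ n \<longrightarrow> u n z \<in> V"
begin

lemma u_closed [simp]: "u n z \<in> carrier G"
  using u_carrier by blast

text \<open>Refinement repeats coordinates, so the bound \<open>B\<close> does not grow with the
  level. This allows the box length to be chosen after the level.\<close>

lemma u_all_levels:
  assumes "g \<in> carrier G"
  obtains n0 B where "\<And>n. n0 \<le> n \<Longrightarrow> \<exists>w. g = u n w \<and> (\<forall>k<2 ^ n. \<bar>w k\<bar> \<le> int B)"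
proof -
  obtain n0 w0 where g: "g = u n0 w0" using assms u_carrier by blast
  define B where "B = nat (Max (insert 0 ((\<lambda>k. \<bar>w0 k\<bar>) ` {..<2 ^ n0})))"
  have B: "\<bar>w0 k\<bar> \<le> int B" if "k < 2 ^ n0" for k
  proof -
    have "\<bar>w0 k\<bar> \<le> Max (insert 0 ((\<lambda>k. \<bar>w0 k\<bar>) ` {..<2 ^ n0}))" using that by (intro Max_ge) auto
    then show ?thesis by (simp add: B_def)
  qed
  have "\<exists>w. g = u n w \<and> (\<forall>k<2 ^ n. \<bar>w k\<bar> \<le> int B)" if "n0 \<le> n" for n
    using that
  proof (induction n rule: dec_induct)
    case base
    then show ?case using g B by blast
  next
    case (step n)
    then obtain w where w: "g = u n w" "\<forall>k<2 ^ n. \<bar>w k\<bar> \<le> int B" by blast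
    have "\<forall>k<2 ^ Suc n. \<bar>w (k div 2)\<bar> \<le> int B" using w(2) by auto
    then show ?case using w(1) u_refine[of n w] by metis
  qed
  then show thesis by (rule that)
qed

context
  fixes S :: "'b topology" and \<phi> and x0 :: 'b
  assumes act: "continuous_action G T S \<phi>" and compact: "compact_space S"
    and x0: "x0 \<in> topspace S"
begin

lemma T_space: "topspace T = carrier G" and G_group: "group G"
  using top_group by (auto simp: topological_group_def)

lemma action: "group_action G (topspace S) \<phi>"
  and action_continuous: "continuous_map (prod_topology T S) S (\<lambda>(g, x). \<phi> g x)"
  using act by (auto simp: continuous_action_def)

lemma action_closed: "g \<in> carrier G \<Longrightarrow> x \<in> topspace S \<Longrightarrow> \<phi> g x \<in> topspace S"
  using group_action.element_image[OF action] by blast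

lemma action_one: "x \<in> topspace S \<Longrightarrow> \<phi> \<one> x = x"
  using group_action.id_eq_one[OF action] by (metis restrict_apply')

lemma action_mult: "g \<in> carrier G \<Longrightarrow> g' \<in> carrier G \<Longrightarrow> x \<in> topspace S \<Longrightarrow> \<phi> (g \<otimes> g') x = \<phi> g (\<phi> g' x)"
  using group_action.composition_rule[OF action] by blast

text \<open>The tube lemma over the compact space turns continuity of the action at
  \<open>\<one>\<close> into a neighbourhood of \<open>\<one>\<close> that works for all points
  \<open>x\<close> at once.\<close>

lemma uniformly_small:
  assumes f: "continuous_map S euclideanreal f" and \<eta>: "0 < \<eta>"
  obtains \<delta> where "0 < \<delta>" "\<And>n z x. x \<in> topspace S \<Longrightarrow>
    real (card {k. k < 2 ^ n \<and> z k \<noteq> 0}) \<le> \<delta> * 2 ^ n \<Longrightarrow> \<bar>f (\<phi> (u n z) x) - f x\<bar> < \<eta>"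
proof -
  define D where "D p = \<bar>f (\<phi> (fst p) (snd p)) - f (snd p)\<bar>" for p :: "'g \<times> 'b"
  have "continuous_map (prod_topology T S) euclideanreal (\<lambda>p. f (\<phi> (fst p) (snd p)))"
    using continuous_map_compose[OF action_continuous f] by (simp add: o_def case_prod_beta)
  moreover have "continuous_map (prod_topology T S) euclideanreal (\<lambda>p. f (snd p))"
    using continuous_map_compose[OF continuous_map_snd f] by (simp add: o_def)
  ultimately have "continuous_map (prod_topology T S) euclideanreal D"
    unfolding D_def by (intro continuous_map_real_abs continuous_map_diff)
  then have "openin (prod_topology T S) {p \<in> topspace (prod_topology T S). D p \<in> {..<\<eta>}}"
    by (rule openin_continuous_map_preimage) simp
  moreover have "{\<one>} \<times> topspace S \<subseteq> {p \<in> topspace (prod_topology T S). D p \<in> {..<\<eta>}}"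
    using \<eta> T_space group.is_monoid[OF G_group] by (auto simp: D_def action_one monoid.one_closed)
  moreover have "\<one> \<in> topspace T" using T_space group.is_monoid[OF G_group] by (simp add: monoid.one_closed)
  ultimately obtain V V' where V: "openin T V" "\<one> \<in> V" "topspace S \<subseteq> V'"
      "V \<times> V' \<subseteq> {p \<in> topspace (prod_topology T S). D p \<in> {..<\<eta>}}"
    using tube_lemma_right[of T S _ "topspace S" \<one>] compact unfolding compact_space_def by meson
  obtain \<delta> where \<delta>: "0 < \<delta>" "\<forall>n z. real (card {k. k < 2 ^ n \<and> z k \<noteq> 0}) \<le> \<delta> * 2 ^ n \<longrightarrow> u n z \<in> V"
    using u_small[OF V(1,2)] by blast
  show thesis
  proof (rule that[OF \<delta>(1)])
    fix n x and z :: "nat \<Rightarrow> int" assume x: "x \<in> topspace S" and "real (card {k. k < 2 ^ n \<and> z k \<noteq> 0}) \<le> \<delta> * 2 ^ n"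
    then have "u n z \<in> V" using \<delta>(2) by blast
    then have "(u n z, x) \<in> V \<times> V'" using V(3) x by blast
    then have "D (u n z, x) < \<eta>" using V(4) by blast
    then show "\<bar>f (\<phi> (u n z) x) - f x\<bar> < \<eta>" by (simp add: D_def)
  qed
qed

text \<open>This is a union bound over the words of a box. A word is rejected if some
  \<open>f\<close> deviates from its central value there or after a translation, or if a translation
  leaves the box; some word survives.\<close>

lemma almost_fixed:
  assumes A: "finite A" "\<And>f. f \<in> A \<Longrightarrow> continuous_map S euclideanreal f"
      "\<And>f x. f \<in> A \<Longrightarrow> x \<in> topspace S \<Longrightarrow> 0 \<le> f x \<and> f x \<le> (1::real)"
    and E: "finite E" "E \<subseteq> carrier G" and \<epsilon>: "0 < \<epsilon>"
  obtains x where "x \<in> topspace S" "\<And>f g. f \<in> A \<Longrightarrow> g \<in> E \<Longrightarrow> \<bar>f (\<phi> g x) - f x\<bar> \<le> \<epsilon>"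
proof -
  \<comment> \<open>Two values within \<open>2 * \<eta>\<close> of a common \<open>\<mu> f\<close>
    differ by at most \<open>\<epsilon>\<close>.\<close>
  define \<eta> where "\<eta> = \<epsilon> / 4"
  have \<eta>: "0 < \<eta>" using \<epsilon> by (simp add: \<eta>_def)
  define small where "small f \<delta> \<longleftrightarrow> 0 < \<delta> \<and> (\<forall>n z x. x \<in> topspace S \<longrightarrow>
    real (card {k. k < 2 ^ n \<and> z k \<noteq> 0}) \<le> \<delta> * 2 ^ n \<longrightarrow> \<bar>f (\<phi> (u n z) x) - f x\<bar> < \<eta>)" for f \<delta>
  have "\<exists>\<delta>. small f \<delta>" if "f \<in> A" for f
    by (rule uniformly_small[OF A(2)[OF that] \<eta>]) (auto simp: small_def)
  then obtain \<delta>' where small: "\<And>f. f \<in> A \<Longrightarrow> small f (\<delta>' f)" by metis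
  have \<delta>': "\<And>f. f \<in> A \<Longrightarrow> 0 < \<delta>' f" "\<And>f n z x. f \<in> A \<Longrightarrow> x \<in> topspace S \<Longrightarrow>
    real (card {k. k < 2 ^ n \<and> z k \<noteq> 0}) \<le> \<delta>' f * 2 ^ n \<Longrightarrow> \<bar>f (\<phi> (u n z) x) - f x\<bar> < \<eta>"
    using small by (simp_all add: small_def)
  define \<delta> where "\<delta> = Min (insert 1 (\<delta>' ` A))"
  have \<delta>: "0 < \<delta>" "\<And>f. f \<in> A \<Longrightarrow> \<delta> \<le> \<delta>' f" using A(1) \<delta>'(1) by (auto simp: \<delta>_def)
  have "\<exists>n0 B. \<forall>n\<ge>n0. \<exists>w. g = u n w \<and> (\<forall>k<2 ^ n. \<bar>w k\<bar> \<le> int B)" if "g \<in> E" for g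
    using u_all_levels[of g] E(2) that by (metis subsetD)
  then obtain n0 B where nB: "\<And>g n. g \<in> E \<Longrightarrow> n0 g \<le> n \<Longrightarrow> \<exists>w. g = u n w \<and> (\<forall>k<2 ^ n. \<bar>w k\<bar> \<le> int (B g))"
    by metis
  define B' where "B' = Max (insert 0 (B ` E))"
  have B': "B g \<le> B'" if "g \<in> E" for g using E(1) that by (auto simp: B'_def)
  define p where "p = real (card A)"
  define q where "q = real (card E)"
  define n1 where "n1 = Max (insert 0 (n0 ` E))"
  have n1: "n0 g \<le> n1" if "g \<in> E" for g using E(1) that by (auto simp: n1_def)
  \<comment> \<open>There are \<open>p\<close> deviation events at the word itself and
    \<open>p * q\<close> after translation; the level makes their total proportion smaller than one
    half.\<close>
  obtain n2 where n2: "2 * (p + p * q) / (\<delta>\<^sup>2 * \<eta>\<^sup>2) < 2 ^ n2"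
    using real_arch_pow[of 2] by auto
  define n where "n = max n1 n2"
  define K where "K = (2::nat) ^ n"
  have K: "0 < K" by (simp add: K_def)
  have "(2::real) ^ n2 \<le> 2 ^ n" by (simp add: n_def)
  then have "2 * (p + p * q) / (\<delta>\<^sup>2 * \<eta>\<^sup>2) < real K" using order.strict_trans2[OF n2] by (simp add: K_def)
  then have bK: "(p + p * q) * (1 / (\<delta>\<^sup>2 * \<eta>\<^sup>2 * K)) < 1 / 2"
    using \<delta>(1) \<eta> K by (simp add: field_simps)
  \<comment> \<open>\<open>N\<close> is chosen in terms of \<open>K\<close>: the \<open>q\<close>
    events of leaving the box get at most the other half.\<close>
  obtain N :: nat where N: "4 * q * B' * K < N" using reals_Archimedean2 by blast
  then have N0: "0 < N" using q_def by (metis mult_nonneg_nonneg of_nat_0_le_iff of_nat_0_less_iff order_le_less_trans zero_le_numeral)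
  have bN: "q * (2 * real B' * real K / real N) \<le> 1 / 2" using N N0 by (simp add: field_simps)
  define I where "I = {0..<int N}"
  have I: "finite I" "I \<noteq> {}" using N0 by (auto simp: I_def)
  let ?W = "words I K"
  have finW: "finite ?W" by (rule finite_words[OF I(1)])
  have cW: "0 < real (card ?W)" using I by (simp add: card_words card_gt_0_iff)
  define zz where "zz xs k = (if k < length xs then xs ! k else 0)" for xs :: "int list" and k
  define pt where "pt xs = \<phi> (u n (zz xs)) x0" for xs
  have pt: "pt xs \<in> topspace S" for xs unfolding pt_def by (rule action_closed[OF u_closed x0])
  have conc: "\<forall>f\<in>A. \<exists>\<mu>. real (card {xs \<in> ?W. 2 * \<eta> \<le> \<bar>f (pt xs) - \<mu>\<bar>}) \<le> real (card ?W) / (\<delta>\<^sup>2 * \<eta>\<^sup>2 * K)"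
  proof
    fix f assume f: "f \<in> A"
    have unif: "\<bar>f (pt xs) - f (pt ys)\<bar> \<le> \<eta>"
      if xy: "xs \<in> ?W" "ys \<in> ?W" "real (ham xs ys) \<le> \<delta> * K" for xs ys
    proof -
      let ?z = "\<lambda>k. zz xs k - zz ys k"
      have l: "length xs = K" "length ys = K" using xy by (auto simp: words_def)
      have "u n ?z \<otimes> u n (zz ys) = u n (zz xs)" by (simp add: u_mult)
      then have "pt xs = \<phi> (u n ?z) (pt ys)"
        unfolding pt_def using action_mult[OF u_closed u_closed x0] by metis
      moreover have "{k. k < 2 ^ n \<and> ?z k \<noteq> 0} = {k. k < length xs \<and> xs ! k \<noteq> ys ! k}"
        using l by (auto simp: zz_def K_def)
      then have "real (card {k. k < 2 ^ n \<and> ?z k \<noteq> 0}) \<le> \<delta> * K" using xy(3) by (simp add: ham_def)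
      then have "real (card {k. k < 2 ^ n \<and> ?z k \<noteq> 0}) \<le> \<delta>' f * 2 ^ n"
        using \<delta>(2)[OF f] by (simp add: K_def) (meson mult_right_mono order_trans zero_le_numeral zero_le_power)
      then have "\<bar>f (\<phi> (u n ?z) (pt ys)) - f (pt ys)\<bar> < \<eta>" by (rule \<delta>'(2)[OF f pt])
      ultimately show ?thesis by simp
    qed
    show "\<exists>\<mu>. real (card {xs \<in> ?W. 2 * \<eta> \<le> \<bar>f (pt xs) - \<mu>\<bar>}) \<le> real (card ?W) / (\<delta>\<^sup>2 * \<eta>\<^sup>2 * K)"
      by (rule concentration[OF I K \<delta>(1) \<eta>, of "\<lambda>xs. f (pt xs)"]) (use A(3)[OF f pt] unif in auto)
  qed
  from bchoice[OF conc] obtain \<mu> where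
    \<mu>: "\<forall>f\<in>A. real (card {xs \<in> ?W. 2 * \<eta> \<le> \<bar>f (pt xs) - \<mu> f\<bar>}) \<le> real (card ?W) / (\<delta>\<^sup>2 * \<eta>\<^sup>2 * K)" ..
  define \<beta> where "\<beta> = real (card ?W) * (1 / (\<delta>\<^sup>2 * \<eta>\<^sup>2 * K))"
  define bad where "bad f = {xs \<in> ?W. 2 * \<eta> \<le> \<bar>f (pt xs) - \<mu> f\<bar>}" for f
  have bad: "real (card (bad f)) \<le> \<beta>" if "f \<in> A" for f using \<mu>[rule_format, OF that] by (simp add: bad_def \<beta>_def)
  have "\<exists>w. g = u n w \<and> (\<forall>k<K. \<bar>w k\<bar> \<le> int B')" if g: "g \<in> E" for g
  proof -
    have "n0 g \<le> n" using n1[OF g] by (simp add: n_def)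
    from nB[OF g this] obtain w where w: "g = u n w" "\<forall>k<2 ^ n. \<bar>w k\<bar> \<le> int (B g)" by blast
    have "\<bar>w k\<bar> \<le> int B'" if "k < K" for k
      using w(2)[rule_format, of k] that B'[OF g] by (simp add: K_def)
    then show ?thesis using w(1) by blast
  qed
  then obtain w where w: "\<And>g. g \<in> E \<Longrightarrow> g = u n (w g)" "\<And>g k. g \<in> E \<Longrightarrow> k < K \<Longrightarrow> \<bar>w g k\<bar> \<le> int B'" by metis
  define out where "out g = {xs \<in> ?W. shift (w g) xs \<notin> ?W}" for g
  define \<gamma> where "\<gamma> = real (card ?W) * (2 * real B' * real K / real N)"
  have out: "real (card (out g)) \<le> \<gamma>" if "g \<in> E" for g
    unfolding out_def \<gamma>_def I_def by (rule almost_shift_invariant) (use w(2)[OF that] N0 in auto)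
  \<comment> \<open>Translation is injective, so the preimage of a deviation event is no larger than
    the event itself.\<close>
  define mov where "mov f g = {xs \<in> ?W. shift (w g) xs \<in> bad f}" for f g
  have mov: "real (card (mov f g)) \<le> \<beta>" if "f \<in> A" for f g
  proof -
    have "card (mov f g) \<le> card (bad f)"
    proof (rule card_inj_on_le[of "shift (w g)"])
      show "inj_on (shift (w g)) (mov f g)"
        by (rule inj_on_subset[OF inj_shift[of _ I K]]) (auto simp: mov_def)
      show "finite (bad f)" using finW by (simp add: bad_def)
    qed (auto simp: mov_def)
    then show ?thesis using bad[OF that] by linarith
  qed
  let ?U = "(\<Union>f\<in>A. bad f) \<union> (\<Union>g\<in>E. out g) \<union> (\<Union>f\<in>A. \<Union>g\<in>E. mov f g)"
  have "real (card ?U) \<le> p * \<beta> + q * \<gamma> + p * (q * \<beta>)"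
  proof -
    have 1: "real (card (\<Union>i\<in>J. X' i)) \<le> real (card J) * b"
      if "finite J" "\<And>i. i \<in> J \<Longrightarrow> real (card (X' i)) \<le> b" for J :: "'j set" and X' :: "'j \<Rightarrow> int list set" and b
    proof -
      have "real (card (\<Union>i\<in>J. X' i)) \<le> real (\<Sum>i\<in>J. card (X' i))" by (intro of_nat_mono card_UN_le that(1))
      also have "\<dots> \<le> (\<Sum>i\<in>J. b)" unfolding of_nat_sum by (rule sum_mono) (rule that(2))
      finally show ?thesis by simp
    qed
    have "real (card (\<Union>f\<in>A. bad f)) \<le> p * \<beta>" unfolding p_def by (rule 1[OF A(1) bad])
    moreover have "real (card (\<Union>g\<in>E. out g)) \<le> q * \<gamma>" unfolding q_def by (rule 1[OF E(1) out])
    moreover have "real (card (\<Union>f\<in>A. \<Union>g\<in>E. mov f g)) \<le> p * (q * \<beta>)" unfolding p_def q_def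
      by (rule 1[OF A(1)], rule 1[OF E(1)], rule mov)
    moreover have "real (card ?U) \<le> real (card (\<Union>f\<in>A. bad f)) + real (card (\<Union>g\<in>E. out g)) + real (card (\<Union>f\<in>A. \<Union>g\<in>E. mov f g))"
      using card_Un_le[of "(\<Union>f\<in>A. bad f) \<union> (\<Union>g\<in>E. out g)" "\<Union>f\<in>A. \<Union>g\<in>E. mov f g"]
        card_Un_le[of "\<Union>f\<in>A. bad f" "\<Union>g\<in>E. out g"] by linarith
    ultimately show ?thesis by linarith
  qed
  also have "p * \<beta> + q * \<gamma> + p * (q * \<beta>) = real (card ?W) * ((p + p * q) * (1 / (\<delta>\<^sup>2 * \<eta>\<^sup>2 * K)) + q * (2 * real B' * real K / real N))"
    unfolding \<beta>_def \<gamma>_def by (simp only: distrib_left distrib_right mult_ac)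
  also have "\<dots> < real (card ?W) * 1" using bK bN cW by (intro mult_strict_left_mono) linarith+
  finally have "card ?U < card ?W" by simp
  moreover have "?U \<subseteq> ?W" by (auto simp: bad_def out_def mov_def)
  ultimately obtain xs where xs: "xs \<in> ?W" "xs \<notin> ?U" by (metis nat_less_le subsetI subset_antisym)
  show thesis
  proof (rule that[OF pt[of xs]])
    fix f g assume f: "f \<in> A" and g: "g \<in> E"
    have "\<bar>f (pt xs) - \<mu> f\<bar> < 2 * \<eta>" using xs f by (auto simp: bad_def)
    moreover have "\<bar>f (pt (shift (w g) xs)) - \<mu> f\<bar> < 2 * \<eta>"
    proof -
      have "shift (w g) xs \<in> ?W" using xs g by (auto simp: out_def)
      moreover have "shift (w g) xs \<notin> bad f" using xs f g by (auto simp: mov_def)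
      ultimately show ?thesis by (simp add: bad_def)
    qed
    moreover have "pt (shift (w g) xs) = \<phi> g (pt xs)"
    proof -
      have l: "length xs = K" using xs by (simp add: words_def)
      have "u n (zz (shift (w g) xs)) = u n (\<lambda>k. w g k + zz xs k)"
        by (rule u_cong) (use l in \<open>simp add: zz_def K_def\<close>)
      also have "\<dots> = g \<otimes> u n (zz xs)" using w(1)[OF g] u_mult by metis
      finally show ?thesis unfolding pt_def using action_mult[OF _ u_closed x0] g E(2) by auto
    qed
    ultimately have "\<bar>f (pt xs) - \<mu> f\<bar> < 2 * \<eta>" "\<bar>f (\<phi> g (pt xs)) - \<mu> f\<bar> < 2 * \<eta>" by simp_all
    then show "\<bar>f (\<phi> g (pt xs)) - f (pt xs)\<bar> \<le> \<epsilon>" unfolding \<eta>_def by arith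
  qed
qed

text \<open>The sets \<open>Z\<close> of approximate fixed points are closed and have the finite
  intersection property by \<open>almost_fixed\<close>. A common point is fixed because continuous
  functions into the unit interval separate points.\<close>

lemma fixed_point:
  assumes Haus: "Hausdorff_space S"
  shows "\<exists>x\<in>topspace S. \<forall>g\<in>carrier G. \<phi> g x = x"
proof -
  define \<F> where "\<F> = {f. continuous_map S euclideanreal f \<and> (\<forall>x\<in>topspace S. 0 \<le> f x \<and> f x \<le> (1::real))}"
  define Z where "Z = (\<lambda>(f, g, \<epsilon>). {x \<in> topspace S. \<bar>f (\<phi> g x) - f x\<bar> \<le> (\<epsilon>::real)})"
  define P where "P = \<F> \<times> carrier G \<times> {0::real<..}"
  have cont_g: "continuous_map S S (\<phi> g)" if "g \<in> carrier G" for g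
  proof -
    have "continuous_map S (prod_topology T S) (\<lambda>x. (g, x))"
      using that T_space by (simp add: continuous_map_pairedI)
    from continuous_map_compose[OF this action_continuous] show ?thesis by (simp add: o_def)
  qed
  have closed: "closedin S (Z (f, g, \<epsilon>))" if "f \<in> \<F>" "g \<in> carrier G" for f g \<epsilon>
  proof -
    have f: "continuous_map S euclideanreal f" using that by (simp add: \<F>_def)
    have "continuous_map S euclideanreal (\<lambda>x. \<bar>f (\<phi> g x) - f x\<bar>)"
      using continuous_map_compose[OF cont_g[OF that(2)] f] f
      by (intro continuous_map_real_abs continuous_map_diff) (simp_all add: o_def)
    then have "closedin S {x \<in> topspace S. \<bar>f (\<phi> g x) - f x\<bar> \<in> {..\<epsilon>}}"
      by (rule closedin_continuous_map_preimage) simp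
    then show ?thesis by (simp add: Z_def)
  qed
  have "\<Inter> (insert (topspace S) (Z ` P)) \<noteq> {}"
  proof (rule compact[unfolded compact_space_fip, THEN spec, THEN mp], intro conjI ballI allI impI)
    show "closedin S C" if "C \<in> insert (topspace S) (Z ` P)" for C
      using that closed by (auto simp: P_def)
    fix \<Q> assume Q: "finite \<Q> \<and> \<Q> \<subseteq> insert (topspace S) (Z ` P)"
    then have "finite (\<Q> - {topspace S})" "\<Q> - {topspace S} \<subseteq> Z ` P" by auto
    then obtain P' where P': "finite P'" "P' \<subseteq> P" "\<Q> - {topspace S} = Z ` P'"
      by (meson finite_subset_image)
    define \<epsilon> where "\<epsilon> = Min (insert 1 ((\<lambda>(f, g, \<epsilon>). \<epsilon>) ` P'))"
    have \<epsilon>: "0 < \<epsilon>" using P'(1,2) by (auto simp: \<epsilon>_def P_def)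
    have \<epsilon>le: "\<epsilon> \<le> e" if "(f, g, e) \<in> P'" for f g e
      unfolding \<epsilon>_def using P'(1) that by (intro Min_le) force+
    obtain x where x: "x \<in> topspace S" "\<And>f g. f \<in> fst ` P' \<Longrightarrow> g \<in> (fst \<circ> snd) ` P' \<Longrightarrow> \<bar>f (\<phi> g x) - f x\<bar> \<le> \<epsilon>"
    proof (rule almost_fixed[of "fst ` P'" "(fst \<circ> snd) ` P'" \<epsilon>])
      show "finite (fst ` P')" "finite ((fst \<circ> snd) ` P')" using P'(1) by auto
      show "continuous_map S euclideanreal f" if "f \<in> fst ` P'" for f
        using that P'(2) by (auto simp: P_def \<F>_def)
      show "0 \<le> f x \<and> f x \<le> 1" if "f \<in> fst ` P'" "x \<in> topspace S" for f x
        using that P'(2) by (auto simp: P_def \<F>_def)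
      show "(fst \<circ> snd) ` P' \<subseteq> carrier G" using P'(2) by (auto simp: P_def)
    qed (use \<epsilon> in auto)
    have "x \<in> Z t" if "t \<in> P'" for t
    proof -
      obtain f g e where t: "t = (f, g, e)" by (cases t)
      have "f \<in> fst ` P'" "g \<in> (fst \<circ> snd) ` P'" using that t by force+
      then have "\<bar>f (\<phi> g x) - f x\<bar> \<le> e" using order_trans[OF x(2) \<epsilon>le, of f g f g e] that t by simp
      then show ?thesis using x(1) by (simp add: Z_def t)
    qed
    then have "x \<in> C" if "C \<in> \<Q>" for C using that P'(3) x(1) by (cases "C = topspace S") blast+
    then show "\<Inter> \<Q> \<noteq> {}" by blast
  qed
  then obtain x where x: "x \<in> topspace S" "\<And>t. t \<in> P \<Longrightarrow> x \<in> Z t" by blast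
  have "\<phi> g x = x" if g: "g \<in> carrier G" for g
  proof (rule ccontr)
    assume ne: "\<phi> g x \<noteq> x"
    have "normal_space S" using compact Haus by (rule compact_Hausdorff_or_regular_imp_normal_space[OF _ disjI1])
    then have "completely_regular_space S" using Haus
      by (simp add: normal_imp_completely_regular_space)
    moreover have "closedin S {x}" using x(1) Haus by (simp add: closedin_Hausdorff_singleton)
    moreover have "\<phi> g x \<in> topspace S - {x}" using action_closed[OF g x(1)] ne by blast
    ultimately obtain f :: "'b \<Rightarrow> real" where f: "continuous_map S (top_of_set {0..1}) f" "f (\<phi> g x) = 0" "f ` {x} \<subseteq> {1}"
      unfolding completely_regular_space_def by metis
    have "f \<in> \<F>" using f(1) unfolding \<F>_def continuous_map_in_subtopology by (auto simp: image_subset_iff Pi_iff)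
    \<comment> \<open>The values of \<open>f\<close> at \<open>x\<close> and
      \<open>\<phi> g x\<close> are \<open>1\<close> and \<open>0\<close>; a tolerance below
      \<open>1\<close> is contradictory.\<close>
    then have "(f, g, 1/2) \<in> P" using g by (simp add: P_def)
    then have "x \<in> Z (f, g, 1/2)" by (rule x(2))
    then show False using f(2,3) by (simp add: Z_def)
  qed
  then show ?thesis using x(1) by blast
qed

end

theorem extremely_amenable: "extremely_amenable G T"
  unfolding extremely_amenable_def
proof (intro conjI allI impI)
  fix S :: "'g set set topology" and \<phi>
  assume S: "topspace S \<noteq> {} \<and> compact_space S \<and> Hausdorff_space S \<and> continuous_action G T S \<phi>"
  then obtain x0 where "x0 \<in> topspace S" by blast
  then show "\<exists>x\<in>topspace S. \<forall>g\<in>carrier G. \<phi> g x = x" using S by (intro fixed_point) auto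
qed (rule top_group)

end

section \<open>The subgroup generated by a flow\<close>

lemma comm_imp_locally_solvable:
  assumes "comm_group G"
  shows "locally_solvable G"
proof -
  interpret comm_group G by (rule assms)
  have "solvable (G\<lparr>carrier := generate G F\<rparr>)" if F: "F \<subseteq> carrier G" for F
  proof -
    let ?L = "G\<lparr>carrier := generate G F\<rparr>"
    have sub: "subgroup (generate G F) G" by (rule generate_is_subgroup[OF F])
    interpret L: group ?L by (rule subgroup.subgroup_is_group[OF sub is_group])
    have "comm_group ?L"
      by (rule L.group_comm_groupI) (use subgroup.mem_carrier[OF sub] m_comm in auto)
    then have "derived ?L (carrier ?L) = {\<one>\<^bsub>?L\<^esub>}"
      by (rule comm_group.derived_eq_singleton) simp
    then have "(derived ?L ^^ 1) (carrier ?L) = {\<one>\<^bsub>?L\<^esub>}" by simp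
    then show ?thesis using L.solvable_iff_trivial_derived_seq by blast
  qed
  then show ?thesis by (simp add: locally_solvable_def is_group)
qed

lemma metric_topological_group:
  assumes "group G" "Metric_space (carrier G) d"
    and mult: "\<And>x y x' y'. x \<in> carrier G \<Longrightarrow> y \<in> carrier G \<Longrightarrow> x' \<in> carrier G \<Longrightarrow> y' \<in> carrier G \<Longrightarrow>
      d (x \<otimes>\<^bsub>G\<^esub> y) (x' \<otimes>\<^bsub>G\<^esub> y') \<le> d x x' + d y y'"
    and inv: "\<And>x y. x \<in> carrier G \<Longrightarrow> y \<in> carrier G \<Longrightarrow> d (inv\<^bsub>G\<^esub> x) (inv\<^bsub>G\<^esub> y) \<le> d x y"
  shows "topological_group G (Metric_space.mtopology (carrier G) d)"
proof -
  interpret group G by (rule assms(1))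
  interpret Metric_space "carrier G" d by (rule assms(2))
  have "continuous_map (prod_topology mtopology mtopology) mtopology (\<lambda>(x, y). x \<otimes>\<^bsub>G\<^esub> y)"
    unfolding continuous_map_to_metric
  proof (intro ballI allI impI)
    fix p and \<epsilon> :: real assume p: "p \<in> topspace (prod_topology mtopology mtopology)" and \<epsilon>: "0 < \<epsilon>"
    obtain x y where xy: "p = (x, y)" "x \<in> carrier G" "y \<in> carrier G" using p by auto
    let ?U = "mball x (\<epsilon> / 2) \<times> mball y (\<epsilon> / 2)"
    have "openin (prod_topology mtopology mtopology) ?U" by (simp add: openin_prod_Times_iff)
    moreover have "p \<in> ?U" using xy \<epsilon> by simp
    moreover have "(\<lambda>(x, y). x \<otimes>\<^bsub>G\<^esub> y) q \<in> mball ((\<lambda>(x, y). x \<otimes>\<^bsub>G\<^esub> y) p) \<epsilon>" if q: "q \<in> ?U" for q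
    proof -
      obtain x' y' where q': "q = (x', y')" "x' \<in> carrier G" "y' \<in> carrier G" "d x x' < \<epsilon> / 2" "d y y' < \<epsilon> / 2"
        using q by auto
      then show ?thesis using mult[of x y x' y'] xy by simp
    qed
    ultimately show "\<exists>U. openin (prod_topology mtopology mtopology) U \<and> p \<in> U \<and>
        (\<forall>q\<in>U. (\<lambda>(x, y). x \<otimes>\<^bsub>G\<^esub> y) q \<in> mball ((\<lambda>(x, y). x \<otimes>\<^bsub>G\<^esub> y) p) \<epsilon>)" by blast
  qed
  moreover have "continuous_map mtopology mtopology (\<lambda>x. inv\<^bsub>G\<^esub> x)"
    unfolding continuous_map_to_metric
  proof (intro ballI allI impI)
    fix x and \<epsilon> :: real assume x: "x \<in> topspace mtopology" and \<epsilon>: "0 < \<epsilon>"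
    have "openin mtopology (mball x \<epsilon>)" by simp
    moreover have "x \<in> mball x \<epsilon>" using x \<epsilon> by simp
    moreover have "inv\<^bsub>G\<^esub> y \<in> mball (inv\<^bsub>G\<^esub> x) \<epsilon>" if "y \<in> mball x \<epsilon>" for y
      using inv[of x y] that by simp
    ultimately show "\<exists>U. openin mtopology U \<and> x \<in> U \<and> (\<forall>y\<in>U. inv\<^bsub>G\<^esub> y \<in> mball (inv\<^bsub>G\<^esub> x) \<epsilon>)" by blast
  qed
  ultimately show ?thesis by (simp add: topological_group_def is_group)
qed

section \<open>The rank metric\<close>

locale subadditive_rank = ring R for R :: "('a, 'm) ring_scheme" (structure) +
  fixes \<rho> :: "'a \<Rightarrow> real"
  assumes rank: "rank_function R \<rho>" and rank_of: "rank_of R = \<rho>"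
    and rank_add: "a \<in> carrier R \<Longrightarrow> b \<in> carrier R \<Longrightarrow> \<rho> (a \<oplus> b) \<le> \<rho> a + \<rho> b"
begin

lemma rank_nonneg: "a \<in> carrier R \<Longrightarrow> 0 \<le> \<rho> a"
  using rank by (auto simp: rank_function_def PiE_iff)

lemma rank_mult: "a \<in> carrier R \<Longrightarrow> b \<in> carrier R \<Longrightarrow> \<rho> (a \<otimes> b) \<le> \<rho> a"
    "a \<in> carrier R \<Longrightarrow> b \<in> carrier R \<Longrightarrow> \<rho> (a \<otimes> b) \<le> \<rho> b"
  using rank by (auto simp: rank_function_def)

lemma rank_zero: "\<rho> \<zero> = 0"
proof -
  have "\<rho> (\<zero> \<oplus> \<zero>) = \<rho> \<zero> + \<rho> \<zero>"
    using rank unfolding rank_function_def by (metis zero_closed l_null)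
  then show ?thesis by simp
qed

lemma rank_eq_zero: "a \<in> carrier R \<Longrightarrow> \<rho> a = 0 \<longleftrightarrow> a = \<zero>"
  using rank rank_zero unfolding rank_function_def by (metis less_irrefl)

lemma rank_minus: "a \<in> carrier R \<Longrightarrow> b \<in> carrier R \<Longrightarrow> \<rho> (a \<ominus> b) = \<rho> (b \<ominus> a)"
proof -
  have le: "\<rho> (\<ominus> x) \<le> \<rho> x" if "x \<in> carrier R" for x
    using rank_mult(2)[of "\<ominus> \<one>" x] that by (simp add: l_minus)
  assume ab: "a \<in> carrier R" "b \<in> carrier R"
  then have "\<ominus> (a \<ominus> b) = b \<ominus> a" "\<ominus> (b \<ominus> a) = a \<ominus> b"
    by (simp_all add: minus_eq minus_add a_comm)
  then show ?thesis using le[of "a \<ominus> b"] le[of "b \<ominus> a"] ab by (simp add: minus_eq)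
qed

lemma rank_dist_eq: "a \<in> carrier R \<Longrightarrow> b \<in> carrier R \<Longrightarrow> rank_dist R a b = \<rho> (a \<ominus> b)"
  by (simp add: rank_dist_def rank_of)

sublocale metric: Metric_space "carrier R" "rank_dist R"
proof
  show "0 \<le> rank_dist R a b" for a b
    by (simp add: rank_dist_def rank_of rank_nonneg minus_eq)
  show "rank_dist R a b = rank_dist R b a" for a b
    by (simp add: rank_dist_def rank_of rank_minus)
  show "rank_dist R a b = 0 \<longleftrightarrow> a = b" if "a \<in> carrier R" "b \<in> carrier R" for a b
    using that by (simp add: rank_dist_eq rank_eq_zero)
  show "rank_dist R a c \<le> rank_dist R a b + rank_dist R b c"
    if "a \<in> carrier R" "b \<in> carrier R" "c \<in> carrier R" for a b c
  proof -
    have "(a \<ominus> b) \<oplus> (b \<ominus> c) = a \<ominus> c"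
      using that by (simp add: minus_eq a_assoc) (metis a_assoc a_inv_closed l_neg l_zero)
    then show ?thesis using rank_add[of "a \<ominus> b" "b \<ominus> c"] that by (simp add: rank_dist_eq)
  qed
qed

lemma topology: "rank_topology R = metric.mtopology"
  by (simp add: rank_topology_def)

lemma rank_dist_mult:
  assumes "a \<in> carrier R" "b \<in> carrier R" "c \<in> carrier R" "d \<in> carrier R"
  shows "rank_dist R (a \<otimes> b) (c \<otimes> d) \<le> rank_dist R a c + rank_dist R b d"
proof -
  have "rank_dist R (a \<otimes> b) (c \<otimes> b) \<le> rank_dist R a c"
    using rank_mult(1)[of "a \<ominus> c" b] assms by (simp add: rank_dist_eq minus_eq l_distr l_minus)
  moreover have "rank_dist R (c \<otimes> b) (c \<otimes> d) \<le> rank_dist R b d"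
    using rank_mult(2)[of c "b \<ominus> d"] assms by (simp add: rank_dist_eq minus_eq r_distr r_minus)
  ultimately show ?thesis using metric.triangle[of "a \<otimes> b" "c \<otimes> b" "c \<otimes> d"] assms by simp
qed

text \<open>With \<open>c\<close> inverse to \<open>a\<close> and \<open>d\<close> to
  \<open>b\<close>, the identity \<open>c - d = c (b - a) d\<close> reduces the claim to
  monotonicity of the rank under products.\<close>

lemma rank_dist_inv:
  assumes "a \<in> carrier R" "b \<in> carrier R" "c \<in> carrier R" "d \<in> carrier R" "c \<otimes> a = \<one>" "b \<otimes> d = \<one>"
  shows "rank_dist R c d \<le> rank_dist R a b"
proof -
  have "c \<otimes> (b \<ominus> a) \<otimes> d = c \<ominus> d"
  proof -
    have "c \<otimes> (b \<ominus> a) \<otimes> d = c \<otimes> (b \<otimes> d) \<ominus> (c \<otimes> a) \<otimes> d"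
      using assms(1-4) by (simp add: minus_eq r_distr l_distr r_minus l_minus m_assoc)
    then show ?thesis using assms by simp
  qed
  moreover have "\<rho> (c \<otimes> (b \<ominus> a) \<otimes> d) \<le> \<rho> (b \<ominus> a)"
    using rank_mult(1)[of "c \<otimes> (b \<ominus> a)" d] rank_mult(2)[of c "b \<ominus> a"] assms(1-4) by simp
  ultimately show ?thesis using assms(1-4) by (simp add: rank_dist_eq rank_minus)
qed

lemma discrete_topology:
  assumes "0 < \<epsilon>" "\<And>a. a \<in> carrier R \<Longrightarrow> a \<noteq> \<zero> \<Longrightarrow> \<epsilon> \<le> \<rho> a"
  shows "rank_topology R = discrete_topology (carrier R)"
proof -
  have "openin metric.mtopology {a}" if a: "a \<in> carrier R" for a
  proof -
    have "metric.mball a \<epsilon> = {a}"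
    proof (intro equalityI subsetI)
      fix b assume "b \<in> metric.mball a \<epsilon>"
      then have b: "b \<in> carrier R" "\<rho> (a \<ominus> b) < \<epsilon>" by (auto simp: rank_dist_eq)
      then have "a \<ominus> b = \<zero>" using assms(2)[of "a \<ominus> b"] a by force
      then show "b \<in> {a}" using a b by (simp add: r_right_minus_eq)
    qed (use a assms(1) in simp)
    then show ?thesis using metric.openin_mball[of a \<epsilon>] by simp
  qed
  then show ?thesis unfolding topology
    by (metis discrete_topology_unique metric.topspace_mtopology)
qed

section \<open>The group of a flow\<close>

context
  fixes a :: 'a and u :: "nat \<Rightarrow> (nat \<Rightarrow> int) \<Rightarrow> 'a" and C :: real
  assumes flow: "unit_flow R \<rho> a u C"
begin

lemma flow_closed: "u n z \<in> carrier R"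
  and flow_mult: "u n z \<otimes> u n z' = u n (\<lambda>k. z k + z' k)"
  and flow_zero: "u n (\<lambda>_. 0) = \<one>"
  and flow_one: "u 0 (\<lambda>_. 1) = a"
  and flow_refine: "u n z = u (Suc n) (\<lambda>k. z (k div 2))"
  and flow_rank: "\<rho> (u n z \<ominus> u n z') \<le> C / 2 ^ n * real (card {k. k < 2 ^ n \<and> z k \<noteq> z' k})"
  using flow unfolding unit_flow_def by blast+

definition flow_set where "flow_set = {u n z | n z. True}"

lemma flow_refine_le: "n \<le> m \<Longrightarrow> \<exists>z'. u n z = u m z'"
  by (induction m rule: dec_induct) (metis flow_refine)+

text \<open>At a fixed level products are given by adding vectors, so passing to the larger level
  yields closure and commutativity.\<close>

lemma flow_common:
  assumes "x \<in> flow_set" "y \<in> flow_set"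
  obtains n z z' where "x = u n z" "y = u n z'"
proof -
  obtain n z m z' where "x = u n z" "y = u m z'" using assms by (auto simp: flow_set_def)
  then show thesis using that[of "max n m"] flow_refine_le[of n "max n m" z] flow_refine_le[of m "max n m" z']
    by (metis max.cobounded1 max.cobounded2)
qed

lemma flow_inverse: "u n z \<otimes> u n (\<lambda>k. - z k) = \<one>" "u n (\<lambda>k. - z k) \<otimes> u n z = \<one>"
  by (simp_all add: flow_mult flow_zero)

lemma flow_Units: "u n z \<in> Units R"
  unfolding Units_def using flow_inverse flow_closed by blast

lemma flow_inv: "inv u n z = u n (\<lambda>k. - z k)"
  using inv_unique'[OF flow_closed flow_closed flow_inverse] by simp

lemma flow_subgroup: "subgroup flow_set (units_of R)"
proof (rule group.subgroupI[OF units_group])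
  show "flow_set \<subseteq> carrier (units_of R)" using flow_Units by (auto simp: flow_set_def units_of_carrier)
  show "flow_set \<noteq> {}" by (auto simp: flow_set_def)
  show "inv\<^bsub>units_of R\<^esub> x \<in> flow_set" if x: "x \<in> flow_set" for x
  proof -
    obtain n z where "x = u n z" using x by (auto simp: flow_set_def)
    then have "inv\<^bsub>units_of R\<^esub> x = u n (\<lambda>k. - z k)" using flow_Units by (simp add: units_of_inv flow_inv)
    then show ?thesis unfolding flow_set_def by blast
  qed
  show "x \<otimes>\<^bsub>units_of R\<^esub> y \<in> flow_set" if xy: "x \<in> flow_set" "y \<in> flow_set" for x y
  proof -
    obtain n z z' where "x = u n z" "y = u n z'" using flow_common[OF xy] .
    then show ?thesis using flow_mult[of n z z'] by (auto simp: flow_set_def units_of_mult)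
  qed
qed

lemma flow_group: "group ((units_of R)\<lparr>carrier := flow_set\<rparr>)"
  by (rule subgroup.subgroup_is_group[OF flow_subgroup units_group])

lemma flow_comm_group: "comm_group ((units_of R)\<lparr>carrier := flow_set\<rparr>)"
proof (rule group.group_comm_groupI[OF flow_group])
  fix x y assume "x \<in> carrier ((units_of R)\<lparr>carrier := flow_set\<rparr>)" "y \<in> carrier ((units_of R)\<lparr>carrier := flow_set\<rparr>)"
  then have xy: "x \<in> flow_set" "y \<in> flow_set" by simp_all
  obtain n z z' where "x = u n z" "y = u n z'" using flow_common[OF xy] .
  then show "x \<otimes>\<^bsub>(units_of R)\<lparr>carrier := flow_set\<rparr>\<^esub> y = y \<otimes>\<^bsub>(units_of R)\<lparr>carrier := flow_set\<rparr>\<^esub> x"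
    by (simp add: units_of_mult flow_mult add.commute)
qed

lemma flow_set_carrier: "flow_set \<subseteq> carrier R"
  using flow_closed by (auto simp: flow_set_def)

lemma flow_topology: "subtopology (rank_topology R) flow_set = Metric_space.mtopology flow_set (rank_dist R)"
proof -
  interpret Submetric "carrier R" "rank_dist R" flow_set
    by unfold_locales (rule flow_set_carrier)
  show ?thesis by (simp add: topology mtopology_submetric)
qed

lemma flow_topological_group:
  "topological_group ((units_of R)\<lparr>carrier := flow_set\<rparr>) (subtopology (rank_topology R) flow_set)"
proof -
  let ?G = "(units_of R)\<lparr>carrier := flow_set\<rparr>"
  have "topological_group ?G (Metric_space.mtopology (carrier ?G) (rank_dist R))"
  proof (rule metric_topological_group[OF flow_group])
    show "Metric_space (carrier ?G) (rank_dist R)" using metric.subspace[OF flow_set_carrier] by simp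
    show "rank_dist R (x \<otimes>\<^bsub>?G\<^esub> y) (x' \<otimes>\<^bsub>?G\<^esub> y') \<le> rank_dist R x x' + rank_dist R y y'"
      if "x \<in> carrier ?G" "y \<in> carrier ?G" "x' \<in> carrier ?G" "y' \<in> carrier ?G" for x y x' y'
      using that flow_set_carrier by (auto simp: units_of_mult intro!: rank_dist_mult)
    show "rank_dist R (inv\<^bsub>?G\<^esub> x) (inv\<^bsub>?G\<^esub> y) \<le> rank_dist R x y" if xy: "x \<in> carrier ?G" "y \<in> carrier ?G" for x y
    proof -
      obtain n z m z' where x: "x = u n z" and y: "y = u m z'" using xy by (auto simp: flow_set_def)
      have mem: "u n z \<in> flow_set" "u m z' \<in> flow_set" by (auto simp: flow_set_def)
      have "inv\<^bsub>?G\<^esub> x = u n (\<lambda>k. - z k)" "inv\<^bsub>?G\<^esub> y = u m (\<lambda>k. - z' k)"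
        unfolding x y using group.m_inv_consistent[OF units_group flow_subgroup] mem
        by (simp_all add: units_of_inv flow_Units flow_inv)
      then show ?thesis unfolding x y
        by (simp add: rank_dist_inv[OF flow_closed flow_closed flow_closed flow_closed flow_inverse(2) flow_inverse(1)])
    qed
  qed
  then show ?thesis by (simp add: flow_topology)
qed

lemma flow_extremely_amenable:
  "extremely_amenable ((units_of R)\<lparr>carrier := flow_set\<rparr>) (subtopology (rank_topology R) flow_set)"
proof -
  let ?G = "(units_of R)\<lparr>carrier := flow_set\<rparr>" and ?T = "subtopology (rank_topology R) flow_set"
  interpret levy_group ?G ?T u
  proof
    show "topological_group ?G ?T" by (rule flow_topological_group)
    show "carrier ?G = {u n z | n z. True}" by (simp add: flow_set_def)
    show "u n z \<otimes>\<^bsub>?G\<^esub> u n z' = u n (\<lambda>k. z k + z' k)" for n z z' by (simp add: units_of_mult flow_mult)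
    show "u n (\<lambda>_. 0) = \<one>\<^bsub>?G\<^esub>" for n by (simp add: units_of_one flow_zero)
    show "u n z = u (Suc n) (\<lambda>k. z (k div 2))" for n z by (rule flow_refine)
    show "u n z = u n z'" if "\<And>k. k < 2 ^ n \<Longrightarrow> z k = z' k" for n z z'
    proof -
      have "{k. k < 2 ^ n \<and> z k \<noteq> z' k} = {}" using that by blast
      then have "\<rho> (u n z \<ominus> u n z') \<le> 0" using flow_rank[of n z z'] by (simp only: card.empty)
      moreover have "0 \<le> \<rho> (u n z \<ominus> u n z')" by (intro rank_nonneg minus_closed flow_closed)
      ultimately have "\<rho> (u n z \<ominus> u n z') = 0" by (rule order_antisym)
      then show ?thesis using flow_closed by (simp add: rank_eq_zero)
    qed
    fix V assume V: "openin ?T V" "\<one>\<^bsub>?G\<^esub> \<in> V"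
    have "openin (Metric_space.mtopology flow_set (rank_dist R)) V" using V by (simp add: flow_topology)
    then obtain r where r: "0 < r" "Metric_space.mball flow_set (rank_dist R) \<one> r \<subseteq> V"
      using V(2) by (auto simp: Metric_space.openin_mtopology[OF metric.subspace[OF flow_set_carrier]] units_of_one)
    \<comment> \<open>The distance to \<open>\<one>\<close> is at most \<open>\<bar>C\<bar>\<close>
      times the proportion of nonzero coordinates; the summand \<open>1\<close> avoids division by
      zero and makes the inequality strict.\<close>
    define \<delta> where "\<delta> = r / (\<bar>C\<bar> + 1)"
    have "u n z \<in> V" if z: "real (card {k. k < 2 ^ n \<and> z k \<noteq> 0}) \<le> \<delta> * 2 ^ n" for n z
    proof -
      have "rank_dist R \<one> (u n z) = \<rho> (u n z \<ominus> u n (\<lambda>_. 0))"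
        using flow_closed by (simp add: rank_dist_eq flow_zero rank_minus)
      also have "\<dots> \<le> C / 2 ^ n * real (card {k. k < 2 ^ n \<and> z k \<noteq> 0})" by (rule flow_rank)
      also have "\<dots> \<le> \<bar>C\<bar> / 2 ^ n * (\<delta> * 2 ^ n)"
        using z by (intro mult_mono divide_right_mono) auto
      also have "\<dots> = \<bar>C\<bar> * r / (\<bar>C\<bar> + 1)" by (simp add: \<delta>_def)
      also have "\<dots> < r" using r(1) by (simp add: divide_less_eq)
      finally have "rank_dist R \<one> (u n z) < r" .
      moreover have "\<one> \<in> flow_set" "u n z \<in> flow_set" unfolding flow_set_def using flow_zero[of 0] by (metis (mono_tags, lifting) mem_Collect_eq)+
      ultimately have "u n z \<in> Metric_space.mball flow_set (rank_dist R) \<one> r"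
        by (simp add: Metric_space.in_mball[OF metric.subspace[OF flow_set_carrier]])
      then show ?thesis using r(2) by blast
    qed
    moreover have "0 < \<delta>" using r(1) by (simp add: \<delta>_def add_nonneg_pos)
    ultimately show "\<exists>\<delta>>0. \<forall>n z. real (card {k. k < 2 ^ n \<and> z k \<noteq> 0}) \<le> \<delta> * 2 ^ n \<longrightarrow> u n z \<in> V" by blast
  qed
  show ?thesis by (rule extremely_amenable)
qed

lemma flow_contains: "a \<in> flow_set"
  using flow_one by (auto simp: flow_set_def)

end

end

theorem corollary1p5:
  fixes R :: "('a, 'm) ring_scheme" and a :: 'a
  assumes "continuous_ring R" and "irreducible_ring R" and "non_discrete_ring R"
    and "a \<in> Units R" and "algebraic_over_center R a"
  shows "\<exists>H. subgroup H (units_of R) \<and> a \<in> H \<and>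
           locally_solvable ((units_of R)\<lparr>carrier := H\<rparr>) \<and>
           extremely_amenable ((units_of R)\<lparr>carrier := H\<rparr>) (subtopology (rank_topology R) H)"
proof -
  obtain \<rho> where rank: "rank_function R \<rho>" and uniq: "\<And>\<rho>'. rank_function R \<rho>' \<Longrightarrow> \<rho>' = \<rho>"
    and add: "\<And>a b. a \<in> carrier R \<Longrightarrow> b \<in> carrier R \<Longrightarrow> \<rho> (a \<oplus>\<^bsub>R\<^esub> b) \<le> \<rho> a + \<rho> b"
    and dich: "(\<exists>\<epsilon>>0. \<forall>a\<in>carrier R. a \<noteq> \<zero>\<^bsub>R\<^esub> \<longrightarrow> \<epsilon> \<le> \<rho> a) \<or>
      (\<forall>a. a \<in> Units R \<and> algebraic_over_center R a \<longrightarrow> (\<exists>u C. unit_flow R \<rho> a u C))"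
    using continuous_irreducible_flow_ring[OF assms(1,2)] unfolding flow_ring_def by metis
  interpret ring R using assms(2) by (simp add: irreducible_ring_def)
  interpret subadditive_rank R \<rho>
  proof
    show "rank_of R = \<rho>" unfolding rank_of_def using rank uniq by (rule the_equality)
  qed (rule rank add; assumption?)+
  \<comment> \<open>A positive lower bound for nonzero ranks would make small balls singletons and
    the topology discrete, so the second alternative of \<open>dich\<close> remains.\<close>
  have "\<nexists>\<epsilon>. \<epsilon> > 0 \<and> (\<forall>a\<in>carrier R. a \<noteq> \<zero>\<^bsub>R\<^esub> \<longrightarrow> \<epsilon> \<le> \<rho> a)"
    using discrete_topology assms(3) unfolding non_discrete_ring_def by blast
  then obtain u C where flow: "unit_flow R \<rho> a u C" using dich assms(4,5) by blast
  show ?thesis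
    using flow_subgroup[OF flow] flow_contains[OF flow] flow_extremely_amenable[OF flow]
      comm_imp_locally_solvable[OF flow_comm_group[OF flow]] by blast
qed

end
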